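(* Let $K$ be a discrete valuation field with valuation ring $\mathcal{O}_K$, normalised valuation $v$ and uniformiser $\pi$. Let $\Phi, \Phi' \in X_5(\mathcal{O}_K)$ be Pfaffian models with $v(\Delta(\Phi)) \le 1$ and $v(\Delta(\Phi')) \le 1$. If $\Phi' = [A,B]\Phi$ for some $A,B \in \mathrm{GL}_5(K)$, then $A,B \in K^\times \mathrm{GL}_5(\mathcal{O}_K)$. In particular: (i) if $\Phi$ and $\Phi'$ are $K$-equivalent then they are $\mathcal{O}_K$-equivalent; (ii) the stabiliser of $\Phi$ in $\mathrm{GL}_5(K)\times\mathrm{GL}_5(K)$ is contained in the subgroup generated by $\mathrm{GL}_5(\mathcal{O}_K)\times\mathrm{GL}_5(\mathcal{O}_K)$ and $[\pi^{-1}I_5, \pi^2 I_5]$.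
   Context: A Pfaffian model over a commutative ring $R$ is a $5\times5$ alternating matrix $\Phi=(\Phi_{ij})$ whose entries are linear forms in $R[x_1,\dots,x_5]$; $X_5(R)$ denotes the set of these. For $A,B\in\mathrm{GL}_5(R)$, the model $[A,B]\Phi$ is obtained by replacing $\Phi$ by $A\Phi A^T$ and substituting $x_j' = \sum_{i=1}^5 B_{ij}x_i$ for $x_j$, i.e. $(\Phi_{ij}(x_1,\dots,x_5))\mapsto(\Phi_{ij}(x_1',\dots,x_5'))$. We set $\det[A,B]=(\det A)^2\det B$. Two models are $R$-equivalent if one is $[A,B]$ applied to the other with $A,B\in\mathrm{GL}_5(R)$. For a field $F$ and $\Phi\in X_5(F)$, $C_\Phi\subset\mathbb{P}^4_F$ is the subscheme defined by the $4\times4$ Pfaffians of $\Phi$, and $\Phi$ is nonsingular if $C_\Phi$ is a smooth curve of genus one. The discriminant $\Delta\in\mathbb{Z}[X_5]$ is the standard discriminant invariant of Pfaffian models (as normalised by Fisher): an integer-coefficient polynomial of degree $60$ in the $50$ coefficients of a model, satisfying $\Delta(g\Phi)=(\det g)^{12}\Delta(\Phi)$, with $\Delta(\Phi)\neq0$ iff $\Phi$ is nonsingular, and such that for nonsingular $\Phi$ over a field $\Delta(\Phi)$ is the discriminant of a Weierstrass equation for the Jacobian of $C_\Phi$ (with $c_4^3-c_6^2=1728\Delta$ for companion invariants $c_4,c_6$ of degrees $20,30$). Here $v(0)=+\infty$. *)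

theory Defs
  imports
    "HOL-Analysis.Analysis"
    "HOL-Algebra.Generated_Groups"
    "HOL-Library.Poly_Mapping"
    "HOL-Library.Extended"
    "HOL-Computational_Algebra.Polynomial"
    "HOL-Computational_Algebra.Fundamental_Theorem_Algebra"
begin

section \<open>Multivariate polynomials\<close>

type_synonym ('x, 'a) mvpoly = "('x \<Rightarrow>\<^sub>0 nat) \<Rightarrow>\<^sub>0 'a"

definition eval_mvpoly :: "('a::zero \<Rightarrow> 'b::comm_semiring_1) \<Rightarrow> ('x \<Rightarrow> 'b) \<Rightarrow> ('x, 'a) mvpoly \<Rightarrow> 'b"
  where "eval_mvpoly h x p =
    (\<Sum>m\<in>Poly_Mapping.keys p. h (Poly_Mapping.lookup p m) * (\<Prod>i\<in>Poly_Mapping.keys m. x i ^ Poly_Mapping.lookup m i))"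

definition homogeneous :: "nat \<Rightarrow> ('x, 'a::zero) mvpoly \<Rightarrow> bool"
  where "homogeneous d p \<longleftrightarrow> (\<forall>m\<in>Poly_Mapping.keys p. (\<Sum>i\<in>Poly_Mapping.keys m. Poly_Mapping.lookup m i) = d)"

definition partial_deriv :: "'x \<Rightarrow> ('x, 'a::comm_semiring_1) mvpoly \<Rightarrow> ('x, 'a) mvpoly"
  where "partial_deriv k p =
    (\<Sum>m\<in>Poly_Mapping.keys p. Poly_Mapping.single (m - Poly_Mapping.single k 1) (of_nat (Poly_Mapping.lookup m k) * Poly_Mapping.lookup p m))"

definition scale_mvpoly :: "'a::comm_semiring_1 \<Rightarrow> ('x, 'a) mvpoly \<Rightarrow> ('x, 'a) mvpoly"
  where "scale_mvpoly c p = Poly_Mapping.single 0 c * p"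


section \<open>Pfaffian models and the group action\<close>

text \<open>The index type 5 has the elements 0, 1, 2, 3, 4 (with arithmetic modulo 5), so indices
  and variables are numbered from 0. A linear form is its vector of coefficients:
  \<open>\<Phi> $ i $ j $ k\<close> is the coefficient of \<open>x\<^sub>k\<close> in the entry \<open>\<Phi>\<^sub>i\<^sub>j\<close>.\<close>

type_synonym 'a linear_form = "'a^5"
type_synonym 'a model = "'a linear_form^5^5"

text \<open>In the following, \<open>R\<close> is the carrier of a subring of the ambient ring.\<close>

definition pfaffian_models :: "'a::comm_ring_1 set \<Rightarrow> 'a model set"  (\<open>X\<^sub>5\<close>)
  where "X\<^sub>5 R = {\<Phi>. (\<forall>i. \<Phi> $ i $ i = 0) \<and> (\<forall>i j. \<Phi> $ j $ i = - (\<Phi> $ i $ j)) \<and>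
                  (\<forall>i j k. \<Phi> $ i $ j $ k \<in> R)}"

definition GL5 :: "'a::comm_ring_1 set \<Rightarrow> ('a^5^5) set"
  where "GL5 R = {A. (\<forall>i j. A $ i $ j \<in> R) \<and>
     (\<exists>A'. (\<forall>i j. A' $ i $ j \<in> R) \<and> A ** A' = mat 1 \<and> A' ** A = mat 1)}"

definition GL5_group :: "'a::comm_ring_1 set \<Rightarrow> ('a^5^5) monoid"
  where "GL5_group R = \<lparr>carrier = GL5 R, mult = (**), one = mat 1\<rparr>"

text \<open>Substituting \<open>\<Sum>\<^sub>i B\<^sub>i\<^sub>j x\<^sub>i\<close> for \<open>x\<^sub>j\<close> in the linear form with coefficient vector \<open>c\<close>
  gives the linear form with coefficient vector \<open>B *v c\<close>.\<close>

definition act :: "'a::comm_ring_1^5^5 \<Rightarrow> 'a^5^5 \<Rightarrow> 'a model \<Rightarrow> 'a model"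
  where "act A B \<Phi> = (\<chi> i j. B *v (\<Sum>r\<in>UNIV. \<Sum>s\<in>UNIV. (A $ i $ r * A $ j $ s) *s (\<Phi> $ r $ s)))"

definition act_det :: "'a::comm_ring_1^5^5 \<Rightarrow> 'a^5^5 \<Rightarrow> 'a"
  where "act_det A B = (det A)\<^sup>2 * det B"

definition equivalent_over :: "'a::comm_ring_1 set \<Rightarrow> 'a model \<Rightarrow> 'a model \<Rightarrow> bool"
  where "equivalent_over R \<Phi> \<Phi>' \<longleftrightarrow> (\<exists>A\<in>GL5 R. \<exists>B\<in>GL5 R. \<Phi>' = act A B \<Phi>)"

definition stabiliser :: "'a::comm_ring_1 set \<Rightarrow> 'a model \<Rightarrow> (('a^5^5) \<times> ('a^5^5)) set"
  where "stabiliser R \<Phi> = {(A, B) \<in> GL5 R \<times> GL5 R. act A B \<Phi> = \<Phi>}"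


section \<open>The curve defined by a model\<close>

definition form_poly :: "'a::comm_ring_1 linear_form \<Rightarrow> (5, 'a) mvpoly"
  where "form_poly c = (\<Sum>k\<in>UNIV. Poly_Mapping.single (Poly_Mapping.single k 1) (c $ k))"

text \<open>The Pfaffian of the submatrix obtained by deleting row and column \<open>i\<close>; the remaining
  indices are taken in the cyclic order \<open>i+1, i+2, i+3, i+4\<close>, which affects at most its sign.\<close>

definition pfaffian :: "'a::comm_ring_1 model \<Rightarrow> 5 \<Rightarrow> (5, 'a) mvpoly"
  where "pfaffian \<Phi> i =
    (let F = (\<lambda>r s. form_poly (\<Phi> $ (i + r) $ (i + s)))
     in F 1 2 * F 3 4 - F 1 3 * F 2 4 + F 1 4 * F 2 3)"

text \<open>Homogeneous coordinate vectors of the points of \<open>C\<^sub>\<Phi>\<close> over an algebraically closed field.\<close>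

definition curve_points :: "'a::alg_closed_field model \<Rightarrow> ('a^5) set"
  where "curve_points \<Phi> = {x. x \<noteq> 0 \<and> (\<forall>i. eval_mvpoly id (($) x) (pfaffian \<Phi> i) = 0)}"

definition jacobian_matrix :: "'a::alg_closed_field model \<Rightarrow> 'a^5 \<Rightarrow> 'a^5^5"
  where "jacobian_matrix \<Phi> x = (\<chi> i k. eval_mvpoly id (($) x) (partial_deriv k (pfaffian \<Phi> i)))"

definition irreducible_curve :: "'a::alg_closed_field model \<Rightarrow> bool"
  where "irreducible_curve \<Phi> \<longleftrightarrow> curve_points \<Phi> \<noteq> {} \<and>
    (\<forall>f g. (\<forall>x\<in>curve_points \<Phi>. eval_mvpoly id (($) x) (f * g) = 0) \<longrightarrow>
       (\<forall>x\<in>curve_points \<Phi>. eval_mvpoly id (($) x) f = 0) \<or>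
       (\<forall>x\<in>curve_points \<Phi>. eval_mvpoly id (($) x) g = 0))"

text \<open>The Hilbert function of the homogeneous coordinate ring of \<open>C\<^sub>\<Phi>\<close>.\<close>

definition hilbert_function :: "'a::alg_closed_field model \<Rightarrow> nat \<Rightarrow> int"
  where "hilbert_function \<Phi> d =
    int (vector_space.dim scale_mvpoly {f :: (5, 'a) mvpoly. homogeneous d f}) -
    int (vector_space.dim scale_mvpoly
      {f. homogeneous d f \<and> (\<exists>q. f = (\<Sum>i\<in>UNIV. q i * pfaffian \<Phi> i))})"

text \<open>A projective scheme is a curve of arithmetic genus \<open>g\<close> iff its Hilbert polynomial is
  \<open>n d + 1 - g\<close> for some \<open>n > 0\<close> (its degree).\<close>

definition has_arithmetic_genus :: "'a::alg_closed_field model \<Rightarrow> int \<Rightarrow> bool"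
  where "has_arithmetic_genus \<Phi> g \<longleftrightarrow>
    (\<exists>n>0. \<forall>\<^sub>F d in sequentially. hilbert_function \<Phi> d = n * int d + 1 - g)"

text \<open>Smoothness is the projective Jacobian criterion: the rank is the codimension 3 of a curve
  in projective 4-space at every point.\<close>

definition nonsingular :: "'a::alg_closed_field model \<Rightarrow> bool"
  where "nonsingular \<Phi> \<longleftrightarrow>
    irreducible_curve \<Phi> \<and> has_arithmetic_genus \<Phi> 1 \<and>
    (\<forall>x\<in>curve_points \<Phi>. rank (jacobian_matrix \<Phi> x) = 3)"


section \<open>Invariants and the discriminant\<close>

text \<open>The variable \<open>(i, j, k)\<close>, for \<open>i < j\<close>, stands for the coefficient of \<open>x\<^sub>k\<close> in \<open>\<Phi>\<^sub>i\<^sub>j\<close>.\<close>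

type_synonym model_poly = "(5 \<times> 5 \<times> 5, int) mvpoly"

definition model_polys :: "model_poly set" 
  where "model_polys = {p. \<forall>m\<in>Poly_Mapping.keys p. Poly_Mapping.keys m \<subseteq> {(i, j, k). i < j}}"

definition eval_model :: "model_poly \<Rightarrow> 'a::comm_ring_1 model \<Rightarrow> 'a"
  where "eval_model p \<Phi> = eval_mvpoly of_int (\<lambda>(i, j, k). \<Phi> $ i $ j $ k) p"

text \<open>An identity between integer polynomials holds over every commutative ring as soon as it
  holds over the complex numbers.\<close>

definition invariant_of_weight :: "nat \<Rightarrow> model_poly \<Rightarrow> bool"
  where "invariant_of_weight w p \<longleftrightarrow>
    (\<forall>\<Phi> \<in> X\<^sub>5 (UNIV :: complex set). \<forall>A\<in>GL5 UNIV. \<forall>B\<in>GL5 UNIV.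
       eval_model p (act A B \<Phi>) = act_det A B ^ w * eval_model p \<Phi>)"

text \<open>The Pfaffian model of the curve
  \<open>y\<^sup>2 + a\<^sub>1xy + a\<^sub>3y = x\<^sup>3 + a\<^sub>2x\<^sup>2 + a\<^sub>4x + a\<^sub>6\<close> embedded by
  \<open>(x\<^sub>0 : x\<^sub>1 : x\<^sub>2 : x\<^sub>3 : x\<^sub>4) = (1 : x : y : x\<^sup>2 : xy)\<close>. Its Pfaffians are, up to sign,
  the minors of \<open>(x\<^sub>0, x\<^sub>1, x\<^sub>2; x\<^sub>1, x\<^sub>3, x\<^sub>4)\<close>, the Weierstrass equation, and \<open>x\<close> times it.\<close>

definition weierstrass_model :: "'a::comm_ring_1 \<Rightarrow> 'a \<Rightarrow> 'a \<Rightarrow> 'a \<Rightarrow> 'a \<Rightarrow> 'a model"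
  where "weierstrass_model a1 a2 a3 a4 a6 =
    (let x = (\<lambda>k::5. axis k (1::'a));
         U = (\<lambda>(i::5) (j::5).
           if (i, j) = (0, 2) then x 0
           else if (i, j) = (0, 3) then x 1
           else if (i, j) = (0, 4) then x 2
           else if (i, j) = (1, 2) then x 1
           else if (i, j) = (1, 3) then x 3
           else if (i, j) = (1, 4) then x 4
           else if (i, j) = (2, 3) then x 2 + a1 *s x 1 + a3 *s x 0
           else if (i, j) = (2, 4) then x 3 + a2 *s x 1 + a4 *s x 0
           else if (i, j) = (3, 4) then - (a6 *s x 0)
           else 0)
     in \<chi> i j. U i j - U j i)"

definition weierstrass_discriminant :: "'a::comm_ring_1 \<Rightarrow> 'a \<Rightarrow> 'a \<Rightarrow> 'a \<Rightarrow> 'a \<Rightarrow> 'a"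
  where "weierstrass_discriminant a1 a2 a3 a4 a6 =
    (let b2 = a1\<^sup>2 + 4 * a2;
         b4 = 2 * a4 + a1 * a3;
         b6 = a3\<^sup>2 + 4 * a6;
         b8 = a1\<^sup>2 * a6 + 4 * a2 * a6 - a1 * a3 * a4 + a2 * a3\<^sup>2 - a4\<^sup>2
     in - (b2\<^sup>2 * b8) - 8 * b4 ^ 3 - 27 * b6\<^sup>2 + 9 * b2 * b4 * b6)"

text \<open>The following properties determine the discriminant of Pfaffian models uniquely. The
  invariants of degree 60 over the complex numbers are the linear combinations of \<open>c\<^sub>4\<^sup>3\<close> and
  \<open>c\<^sub>6\<^sup>2\<close>; vanishing on singular models leaves one up to a scalar, and its values on the models
  of Weierstrass equations fix the scalar.\<close>

definition is_discriminant :: "model_poly \<Rightarrow> bool"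
  where "is_discriminant D \<longleftrightarrow>
    D \<in> model_polys \<and> homogeneous 60 D \<and> invariant_of_weight 12 D \<and>
    (\<forall>\<Phi> \<in> X\<^sub>5 (UNIV :: complex set). eval_model D \<Phi> \<noteq> 0 \<longleftrightarrow> nonsingular \<Phi>) \<and>
    (\<forall>a1 a2 a3 a4 a6 :: complex.
       eval_model D (weierstrass_model a1 a2 a3 a4 a6) = weierstrass_discriminant a1 a2 a3 a4 a6) \<and>
    (\<exists>c4\<in>model_polys. \<exists>c6\<in>model_polys.
       homogeneous 20 c4 \<and> invariant_of_weight 4 c4 \<and>
       homogeneous 30 c6 \<and> invariant_of_weight 6 c6 \<and>
       c4 ^ 3 - c6 ^ 2 = 1728 * D)"


section \<open>Discrete valuations\<close>

definition normalised_discrete_valuation :: "('k::field \<Rightarrow> int extended) \<Rightarrow> bool"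
  where "normalised_discrete_valuation v \<longleftrightarrow>
    (\<forall>x. v x = Pinf \<longleftrightarrow> x = 0) \<and> (\<forall>x. v x \<noteq> Minf) \<and>
    (\<forall>x y. v (x * y) = v x + v y) \<and>
    (\<forall>x y. min (v x) (v y) \<le> v (x + y)) \<and>
    (\<exists>x. v x = Fin 1)"

definition valuation_ring :: "('k::field \<Rightarrow> int extended) \<Rightarrow> 'k set"
  where "valuation_ring v = {x. Fin 0 \<le> v x}"

definition scalar_GL5 :: "'k::field set \<Rightarrow> ('k^5^5) set"
  where "scalar_GL5 R = {mat c ** A | c A. c \<noteq> 0 \<and> A \<in> GL5 R}"

end

theory Submission
  imports Defs
begin

text \<open>By the Smith normal form we may assume \<open>A = diag(\<pi>\<^bsup>r\<^sub>i\<^esup>)\<close> and \<open>B = diag(\<pi>\<^bsup>s\<^sub>k\<^esup>)\<close>, where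
  \<open>2 \<Sum> r + \<Sum> s = 0\<close> because both discriminants have valuation 0 or 1. Integrality of both models says
  that the coefficient of \<open>x\<^sub>k\<close> in \<open>\<Phi>\<^sub>i\<^sub>j\<close> has valuation at least \<open>max(0, -t)\<close> with \<open>t = r\<^sub>i + r\<^sub>j + s\<^sub>k\<close>.
  It suffices that every monomial of the discriminant has total weight at least 2 with respect to \<open>max(0, -t)\<close>
  unless \<open>r\<close> and \<open>s\<close> are constant; if there is a pentagon in the sense below, it suffices to show this for the
  monomials of the Taylor expansion at it. These are statements about integer polynomials, hence about complex models.

  If \<open>c\<^sub>4\<close> or \<open>c\<^sub>6\<close> has a monomial in coefficients with \<open>t \<ge> 0\<close> only, then \<open>t = 0\<close> for all of them, and
  invariance under the two general linear groups shows that the numbers \<open>-s\<^sub>k\<close> are the sums of \<open>r\<close> over the edges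
  of graphs on five vertices whose degrees average to 2. The most regular such graph is a pentagon: after permutations,
  \<open>r\<^sub>i + r\<^sub>i\<^sub>+\<^sub>1 + s\<^sub>i = 0\<close> for all \<open>i\<close> modulo 5. Otherwise all monomials of \<open>c\<^sub>4\<close> and \<open>c\<^sub>6\<close> have positive
  weight, and \<open>1728 \<Delta> = c\<^sub>4\<^sup>3 - c\<^sub>6\<^sup>2\<close> gives the claim.

  In the presence of a pentagon we expand the discriminant at the model \<open>\<Phi>\<^sub>i\<^sub>,\<^sub>i\<^sub>+\<^sub>1 = x\<^sub>i\<close> of a cycle of five
  lines, where it vanishes because the curve is reducible. This model is fixed by the one-parameter subgroup
  \<open>(r, s)\<close>, so all monomials of the expansion have \<open>t\<close>-weight 0, and the claim becomes that the \<open>|t|\<close>-weight is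
  at least 4. The tangent space of the orbit is complemented by five coordinate directions \<open>q\<^sub>i\<close>, one for each node,
  and infinitesimal invariance reduces the claim to monomials in the \<open>q\<^sub>i\<close>, which must be powers of \<open>\<Prod> q\<^sub>i\<close>.
  The weights \<open>e\<^sub>i = r\<^sub>i\<^sub>+\<^sub>1 + r\<^sub>i\<^sub>+\<^sub>4 - r\<^sub>i\<^sub>+\<^sub>2 - r\<^sub>i\<^sub>+\<^sub>3\<close> of the \<open>q\<^sub>i\<close> satisfy \<open>\<Sum> |e\<^sub>i| \<ge> 4\<close> unless
  \<open>r\<close> is constant.\<close>

section \<open>Evaluation of multivariate polynomials\<close>

abbreviation monomials :: "('x, 'a::zero) mvpoly \<Rightarrow> ('x \<Rightarrow>\<^sub>0 nat) set"
  where "monomials \<equiv> Poly_Mapping.keys"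

abbreviation mcoeff :: "('x, 'a::zero) mvpoly \<Rightarrow> ('x \<Rightarrow>\<^sub>0 nat) \<Rightarrow> 'a"
  where "mcoeff \<equiv> Poly_Mapping.lookup"

abbreviation vars :: "('x \<Rightarrow>\<^sub>0 nat) \<Rightarrow> 'x set"
  where "vars \<equiv> Poly_Mapping.keys"

abbreviation exponent :: "('x \<Rightarrow>\<^sub>0 nat) \<Rightarrow> 'x \<Rightarrow> nat"
  where "exponent \<equiv> Poly_Mapping.lookup"

abbreviation mvmonom :: "('x \<Rightarrow>\<^sub>0 nat) \<Rightarrow> 'a::zero \<Rightarrow> ('x, 'a) mvpoly"
  where "mvmonom \<equiv> Poly_Mapping.single"

abbreviation var_monomial :: "'x \<Rightarrow> 'x \<Rightarrow>\<^sub>0 nat"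
  where "var_monomial v \<equiv> Poly_Mapping.single v 1"

definition mono_eval :: "('x \<Rightarrow> 'b::comm_semiring_1) \<Rightarrow> ('x \<Rightarrow>\<^sub>0 nat) \<Rightarrow> 'b"
  where "mono_eval x m = (\<Prod>v\<in>vars m. x v ^ exponent m v)"

lemma mono_eval_superset:
  assumes "finite S" "vars m \<subseteq> S"
  shows "mono_eval x m = (\<Prod>v\<in>S. x v ^ exponent m v)"
  unfolding mono_eval_def by (rule prod.mono_neutral_left) (use assms in \<open>auto simp: in_keys_iff\<close>)

lemma mono_eval_0 [simp]: "mono_eval x 0 = 1"
  by (simp add: mono_eval_def)

lemma mono_eval_single [simp]: "mono_eval x (Poly_Mapping.single v n) = x v ^ n"
  by (simp add: mono_eval_def)

lemma mono_eval_one [simp]: "mono_eval (\<lambda>_. 1) m = 1"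
  by (simp add: mono_eval_def)

lemma mono_eval_cong: "(\<And>v. v \<in> vars m \<Longrightarrow> x v = y v) \<Longrightarrow> mono_eval x m = mono_eval y m"
  by (simp add: mono_eval_def)

lemma mono_eval_add: "mono_eval x (m + n) = mono_eval x m * mono_eval x n"
proof -
  let ?S = "vars m \<union> vars n"
  have "mono_eval x (m + n) = (\<Prod>v\<in>?S. x v ^ exponent (m + n) v)"
    by (rule mono_eval_superset) (use keys_add[of m n] in auto)
  also have "\<dots> = (\<Prod>v\<in>?S. x v ^ exponent m v) * (\<Prod>v\<in>?S. x v ^ exponent n v)"
    by (simp add: lookup_add power_add prod.distrib)
  also have "\<dots> = mono_eval x m * mono_eval x n"
    by (simp add: mono_eval_superset[of ?S])
  finally show ?thesis .
qed

lemma mono_eval_mult: "mono_eval (\<lambda>v. x v * y v) m = mono_eval x m * mono_eval y m"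
  by (simp add: mono_eval_def power_mult_distrib prod.distrib)

lemma mvpoly_eq_sum_monomials: "p = (\<Sum>m\<in>monomials p. mvmonom m (mcoeff p m))"
proof (rule poly_mapping_eqI)
  fix n
  have "mcoeff (\<Sum>m\<in>monomials p. mvmonom m (mcoeff p m)) n =
      (\<Sum>m\<in>monomials p. if m = n then mcoeff p m else 0)"
    unfolding lookup_sum by (intro sum.cong) (auto simp: lookup_single)
  then show "mcoeff p n = mcoeff (\<Sum>m\<in>monomials p. mvmonom m (mcoeff p m)) n"
    by (simp add: in_keys_iff)
qed

locale coefficient_hom =
  fixes h :: "'a::comm_ring_1 \<Rightarrow> 'b::comm_ring_1"
  assumes hom_1: "h 1 = 1" and hom_add: "h (a + b) = h a + h b" and hom_mult: "h (a * b) = h a * h b"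
begin

lemma hom_0: "h 0 = 0"
  using hom_add[of 0 0] by simp

lemma eval_superset:
  assumes "finite S" "monomials p \<subseteq> S"
  shows "eval_mvpoly h x p = (\<Sum>m\<in>S. h (mcoeff p m) * mono_eval x m)"
  unfolding eval_mvpoly_def mono_eval_def[symmetric]
  by (rule sum.mono_neutral_left) (use assms in \<open>auto simp: in_keys_iff hom_0\<close>)

lemma eval_eq_sum: "eval_mvpoly h x p = (\<Sum>m\<in>monomials p. h (mcoeff p m) * mono_eval x m)"
  by (rule eval_superset) auto

lemma eval_0 [simp]: "eval_mvpoly h x 0 = 0"
  by (simp add: eval_eq_sum)

lemma eval_mvmonom: "eval_mvpoly h x (mvmonom m c) = h c * mono_eval x m"
  by (simp add: eval_eq_sum hom_0)

lemma eval_1 [simp]: "eval_mvpoly h x 1 = 1"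
  using eval_mvmonom[of x 0 1] by (simp add: hom_1)

lemma eval_add [simp]: "eval_mvpoly h x (p + q) = eval_mvpoly h x p + eval_mvpoly h x q"
proof -
  let ?S = "monomials p \<union> monomials q"
  have "eval_mvpoly h x (p + q) = (\<Sum>m\<in>?S. h (mcoeff (p + q) m) * mono_eval x m)"
    by (rule eval_superset) (use keys_add[of p q] in auto)
  also have "\<dots> = eval_mvpoly h x p + eval_mvpoly h x q"
    by (simp add: eval_superset[of ?S] lookup_add hom_add distrib_right sum.distrib)
  finally show ?thesis .
qed

lemma eval_sum [simp]: "eval_mvpoly h x (\<Sum>i\<in>I. f i) = (\<Sum>i\<in>I. eval_mvpoly h x (f i))"
  by (induction I rule: infinite_finite_induct) auto

lemma eval_mult [simp]: "eval_mvpoly h x (p * q) = eval_mvpoly h x p * eval_mvpoly h x q"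
proof -
  have "p * q = (\<Sum>m\<in>monomials p. mvmonom m (mcoeff p m)) * (\<Sum>n\<in>monomials q. mvmonom n (mcoeff q n))"
    by (simp flip: mvpoly_eq_sum_monomials)
  then have "eval_mvpoly h x (p * q) =
      (\<Sum>m\<in>monomials p. \<Sum>n\<in>monomials q. eval_mvpoly h x (mvmonom m (mcoeff p m) * mvmonom n (mcoeff q n)))"
    by (simp add: sum_product)
  also have "\<dots> = (\<Sum>m\<in>monomials p. \<Sum>n\<in>monomials q.
      (h (mcoeff p m) * mono_eval x m) * (h (mcoeff q n) * mono_eval x n))"
    by (simp add: mult_single eval_mvmonom mono_eval_add hom_mult mult_ac)
  also have "\<dots> = eval_mvpoly h x p * eval_mvpoly h x q"
    by (simp add: eval_eq_sum sum_product)
  finally show ?thesis .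
qed

lemma eval_prod [simp]: "eval_mvpoly h x (\<Prod>i\<in>I. f i) = (\<Prod>i\<in>I. eval_mvpoly h x (f i))"
  by (induction I rule: infinite_finite_induct) auto

lemma eval_power [simp]: "eval_mvpoly h x (p ^ n) = eval_mvpoly h x p ^ n"
  by (induction n) auto

lemma eval_uminus [simp]: "eval_mvpoly h x (- p) = - eval_mvpoly h x p"
  using eval_add[of x p "- p"] by (simp add: eq_neg_iff_add_eq_0 add.commute)

lemma eval_diff [simp]: "eval_mvpoly h x (p - q) = eval_mvpoly h x p - eval_mvpoly h x q"
  using eval_add[of x p "- q"] by simp

end

global_interpretation id_eval: coefficient_hom "id :: 'a \<Rightarrow> 'a::comm_ring_1"
  by unfold_locales auto

global_interpretation int_eval: coefficient_hom "of_int :: int \<Rightarrow> 'a::comm_ring_1"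
  by unfold_locales auto

abbreviation int_eval :: "('x \<Rightarrow> 'b::comm_ring_1) \<Rightarrow> ('x, int) mvpoly \<Rightarrow> 'b"
  where "int_eval \<equiv> eval_mvpoly of_int"

definition var :: "'x \<Rightarrow> ('x, int) mvpoly"
  where "var v = mvmonom (var_monomial v) 1"

lemma of_int_mvpoly: "(of_int c :: ('x, int) mvpoly) = mvmonom 0 c"
  by (metis of_int_eq_id id_apply single_of_int)

lemma mcoeff_of_int_mult: "mcoeff (of_int c * p) m = c * mcoeff (p :: ('x, int) mvpoly) m"
  unfolding of_int_mvpoly mult_map_scale_conv_mult[symmetric]
  by (simp add: Poly_Mapping.map.rep_eq when_def)

lemma int_eval_of_int [simp]: "int_eval x (of_int c) = of_int c"
  by (simp add: of_int_mvpoly int_eval.eval_mvmonom)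

lemma int_eval_var [simp]: "int_eval x (var v) = x v"
  by (simp add: var_def int_eval.eval_mvmonom)

lemma int_eval_compose: "int_eval y (int_eval f p) = int_eval (\<lambda>v. int_eval y (f v)) p"
  unfolding int_eval.eval_eq_sum[of f]
  by (simp add: int_eval.eval_eq_sum[of "\<lambda>v. int_eval y (f v)"] mono_eval_def)

lemma poly_int_eval: "poly (int_eval f p) t = int_eval (\<lambda>v. poly (f v) t) p"
  unfolding int_eval.eval_eq_sum mono_eval_def by (simp add: poly_sum poly_prod of_int_poly)

lemma int_eval_restrict:
  fixes x :: "'x \<Rightarrow> 'a::comm_ring_1"
  shows "int_eval (\<lambda>v. if v \<in> S then x v else 0) p =
    (\<Sum>m | m \<in> monomials p \<and> vars m \<subseteq> S. of_int (mcoeff p m) * mono_eval x m)"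
proof -
  let ?y = "\<lambda>v. if v \<in> S then x v else 0"
  have "mono_eval ?y m = mono_eval x m" if "vars m \<subseteq> S" for m
    using that by (intro mono_eval_cong) auto
  moreover have "mono_eval ?y m = 0" if "\<not> vars m \<subseteq> S" for m
    using that unfolding mono_eval_def by (intro prod_zero) (auto simp: in_keys_iff zero_power)
  ultimately have "int_eval ?y p =
      (\<Sum>m\<in>monomials p. if vars m \<subseteq> S then of_int (mcoeff p m) * mono_eval x m else 0)"
    unfolding int_eval.eval_eq_sum by (intro sum.cong) auto
  then show ?thesis
    by (simp add: sum.If_cases Int_def)
qed

lemma int_eval_at_0:
  fixes p :: "('x, int) mvpoly"
  shows "int_eval (\<lambda>_. 0) p = (of_int (mcoeff p 0) :: 'a::comm_ring_1)"
proof -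
  have "{m \<in> monomials p. vars m \<subseteq> {}} = (if mcoeff p 0 = 0 then {} else {0})"
    by (auto simp: in_keys_iff)
  then show ?thesis
    using int_eval_restrict[of "{}" "\<lambda>_. 0 :: 'a" p] by simp
qed

section \<open>Polynomial identities\<close>

text \<open>Monomials are characters of the multiplicative monoid of points, so this is the
  independence of characters.\<close>

lemma monomials_independent:
  fixes a :: "('x \<Rightarrow>\<^sub>0 nat) \<Rightarrow> 'a::{idom, ring_char_0}"
  assumes "finite M" and "\<And>x. (\<Sum>m\<in>M. a m * mono_eval x m) = 0" and "m \<in> M"
  shows "a m = 0"
  using assms
proof (induction M arbitrary: a m)
  case (insert n M)
  have vanish: "a n * mono_eval x n + (\<Sum>m\<in>M. a m * mono_eval x m) = 0" for x
    using insert.prems(1)[of x] insert.hyps by simp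
  have on_M: "a m = 0" if m_in: "m \<in> M" for m
  proof -
    obtain v where distinguishing: "exponent m v \<noteq> exponent n v"
      using m_in insert.hyps(2) by (metis poly_mapping_eqI)
    define y :: "'x \<Rightarrow> 'a" where "y u = (if u = v then 2 else 1)" for u
    have mono_eval_y: "mono_eval y k = 2 ^ exponent k v" for k
      by (subst mono_eval_superset[of "insert v (vars k)"])
        (auto simp: y_def if_distrib[of "\<lambda>z. z ^ _"] cong: if_cong)
    have "(\<Sum>m\<in>M. a m * (mono_eval y m - mono_eval y n) * mono_eval x m) = 0" for x
    proof -
      have "(\<Sum>m\<in>M. a m * (mono_eval y m - mono_eval y n) * mono_eval x m) =
          (a n * mono_eval (\<lambda>v. x v * y v) n + (\<Sum>m\<in>M. a m * mono_eval (\<lambda>v. x v * y v) m)) -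
          mono_eval y n * (a n * mono_eval x n + (\<Sum>m\<in>M. a m * mono_eval x m))"
        by (simp add: mono_eval_mult sum_distrib_left sum_subtractf algebra_simps)
      then show ?thesis
        by (simp add: vanish)
    qed
    then have "a m * (mono_eval y m - mono_eval y n) = 0"
      using insert.IH[of "\<lambda>m. a m * (mono_eval y m - mono_eval y n)"] m_in by blast
    moreover have "mono_eval y m \<noteq> mono_eval y n"
    proof -
      have "of_nat (2 ^ exponent m v) \<noteq> (of_nat (2 ^ exponent n v) :: 'a)"
        unfolding of_nat_eq_iff using distinguishing by simp
      then show ?thesis
        by (simp add: mono_eval_y)
    qed
    ultimately show ?thesis
      by simp
  qed
  moreover have "a n = 0"
    using vanish[of "\<lambda>_. 1"] on_M by simp
  ultimately show ?case
    using insert.prems(2) by auto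
qed auto

lemma int_eval_complex_eq_0:
  fixes p :: "('x, int) mvpoly"
  assumes "\<And>x :: 'x \<Rightarrow> complex. int_eval x p = 0"
  shows "p = 0"
proof -
  have "of_int (mcoeff p m) = (0::complex)" if "m \<in> monomials p" for m
    by (rule monomials_independent[OF finite_keys _ that])
      (use assms in \<open>simp add: int_eval.eval_eq_sum\<close>)
  then show ?thesis
    by (intro poly_mapping_eqI) (force simp: in_keys_iff)
qed

lemma int_eval_complex_eqI:
  fixes p q :: "('x, int) mvpoly"
  assumes "\<And>x :: 'x \<Rightarrow> complex. int_eval x p = int_eval x q"
  shows "p = q"
  using int_eval_complex_eq_0[of "p - q"] assms by simp

text \<open>On the line through two points the two factors are polynomials in one variable.\<close>

lemma int_eval_generically_0:
  fixes p q :: "('x, int) mvpoly" and z :: "'x \<Rightarrow> complex"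
  assumes prod_0: "\<And>x :: 'x \<Rightarrow> complex. int_eval x q \<noteq> 0 \<Longrightarrow> int_eval x p = 0"
    and q_nonzero: "int_eval z q \<noteq> 0"
  shows "p = 0"
proof (rule int_eval_complex_eq_0)
  fix x :: "'x \<Rightarrow> complex"
  define line where "line v = [:x v, z v - x v:]" for v
  have at_0: "poly (int_eval line r) 0 = int_eval x r"
    and at_1: "poly (int_eval line r) 1 = int_eval z r" for r
    by (simp_all add: poly_int_eval line_def)
  have "poly (int_eval line p * int_eval line q) t = 0" for t
    using prod_0 by (auto simp: poly_int_eval)
  then have "int_eval line p * int_eval line q = 0"
    using poly_all_0_iff_0 by blast
  moreover have "int_eval line q \<noteq> 0"
    using q_nonzero at_1[of q] by auto
  ultimately show "int_eval x p = 0"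
    using at_0[of p] by simp
qed

lemma exists_supported_nonzero:
  fixes p :: "('x, int) mvpoly"
  assumes monomial: "m \<in> monomials p" "vars m \<subseteq> S"
  obtains x :: "'x \<Rightarrow> complex" where "\<And>v. v \<notin> S \<Longrightarrow> x v = 0" "int_eval x p \<noteq> 0"
proof (rule ccontr)
  assume "\<not> thesis"
  then have "int_eval (\<lambda>v. if v \<in> S then x v else 0) p = 0" for x :: "'x \<Rightarrow> complex"
    using that[of "\<lambda>v. if v \<in> S then x v else 0"] by auto
  then have "(\<Sum>m | m \<in> monomials p \<and> vars m \<subseteq> S. complex_of_int (mcoeff p m) * mono_eval x m) = 0" for x
    by (simp only: int_eval_restrict)
  then have "complex_of_int (mcoeff p m) = 0"
    by (rule monomials_independent[rotated]) (use monomial in auto)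
  then show False
    using monomial(1) by (simp add: in_keys_iff)
qed

section \<open>Weights of monomials\<close>

definition mono_weight :: "('x \<Rightarrow> int) \<Rightarrow> ('x \<Rightarrow>\<^sub>0 nat) \<Rightarrow> int"
  where "mono_weight t m = (\<Sum>v\<in>vars m. int (exponent m v) * t v)"

lemma mono_weight_superset:
  assumes "finite S" "vars m \<subseteq> S"
  shows "mono_weight t m = (\<Sum>v\<in>S. int (exponent m v) * t v)"
  unfolding mono_weight_def by (rule sum.mono_neutral_left) (use assms in \<open>auto simp: in_keys_iff\<close>)

lemma mono_weight_plus: "mono_weight t (m + n) = mono_weight t m + mono_weight t n"
proof -
  let ?S = "vars m \<union> vars n"
  have "mono_weight t (m + n) = (\<Sum>v\<in>?S. int (exponent (m + n) v) * t v)"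
    by (rule mono_weight_superset) (use keys_add[of m n] in auto)
  then show ?thesis
    by (simp add: mono_weight_superset[of ?S] lookup_add distrib_right sum.distrib)
qed

lemma mono_weight_single [simp]: "mono_weight t (Poly_Mapping.single v n) = int n * t v"
  by (simp add: mono_weight_def)

lemma mono_weight_mono: "(\<And>v. v \<in> vars m \<Longrightarrow> t v \<le> u v) \<Longrightarrow> mono_weight t m \<le> mono_weight u m"
  unfolding mono_weight_def by (intro sum_mono mult_left_mono) auto

lemma mono_weight_nonneg: "(\<And>v. v \<in> vars m \<Longrightarrow> 0 \<le> t v) \<Longrightarrow> 0 \<le> mono_weight t m"
  unfolding mono_weight_def by (intro sum_nonneg mult_nonneg_nonneg) auto

lemma mono_weight_eq_0D:
  assumes "mono_weight t m = 0" "\<And>v. v \<in> vars m \<Longrightarrow> 0 \<le> t v" "v \<in> vars m"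
  shows "t v = 0"
proof -
  have "\<forall>v\<in>vars m. int (exponent m v) * t v = 0"
    using assms(1,2) unfolding mono_weight_def by (subst sum_nonneg_eq_0_iff[symmetric]) auto
  then show ?thesis
    using assms(3) by (auto simp: in_keys_iff)
qed

lemma mono_weight_mult_ge:
  assumes "\<And>m. m \<in> monomials p \<Longrightarrow> a \<le> mono_weight t m"
    and "\<And>m. m \<in> monomials q \<Longrightarrow> b \<le> mono_weight t m"
    and "m \<in> monomials (p * q)"
  shows "a + b \<le> mono_weight t m"
proof -
  obtain m1 m2 where "m = m1 + m2" "m1 \<in> monomials p" "m2 \<in> monomials q"
    using assms(3) keys_mult[of p q] by blast
  then show ?thesis
    using assms(1)[of m1] assms(2)[of m2] by (simp add: mono_weight_plus)
qed

lemma prod_powi: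
  fixes z :: "'a::field"
  assumes "z \<noteq> 0"
  shows "(\<Prod>i\<in>I. z powi f i) = z powi (\<Sum>i\<in>I. f i)"
  by (induction I rule: infinite_finite_induct) (use assms in \<open>auto simp: power_int_add\<close>)

lemma mono_eval_powi:
  fixes z :: "'a::field"
  assumes "z \<noteq> 0"
  shows "mono_eval (\<lambda>v. z powi t v) m = z powi mono_weight t m"
proof -
  have "(z powi t v) ^ n = z powi (int n * t v)" for n v
    by (simp add: power_int_mult power_int_power' mult.commute)
  then show ?thesis
    by (simp add: mono_eval_def mono_weight_def prod_powi[OF assms])
qed

lemma mono_weight_of_quasi_homogeneous:
  fixes p :: "('x, int) mvpoly"
  assumes scaling: "\<And>(z::complex) x. z \<noteq> 0 \<Longrightarrow> int_eval (\<lambda>v. z powi t v * x v) p = z powi N * int_eval x p"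
    and monomial: "m \<in> monomials p"
  shows "mono_weight t m = N"
proof (rule ccontr)
  assume "mono_weight t m \<noteq> N"
  then have "(2 :: real) powi mono_weight t m \<noteq> 2 powi N"
    using power_int_strict_increasing[of "mono_weight t m" N "2 :: real"]
      power_int_strict_increasing[of N "mono_weight t m" "2 :: real"] by linarith
  moreover have "of_int (mcoeff p m) * (2 powi mono_weight t m - 2 powi N) = (0 :: complex)"
  proof (rule monomials_independent[OF finite_keys _ monomial])
    fix x :: "'x \<Rightarrow> complex"
    have "(\<Sum>m\<in>monomials p. of_int (mcoeff p m) * (2 powi mono_weight t m - 2 powi N) * mono_eval x m) =
        int_eval (\<lambda>v. 2 powi t v * x v) p - 2 powi N * int_eval x p"
      by (simp add: int_eval.eval_eq_sum mono_eval_mult mono_eval_powi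
          algebra_simps sum_subtractf sum_distrib_left)
    then show "(\<Sum>m\<in>monomials p.
        of_int (mcoeff p m) * (2 powi mono_weight t m - 2 powi N) * mono_eval x m) = 0"
      by (simp add: scaling)
  qed
  ultimately show False
    using monomial by (auto simp: in_keys_iff dest: arg_cong[of _ _ norm] simp: norm_power_int)
qed

section \<open>Monomial and elementary matrices\<close>

definition monomial_mat :: "('n \<Rightarrow> 'n) \<Rightarrow> ('n \<Rightarrow> 'a::comm_ring_1) \<Rightarrow> 'a^'n^'n"
  where "monomial_mat \<sigma> \<alpha> = (\<chi> i j. if j = \<sigma> i then \<alpha> i else 0)"

abbreviation diag_mat :: "('n \<Rightarrow> 'a::comm_ring_1) \<Rightarrow> 'a^'n^'n"
  where "diag_mat \<equiv> monomial_mat id"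

definition row_addition :: "'n \<Rightarrow> ('n \<Rightarrow> 'a::comm_ring_1) \<Rightarrow> 'a^'n^'n"
  where "row_addition b \<rho> = (\<chi> i j. (if i = j then 1 else 0) + (if j = b then \<rho> i else 0))"

lemma sum_monomial_mat: "(\<Sum>j\<in>UNIV. monomial_mat \<sigma> \<alpha> $ i $ j * f j) = \<alpha> i * f (\<sigma> i)"
  by (simp add: monomial_mat_def if_distrib[of "\<lambda>u. u * _"] cong: if_cong)

lemma sum_row_addition: "(\<Sum>j\<in>UNIV. row_addition b \<rho> $ i $ j * f j) = f i + \<rho> i * f b"
proof -
  have "(\<Sum>j\<in>UNIV. row_addition b \<rho> $ i $ j * f j) =
      (\<Sum>j\<in>UNIV. if i = j then f j else 0) + (\<Sum>j\<in>UNIV. if j = b then \<rho> i * f j else 0)"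
    unfolding sum.distrib[symmetric] by (intro sum.cong) (auto simp: row_addition_def distrib_right)
  then show ?thesis by simp
qed

lemma mat_eq_diag_mat: "mat c = diag_mat (\<lambda>_. c)"
  by (simp add: mat_def monomial_mat_def vec_eq_iff)

lemma monomial_mat_mult:
  "monomial_mat \<sigma> \<alpha> ** monomial_mat \<tau> \<beta> = monomial_mat (\<tau> \<circ> \<sigma>) (\<lambda>i. \<alpha> i * \<beta> (\<sigma> i))"
  by (simp add: vec_eq_iff matrix_matrix_mult_def sum_monomial_mat) (simp add: monomial_mat_def)

lemma det_diag_mat: "det (diag_mat \<alpha>) = (\<Prod>i\<in>UNIV. \<alpha> i)"
  by (subst det_diagonal) (auto simp: monomial_mat_def)

lemma det_row_addition: "det (row_addition b \<rho>) = 1 + \<rho> b"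
proof -
  let ?row = "\<lambda>x. \<chi> k. if k = b then x else axis k (1::'a)"
  have identity: "?row (axis b 1) = mat 1"
    by (auto simp: vec_eq_iff axis_def mat_def)
  have unit_row: "det (?row (axis a 1)) = of_bool (a = b)" for a
  proof (cases "a = b")
    case True
    then show ?thesis
      unfolding True identity by simp
  next
    case False
    then have "det (?row (axis a 1)) = 0"
      by (intro det_identical_rows[of a b]) (auto simp: row_def)
    then show ?thesis
      using False by simp
  qed
  have "(\<rho> a *s axis a 1) $ c = (if a = c then \<rho> c else 0)" for a c
    by (simp add: axis_def)
  then have rows: "transpose (row_addition b \<rho>) = ?row (axis b 1 + (\<Sum>a\<in>UNIV. \<rho> a *s axis a 1))"
    by (simp add: vec_eq_iff transpose_def row_addition_def axis_def)
  have "det (row_addition b \<rho>) = det (?row (axis b 1 + (\<Sum>a\<in>UNIV. \<rho> a *s axis a 1)))"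
    unfolding rows[symmetric] by (rule det_transpose[symmetric])
  also have "\<dots> = det (?row (axis b 1)) + (\<Sum>a\<in>UNIV. det (?row (\<rho> a *s axis a 1)))"
    unfolding det_row_add[of b "\<lambda>_. axis b 1"] det_linear_row_sum[OF finite] ..
  also have "\<dots> = 1 + (\<Sum>a\<in>UNIV. \<rho> a * of_bool (a = b))"
    by (simp add: identity det_row_mul unit_row)
  finally show ?thesis by simp
qed

section \<open>Models in coordinates\<close>

definition coords :: "'a model \<Rightarrow> 5 \<times> 5 \<times> 5 \<Rightarrow> 'a"
  where "coords \<Phi> = (\<lambda>(i, j, k). \<Phi> $ i $ j $ k)"

definition coord_model :: "(5 \<times> 5 \<times> 5 \<Rightarrow> 'a::comm_ring_1) \<Rightarrow> 'a model"
  where "coord_model \<psi> = (\<chi> i j k. if i < j then \<psi> (i, j, k) else if j < i then - \<psi> (j, i, k) else 0)"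

lemma coords_apply [simp]: "coords \<Phi> (i, j, k) = \<Phi> $ i $ j $ k"
  by (simp add: coords_def)

lemma coord_model_nth [simp]:
  "coord_model \<psi> $ i $ j $ k = (if i < j then \<psi> (i, j, k) else if j < i then - \<psi> (j, i, k) else 0)"
  by (simp add: coord_model_def)

lemma pfaffian_modelsI:
  assumes "\<And>i k. \<Phi> $ i $ i $ k = 0" "\<And>i j k. \<Phi> $ j $ i $ k = - (\<Phi> $ i $ j $ k)"
    "\<And>i j k. \<Phi> $ i $ j $ k \<in> R"
  shows "\<Phi> \<in> X\<^sub>5 R"
  using assms unfolding pfaffian_models_def vec_eq_iff zero_index vector_uminus_component by blast

lemma pfaffian_modelsD:
  assumes "\<Phi> \<in> X\<^sub>5 R"
  shows "\<Phi> $ i $ i $ k = 0" "\<Phi> $ j $ i $ k = - (\<Phi> $ i $ j $ k)" "\<Phi> $ i $ j $ k \<in> R"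
proof -
  have "\<Phi> $ i $ i = 0" "\<Phi> $ j $ i = - (\<Phi> $ i $ j)"
    using assms unfolding pfaffian_models_def by blast+
  then show "\<Phi> $ i $ i $ k = 0" "\<Phi> $ j $ i $ k = - (\<Phi> $ i $ j $ k)"
    by simp_all
  show "\<Phi> $ i $ j $ k \<in> R"
    using assms unfolding pfaffian_models_def by blast
qed

lemma coord_model_mem [simp]: "coord_model \<psi> \<in> X\<^sub>5 UNIV"
  by (rule pfaffian_modelsI) auto

lemma coord_model_coords:
  assumes "\<Phi> \<in> X\<^sub>5 R"
  shows "coord_model (coords \<Phi>) = \<Phi>"
proof -
  have "coord_model (coords \<Phi>) $ i $ j $ k = \<Phi> $ i $ j $ k" for i j k
    using pfaffian_modelsD(1)[OF assms, of i k] pfaffian_modelsD(2)[OF assms, of i j k]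
    by (cases i j rule: linorder_cases) auto
  then show ?thesis unfolding vec_eq_iff by blast
qed

lemma eval_model_eq_int_eval: "eval_model p \<Phi> = int_eval (coords \<Phi>) p"
  by (simp add: eval_model_def coords_def)

lemma int_eval_model_poly_cong:
  assumes "p \<in> model_polys" "\<And>i j k. i < j \<Longrightarrow> x (i, j, k) = y (i, j, k)"
  shows "int_eval x p = int_eval y p"
  unfolding int_eval.eval_eq_sum
proof (intro sum.cong refl arg_cong2[of _ _ _ _ "(*)"] mono_eval_cong)
  fix m v assume "m \<in> monomials p" "v \<in> vars m"
  then have "v \<in> {(i, j, k). i < j}"
    using assms(1) by (auto simp: model_polys_def)
  then show "x v = y v"
    using assms(2) by auto
qed

lemma eval_model_coord_model: "p \<in> model_polys \<Longrightarrow> eval_model p (coord_model \<psi>) = int_eval \<psi> p"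
  unfolding eval_model_eq_int_eval by (erule int_eval_model_poly_cong) simp

section \<open>The action of pairs of matrices\<close>

lemma act_nth:
  "act A B \<Phi> $ i $ j $ k =
    (\<Sum>l\<in>UNIV. B $ k $ l * (\<Sum>a\<in>UNIV. A $ i $ a * (\<Sum>b\<in>UNIV. A $ j $ b * \<Phi> $ a $ b $ l)))"
  by (simp add: act_def matrix_vector_mult_def sum_distrib_left mult.assoc)

lemma act_monomial_mat:
  "act (monomial_mat \<sigma> \<alpha>) (monomial_mat \<tau> \<beta>) \<Phi> $ i $ j $ k = \<alpha> i * \<alpha> j * \<beta> k * \<Phi> $ \<sigma> i $ \<sigma> j $ \<tau> k"
  unfolding act_nth sum_monomial_mat by (simp add: mult_ac)

lemma act_mat: "act (mat a) (mat b) \<Phi> $ i $ j $ k = a\<^sup>2 * b * \<Phi> $ i $ j $ k"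
  by (simp add: mat_eq_diag_mat act_monomial_mat power2_eq_square)

lemma act_left: "act A (mat 1) \<Phi> $ i $ j $ k = (\<Sum>a\<in>UNIV. A $ i $ a * (\<Sum>b\<in>UNIV. A $ j $ b * \<Phi> $ a $ b $ k))"
  by (simp add: act_nth mat_eq_diag_mat sum_monomial_mat)

lemma act_right: "act (mat 1) B \<Phi> $ i $ j = B *v \<Phi> $ i $ j"
  by (simp add: vec_eq_iff act_nth mat_eq_diag_mat sum_monomial_mat matrix_vector_mult_def)

lemma act_row_addition_left:
  assumes "\<Phi> \<in> X\<^sub>5 R"
  shows "act (row_addition b \<rho>) (mat 1) \<Phi> $ i $ j $ k =
    \<Phi> $ i $ j $ k + \<rho> i * \<Phi> $ b $ j $ k + \<rho> j * \<Phi> $ i $ b $ k"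
  unfolding act_left sum_row_addition using pfaffian_modelsD(1)[OF assms] by (simp add: algebra_simps)

lemma act_row_addition_right:
  "act (mat 1) (row_addition b \<rho>) \<Phi> $ i $ j $ k = \<Phi> $ i $ j $ k + \<rho> k * \<Phi> $ i $ j $ b"
  unfolding act_right matrix_vector_mult_def by (simp add: sum_row_addition)

lemma alternating_double_sum_0:
  fixes f :: "'i \<Rightarrow> 'i \<Rightarrow> 'a::ab_group_add"
  assumes "\<And>a. f a a = 0" "\<And>a b. f b a = - f a b"
  shows "(\<Sum>a\<in>S. \<Sum>b\<in>S. f a b) = 0"
proof (induction S rule: infinite_finite_induct)
  case (insert c S)
  have "(\<Sum>a\<in>S. f a c) = - (\<Sum>b\<in>S. f c b)"
    unfolding sum_negf[symmetric] by (intro sum.cong refl assms(2))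
  then show ?case
    using insert by (simp add: assms(1) sum.distrib)
qed auto

lemma act_mem_UNIV:
  assumes "\<Phi> \<in> X\<^sub>5 R"
  shows "act A B \<Phi> \<in> X\<^sub>5 UNIV"
proof (rule pfaffian_modelsI)
  have skew: "A $ j $ b * (A $ i $ a * \<Phi> $ b $ a $ l) = - (A $ i $ a * (A $ j $ b * \<Phi> $ a $ b $ l))"
    for i j a b l
    by (subst pfaffian_modelsD(2)[OF assms]) (simp add: mult.left_commute)
  show "act A B \<Phi> $ i $ i $ k = 0" for i k
  proof -
    have "(\<Sum>a\<in>UNIV. \<Sum>b\<in>UNIV. A $ i $ a * (A $ i $ b * \<Phi> $ a $ b $ l)) = 0" for l
      by (rule alternating_double_sum_0[OF _ skew]) (simp add: pfaffian_modelsD(1)[OF assms])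
    then show ?thesis
      by (simp add: act_nth sum_distrib_left)
  qed
  show "act A B \<Phi> $ j $ i $ k = - act A B \<Phi> $ i $ j $ k" for i j k
  proof -
    have "(\<Sum>b\<in>UNIV. \<Sum>a\<in>UNIV. A $ j $ b * (A $ i $ a * \<Phi> $ b $ a $ l)) =
        - (\<Sum>a\<in>UNIV. \<Sum>b\<in>UNIV. A $ i $ a * (A $ j $ b * \<Phi> $ a $ b $ l))" for l
      by (subst sum.swap, unfold sum_negf[symmetric]) (intro sum.cong refl skew)
    then show ?thesis
      by (simp add: act_nth sum_distrib_left sum_negf)
  qed
qed simp

lemma act_act: "act A B (act A' B' \<Phi>) = act (A ** A') (B ** B') \<Phi>"
proof -
  have assoc: "(\<Sum>c\<in>UNIV. (M ** N) $ i $ c * f c) = (\<Sum>a\<in>UNIV. M $ i $ a * (\<Sum>c\<in>UNIV. N $ a $ c * f c))"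
    for M N :: "'a^5^5" and i f
    by (subst sum.swap[of "\<lambda>a c. M $ i $ a * (N $ a $ c * f c)", folded sum_distrib_left])
      (simp add: matrix_matrix_mult_def sum_distrib_right sum_distrib_left mult.assoc)
  have commute: "(\<Sum>a\<in>UNIV. f a * (\<Sum>c\<in>UNIV. g c * h a c)) = (\<Sum>c\<in>UNIV. g c * (\<Sum>a\<in>UNIV. f a * h a c))"
    for f g :: "5 \<Rightarrow> 'a" and h
    unfolding sum_distrib_left by (subst sum.swap) (simp add: mult.left_commute)
  have "act A B (act A' B' \<Phi>) $ i $ j $ k = act (A ** A') (B ** B') \<Phi> $ i $ j $ k" for i j k
  proof -
    let ?S = "\<lambda>a m. \<Sum>c\<in>UNIV. A' $ a $ c * (\<Sum>b\<in>UNIV. A $ j $ b * (\<Sum>d\<in>UNIV. A' $ b $ d * \<Phi> $ c $ d $ m))"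
    have "act A B (act A' B' \<Phi>) $ i $ j $ k =
        (\<Sum>l\<in>UNIV. B $ k $ l * (\<Sum>a\<in>UNIV. A $ i $ a * (\<Sum>m\<in>UNIV. B' $ l $ m * ?S a m)))"
      unfolding act_nth commute[of "\<lambda>b. A $ j $ b"] ..
    also have "\<dots> = act (A ** A') (B ** B') \<Phi> $ i $ j $ k"
      unfolding act_nth assoc commute[of "\<lambda>a. A $ i $ a"] ..
    finally show ?thesis .
  qed
  then show ?thesis unfolding vec_eq_iff by blast
qed

section \<open>Invariance over arbitrary rings\<close>

lemma int_eval_det: "int_eval x (det A) = det (\<chi> i j. int_eval x (A $ i $ j))"
  by (simp add: det_def)

lemma int_eval_eval_model:
  "int_eval x (eval_model p \<Phi>) = eval_model p (\<chi> i j k. int_eval x (\<Phi> $ i $ j $ k))"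
  by (simp add: eval_model_def int_eval_compose case_prod_unfold)

lemma int_eval_act:
  "(\<chi> i j k. int_eval x (act A B \<Phi> $ i $ j $ k)) =
    act (\<chi> i j. int_eval x (A $ i $ j)) (\<chi> i j. int_eval x (B $ i $ j)) (\<chi> i j k. int_eval x (\<Phi> $ i $ j $ k))"
  by (simp add: vec_eq_iff act_nth)

lemma GL5_UNIV_iff_det: "A \<in> GL5 (UNIV :: 'k::field set) \<longleftrightarrow> det A \<noteq> 0"
  unfolding invertible_det_nz[symmetric] by (simp add: GL5_def invertible_def)

text \<open>Invariance is an identity between integer polynomials in the entries of generic \<open>A\<close>, \<open>B\<close> and \<open>\<Phi>\<close>.\<close>

theorem invariant_of_weight_act:
  fixes \<Phi> :: "'a::comm_ring_1 model"
  assumes inv: "invariant_of_weight w p" and model: "\<Phi> \<in> X\<^sub>5 R"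
  shows "eval_model p (act A B \<Phi>) = act_det A B ^ w * eval_model p \<Phi>"
proof -
  define gA gB :: "((5 \<times> 5) + (5 \<times> 5) + (5 \<times> 5 \<times> 5), int) mvpoly^5^5"
    where "gA = (\<chi> i j. var (Inl (i, j)))" and "gB = (\<chi> i j. var (Inr (Inl (i, j))))"
  define g\<Phi> where "g\<Phi> = coord_model (\<lambda>u. var (Inr (Inr u)) :: ((5 \<times> 5) + (5 \<times> 5) + (5 \<times> 5 \<times> 5), int) mvpoly)"
  define P where "P = eval_model p (act gA gB g\<Phi>) - act_det gA gB ^ w * eval_model p g\<Phi>"
  have P_at: "int_eval x P =
      eval_model p (act (\<chi> i j. x (Inl (i, j))) (\<chi> i j. x (Inr (Inl (i, j))))
        (coord_model (\<lambda>u. x (Inr (Inr u)))))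
      - act_det (\<chi> i j. x (Inl (i, j))) (\<chi> i j. x (Inr (Inl (i, j)))) ^ w
        * eval_model p (coord_model (\<lambda>u. x (Inr (Inr u))))" for x :: "_ \<Rightarrow> 'c::comm_ring_1"
  proof -
    have "(\<chi> i j k. int_eval x (g\<Phi> $ i $ j $ k)) = coord_model (\<lambda>u. x (Inr (Inr u)))"
      by (simp add: g\<Phi>_def vec_eq_iff)
    then show ?thesis
      by (simp add: P_def int_eval_eval_model int_eval_act act_det_def int_eval_det gA_def gB_def)
  qed
  have "P = 0"
  proof (rule int_eval_generically_0)
    fix x :: "_ \<Rightarrow> complex"
    assume "int_eval x (det gA * det gB) \<noteq> 0"
    then have "(\<chi> i j. x (Inl (i, j))) \<in> GL5 UNIV" "(\<chi> i j. x (Inr (Inl (i, j)))) \<in> GL5 UNIV"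
      by (auto simp: GL5_UNIV_iff_det int_eval_det gA_def gB_def)
    then show "int_eval x P = 0"
      using inv coord_model_mem[of "\<lambda>u. x (Inr (Inr u))"] unfolding P_at invariant_of_weight_def by simp
  next
    let ?z = "case_sum (\<lambda>(i, j). of_bool (i = j)) (case_sum (\<lambda>(i, j). of_bool (i = j)) (\<lambda>_. 0))"
    have "(\<chi> i j. of_bool (i = j)) = (mat 1 :: complex^5^5)"
      by (simp add: mat_def vec_eq_iff)
    then show "int_eval ?z (det gA * det gB) \<noteq> (0 :: complex)"
      by (simp add: int_eval_det gA_def gB_def)
  qed
  then show ?thesis
    using P_at[of "case_sum (\<lambda>(i, j). A $ i $ j) (case_sum (\<lambda>(i, j). B $ i $ j) (coords \<Phi>))"]
    by (simp add: coord_model_coords[OF model])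
qed

section \<open>Weights of invariants\<close>

definition coord_weight :: "(5 \<Rightarrow> int) \<Rightarrow> (5 \<Rightarrow> int) \<Rightarrow> 5 \<times> 5 \<times> 5 \<Rightarrow> int"
  where "coord_weight r s = (\<lambda>(i, j, k). r i + r j + s k)"

lemma coord_weight_apply [simp]: "coord_weight r s (i, j, k) = r i + r j + s k"
  by (simp add: coord_weight_def)

lemma act_det_diag_mat_powi:
  fixes z :: "'a::field"
  assumes "z \<noteq> 0"
  shows "act_det (diag_mat (\<lambda>i. z powi r i)) (diag_mat (\<lambda>k. z powi s k)) =
    z powi (2 * sum r UNIV + sum s UNIV)"
  using assms
  by (simp add: act_det_def det_diag_mat prod_powi power_int_add mult.commute[of 2] power_int_mult)

lemma invariant_torus_action:
  fixes z :: "'a::field"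
  assumes inv: "invariant_of_weight w p" "p \<in> model_polys" and "z \<noteq> 0"
  shows "int_eval (\<lambda>u. z powi coord_weight r s u * \<psi> u) p =
    z powi (int w * (2 * sum r UNIV + sum s UNIV)) * int_eval \<psi> p"
proof -
  let ?A = "diag_mat (\<lambda>i. z powi r i)" and ?B = "diag_mat (\<lambda>k. z powi s k)"
  have "coord_model (\<lambda>u. z powi coord_weight r s u * \<psi> u) = act ?A ?B (coord_model \<psi>)"
    using assms(3) by (simp add: vec_eq_iff act_monomial_mat power_int_add mult_ac)
  then have "int_eval (\<lambda>u. z powi coord_weight r s u * \<psi> u) p = act_det ?A ?B ^ w * int_eval \<psi> p"
    using invariant_of_weight_act[OF inv(1) coord_model_mem[of \<psi>], of ?A ?B]
    by (simp flip: eval_model_coord_model[OF inv(2)])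
  then show ?thesis
    using assms(3) by (simp add: act_det_diag_mat_powi power_int_mult mult.commute[of "int w"])
qed

lemma invariant_mono_weight:
  assumes "invariant_of_weight w p" "p \<in> model_polys" "m \<in> monomials p"
  shows "mono_weight (coord_weight r s) m = int w * (2 * sum r UNIV + sum s UNIV)"
  by (rule mono_weight_of_quasi_homogeneous[OF invariant_torus_action[OF assms(1,2)] assms(3)])

section \<open>Weighted row selection\<close>

lemma det_nonzero_transversal:
  fixes A :: "'a::idom^'n^'n"
  assumes "det A \<noteq> 0"
  obtains q where "q permutes UNIV" "\<And>i. A $ i $ q i \<noteq> 0"
proof -
  have "\<exists>q. q permutes UNIV \<and> (\<Prod>i\<in>UNIV. A $ i $ q i) \<noteq> 0"
  proof (rule ccontr)
    assume "\<nexists>q. q permutes UNIV \<and> (\<Prod>i\<in>UNIV. A $ i $ q i) \<noteq> 0"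
    then have "det A = 0"
      unfolding det_def by (intro sum.neutral) auto
    with assms show False by simp
  qed
  then show thesis
    using that by auto
qed

text \<open>Exchanging one basis vector multiplies the determinant by a coordinate.\<close>

lemma exists_maximal_weight_basis:
  fixes f :: "'i \<Rightarrow> 'a::field^'n" and wt :: "'i \<Rightarrow> int"
  assumes "finite I" and initial: "\<And>k. b0 k \<in> I" "det (\<chi> k. f (b0 k)) \<noteq> 0"
  obtains b where "\<And>k. b k \<in> I" "det (\<chi> k. f (b k)) \<noteq> 0"
    "\<And>i x k. i \<in> I \<Longrightarrow> f i = (\<Sum>l\<in>UNIV. x $ l *s f (b l)) \<Longrightarrow> x $ k \<noteq> 0 \<Longrightarrow> wt i \<le> wt (b k)"
proof -
  define bases where "bases = {b. (\<forall>k. b k \<in> I) \<and> det (\<chi> k. f (b k)) \<noteq> 0}"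
  define total where "total b = (\<Sum>k\<in>UNIV. wt (b k))" for b :: "'n \<Rightarrow> 'i"
  have "bases \<subseteq> UNIV \<rightarrow>\<^sub>E I"
    by (auto simp: bases_def PiE_UNIV_domain)
  then have "finite bases"
    using finite_PiE[of "UNIV :: 'n set" "\<lambda>_. I"] \<open>finite I\<close> by (simp add: finite_subset)
  moreover have "b0 \<in> bases"
    using initial by (simp add: bases_def)
  ultimately obtain b where basis: "b \<in> bases" and max: "\<And>b'. b' \<in> bases \<Longrightarrow> total b' \<le> total b"
    using Max_in[of "total ` bases"] Max_ge[of "total ` bases"] by fastforce
  show thesis
  proof (rule that[of b])
    show "b k \<in> I" for k
      using basis by (simp add: bases_def)
    show "det (\<chi> k. f (b k)) \<noteq> 0"
      using basis by (simp add: bases_def)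
    show "wt i \<le> wt (b k)"
      if expansion: "i \<in> I" "f i = (\<Sum>l\<in>UNIV. x $ l *s f (b l))" "x $ k \<noteq> 0" for i x k
    proof -
      let ?M = "\<chi> k. f (b k)"
      have "(\<chi> l. f ((b(k := i)) l)) = (\<chi> l. if l = k then \<Sum>l\<in>UNIV. x $ l *s row l ?M else row l ?M)"
        by (simp add: vec_eq_iff row_def expansion(2))
      then have "det (\<chi> l. f ((b(k := i)) l)) = x $ k * det ?M"
        by (simp add: cramer_lemma_transpose)
      then have "b(k := i) \<in> bases"
        using basis expansion by (simp add: bases_def)
      from max[OF this] show ?thesis
        by (simp add: total_def sum.remove[of UNIV k])
    qed
  qed
qed

lemma int_eval_nonzero_monomial:
  fixes x :: "'x \<Rightarrow> 'a::idom"
  assumes "int_eval x p \<noteq> 0"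
  obtains m where "m \<in> monomials p" "\<And>v. v \<in> vars m \<Longrightarrow> x v \<noteq> 0"
proof -
  obtain m where "m \<in> monomials p" "mono_eval x m \<noteq> 0"
    using assms unfolding int_eval.eval_eq_sum
    by (metis (mono_tags, lifting) mult_zero_right sum.neutral)
  then show thesis
    using that by (auto simp: mono_eval_def in_keys_iff)
qed

text \<open>The standard basis vectors supplement the rows of a model, so that a basis exists to start with.\<close>

definition supplemented_row :: "'a::comm_ring_1 model \<Rightarrow> (5 \<times> 5) + 5 \<Rightarrow> 'a^5"
  where "supplemented_row \<Phi> = case_sum (\<lambda>(i, j). \<Phi> $ i $ j) (\<lambda>k. axis k 1)"

lemma exists_basis_dominating_monomial:
  fixes \<Phi> :: "complex model" and wt :: "(5 \<times> 5) + 5 \<Rightarrow> int"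
  assumes inv: "invariant_of_weight w p" "p \<in> model_polys" and model: "\<Phi> \<in> X\<^sub>5 UNIV"
    and nonzero: "eval_model p \<Phi> \<noteq> 0"
  obtains b m where "\<And>k. b k \<in> {(i, j). i < j} <+> UNIV" "det (\<chi> k. supplemented_row \<Phi> (b k)) \<noteq> 0"
    "m \<in> monomials p" "\<And>i j k. (i, j, k) \<in> vars m \<Longrightarrow> wt (Inl (i, j)) \<le> wt (b k)"
proof -
  let ?row = "supplemented_row \<Phi>" and ?I = "{(i, j). i < j} <+> (UNIV :: 5 set)"
  have "(\<chi> k. ?row (Inr k)) = mat 1"
    by (auto simp: supplemented_row_def mat_def axis_def vec_eq_iff)
  then obtain b where basis: "\<And>k. b k \<in> ?I" "det (\<chi> k. ?row (b k)) \<noteq> 0"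
    "\<And>a x k. a \<in> ?I \<Longrightarrow> ?row a = (\<Sum>l\<in>UNIV. x $ l *s ?row (b l)) \<Longrightarrow> x $ k \<noteq> 0 \<Longrightarrow> wt a \<le> wt (b k)"
    using exists_maximal_weight_basis[of ?I Inr ?row wt] by auto
  define Q where "Q = transpose (\<chi> k. ?row (b k))"
  have "invertible Q"
    using basis(2) by (simp add: Q_def invertible_det_nz)
  then obtain B where inverse: "Q ** B = mat 1" "B ** Q = mat 1"
    by (auto simp: invertible_def)
  have expansion: "x = (\<Sum>l\<in>UNIV. (B *v x) $ l *s ?row (b l))" for x
  proof -
    have "x = Q *v (B *v x)"
      by (simp add: matrix_vector_mul_assoc inverse)
    also have "\<dots> = (\<Sum>l\<in>UNIV. (B *v x) $ l *s ?row (b l))"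
      by (simp add: matrix_mult_sum Q_def row_def)
    finally show ?thesis .
  qed
  have "det B \<noteq> 0"
    using inverse(2) by (metis det_I det_mul mult_zero_left zero_neq_one)
  then have "int_eval (coords (act (mat 1) B \<Phi>)) p \<noteq> 0"
    using invariant_of_weight_act[OF inv(1) model, of "mat 1" B] nonzero
    by (simp add: eval_model_eq_int_eval act_det_def)
  then obtain m where monomial: "m \<in> monomials p" "\<And>u. u \<in> vars m \<Longrightarrow> coords (act (mat 1) B \<Phi>) u \<noteq> 0"
    by (rule int_eval_nonzero_monomial) blast
  show thesis
  proof (rule that[OF basis(1,2) monomial(1)])
    fix i j k assume ijk: "(i, j, k) \<in> vars m"
    then have "i < j"
      using monomial(1) inv(2) by (auto simp: model_polys_def)
    moreover have "(B *v \<Phi> $ i $ j) $ k \<noteq> 0"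
      using monomial(2)[OF ijk] by (simp add: act_right)
    moreover have "?row (Inl (i, j)) = \<Phi> $ i $ j"
      by (simp add: supplemented_row_def)
    ultimately show "wt (Inl (i, j)) \<le> wt (b k)"
      using basis(3)[of "Inl (i, j)"] expansion[of "\<Phi> $ i $ j"] by (simp add: InlI)
  qed
qed

lemma weighted_row_selection:
  fixes \<Phi> :: "complex model" and y :: "5 \<Rightarrow> int"
  assumes inv: "invariant_of_weight w p" "p \<in> model_polys" and "w > 0"
    and model: "\<Phi> \<in> X\<^sub>5 UNIV" "eval_model p \<Phi> \<noteq> 0"
  obtains b :: "5 \<Rightarrow> 5 \<times> 5"
  where "\<And>k. fst (b k) < snd (b k)" "det (\<chi> k. \<Phi> $ fst (b k) $ snd (b k)) \<noteq> 0"
    "2 * sum y UNIV \<le> (\<Sum>k\<in>UNIV. y (fst (b k)) + y (snd (b k)))"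
proof -
  define N where "N = 1 + 2 * (\<Sum>i\<in>UNIV. \<bar>y i\<bar>)"
  define wt :: "(5 \<times> 5) + 5 \<Rightarrow> int" where "wt = case_sum (\<lambda>(i, j). y i + y j) (\<lambda>_. - N)"
  obtain b m where basis: "\<And>k. b k \<in> {(i, j). i < j} <+> UNIV" "det (\<chi> k. supplemented_row \<Phi> (b k)) \<noteq> 0"
    and monomial: "m \<in> monomials p" "\<And>i j k. (i, j, k) \<in> vars m \<Longrightarrow> wt (Inl (i, j)) \<le> wt (b k)"
    using exists_basis_dominating_monomial[OF inv model] by blast
  have "\<exists>e. b k = Inl e" for k
  proof (rule ccontr)
    assume "\<nexists>e. b k = Inl e"
    then have wt_k: "wt (b k) = - N"
      by (cases "b k") (auto simp: wt_def)
    have "- N < y i + y j" for i j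
    proof -
      have "\<bar>y i\<bar> \<le> (\<Sum>i\<in>UNIV. \<bar>y i\<bar>)" "\<bar>y j\<bar> \<le> (\<Sum>i\<in>UNIV. \<bar>y i\<bar>)"
        by (rule member_le_sum; simp)+
      then show ?thesis unfolding N_def by linarith
    qed
    then have "l \<noteq> k" if "(i, j, l) \<in> vars m" for i j l
      using monomial(2)[OF that] wt_k by (auto simp: wt_def dest: leD)
    then have "mono_weight (coord_weight (\<lambda>_. 0) (\<lambda>l. of_bool (l = k))) m = 0"
      unfolding mono_weight_def by (intro sum.neutral) (auto simp: coord_weight_def)
    then show False
      using \<open>w > 0\<close> by (simp add: invariant_mono_weight[OF inv monomial(1)])
  qed
  then obtain pairs where basis_eq: "b = Inl \<circ> pairs"
    by (metis comp_apply ext)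
  have "mono_weight (coord_weight y (\<lambda>_. 0)) m \<le> mono_weight (coord_weight (\<lambda>_. 0) (\<lambda>k. wt (b k))) m"
    by (rule mono_weight_mono) (auto simp: wt_def dest: monomial(2))
  then have "int w * (2 * sum y UNIV) \<le> int w * (\<Sum>k\<in>UNIV. wt (b k))"
    by (simp add: invariant_mono_weight[OF inv monomial(1)])
  then have "2 * sum y UNIV \<le> (\<Sum>k\<in>UNIV. wt (b k))"
    using \<open>w > 0\<close> by simp
  then show thesis
    using that[of pairs] basis by (auto simp: basis_eq supplemented_row_def wt_def case_prod_unfold)
qed

section \<open>Graphs with prescribed edge sums\<close>

definition has_edge_sums :: "('v \<Rightarrow> int) \<Rightarrow> int multiset \<Rightarrow> 'v set set \<Rightarrow> bool"
  where "has_edge_sums r M G \<longleftrightarrow> (\<forall>X\<in>G. card X = 2) \<and> image_mset (sum r) (mset_set G) = M"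

definition vertex_degree :: "'v set set \<Rightarrow> 'v \<Rightarrow> nat"
  where "vertex_degree G v = card {X \<in> G. v \<in> X}"

definition neighbours :: "'v set set \<Rightarrow> 'v \<Rightarrow> 'v set"
  where "neighbours G v = {w. {v, w} \<in> G}"

text \<open>With five edges on five vertices, this sum of squares is least for a 5-cycle.\<close>

definition irregularity :: "'v::finite set set \<Rightarrow> int"
  where "irregularity G = (\<Sum>v\<in>UNIV. (int (vertex_degree G v))\<^sup>2)"

lemma neighbours_sym: "w \<in> neighbours G v \<longleftrightarrow> v \<in> neighbours G w"
  by (simp add: neighbours_def insert_commute)

lemma not_neighbour_self: "has_edge_sums r M G \<Longrightarrow> v \<notin> neighbours G v"
  by (auto simp: neighbours_def has_edge_sums_def)

lemma edgeE:
  assumes "card X = 2" "v \<in> X"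
  obtains w where "X = {v, w}" "w \<noteq> v"
  using assms by (auto simp: card_2_iff doubleton_eq_iff)

lemma vertex_degree_eq_card_neighbours:
  assumes "has_edge_sums r M G"
  shows "vertex_degree G v = card (neighbours G v)"
proof -
  have "bij_betw (\<lambda>w. {v, w}) (neighbours G v) {X \<in> G. v \<in> X}"
  proof (rule bij_betwI')
    show "({v, x} = {v, y}) = (x = y)" for x y
      by (auto simp: doubleton_eq_iff)
    show "\<exists>w\<in>neighbours G v. X = {v, w}" if "X \<in> {X \<in> G. v \<in> X}" for X
      using that assms edgeE[of X v] by (auto simp: neighbours_def has_edge_sums_def)
  qed (auto simp: neighbours_def)
  then show ?thesis
    unfolding vertex_degree_def by (simp add: bij_betw_same_card)
qed

lemma sum_vertex_degree:
  fixes G :: "'v::finite set set" and y :: "'v \<Rightarrow> int"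
  shows "(\<Sum>v\<in>UNIV. int (vertex_degree G v) * y v) = (\<Sum>X\<in>G. sum y X)"
proof -
  have "(\<Sum>X\<in>G. sum y X) = (\<Sum>X\<in>G. \<Sum>v\<in>UNIV. if v \<in> X then y v else 0)"
    by (simp add: sum.If_cases)
  also have "\<dots> = (\<Sum>v\<in>UNIV. \<Sum>X\<in>G. if v \<in> X then y v else 0)"
    by (rule sum.swap)
  also have "\<dots> = (\<Sum>v\<in>UNIV. int (vertex_degree G v) * y v)"
    by (simp add: vertex_degree_def sum.If_cases Int_def)
  finally show ?thesis ..
qed

lemma vertex_degree_empty [simp]: "vertex_degree {} v = 0"
  by (simp add: vertex_degree_def)

lemma vertex_degree_insert:
  fixes G :: "'v::finite set set"
  assumes "X \<notin> G"
  shows "vertex_degree (insert X G) v = vertex_degree G v + of_bool (v \<in> X)"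
proof -
  have "{Z \<in> insert X G. v \<in> Z} = (if v \<in> X then insert X {Z \<in> G. v \<in> Z} else {Z \<in> G. v \<in> Z})"
    by auto
  then show ?thesis
    using assms by (simp add: vertex_degree_def)
qed

lemma vertex_degree_exchange:
  fixes G :: "'v::finite set set"
  assumes "X \<in> G" "Y \<notin> G"
  shows "int (vertex_degree (insert Y (G - {X})) v) =
    int (vertex_degree G v) + of_bool (v \<in> Y) - of_bool (v \<in> X)"
  using vertex_degree_insert[of X "G - {X}" v] vertex_degree_insert[of Y "G - {X}" v] assms
  by (simp add: insert_absorb)

lemma has_edge_sums_exchange:
  fixes G :: "'v::finite set set"
  assumes "has_edge_sums r M G" "X \<in> G" "Y \<notin> G" "card Y = 2" "sum r X = sum r Y"
  shows "has_edge_sums r M (insert Y (G - {X}))"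
proof -
  have "image_mset (sum r) (mset_set G) = add_mset (sum r X) (image_mset (sum r) (mset_set (G - {X})))"
    using assms(2) by (simp add: mset_set.remove)
  then show ?thesis
    using assms by (auto simp: has_edge_sums_def)
qed

lemma irregularity_exchange:
  fixes G :: "'v::finite set set"
  assumes "X \<in> G" "Y \<notin> G" "card X = card Y"
  shows "irregularity (insert Y (G - {X})) = irregularity G +
    2 * ((\<Sum>v\<in>Y. int (vertex_degree G v)) - (\<Sum>v\<in>X. int (vertex_degree G v)) + int (card (Y - X)))"
proof -
  let ?d = "\<lambda>v. int (vertex_degree G v)"
  have "(?d v + of_bool (v \<in> Y) - of_bool (v \<in> X))\<^sup>2 = (?d v)\<^sup>2
      + 2 * ((if v \<in> Y then ?d v else 0) - (if v \<in> X then ?d v else 0))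
      + ((if v \<in> Y - X then 1 else 0) + (if v \<in> X - Y then 1 else 0))" for v
    by (simp add: power2_eq_square algebra_simps)
  then have "irregularity (insert Y (G - {X})) = irregularity G
      + 2 * ((\<Sum>v\<in>Y. ?d v) - (\<Sum>v\<in>X. ?d v)) + (int (card (Y - X)) + int (card (X - Y)))"
    unfolding irregularity_def vertex_degree_exchange[OF assms(1,2)]
    by (simp add: sum.distrib sum_subtractf sum.If_cases set_diff_eq flip: sum_distrib_left)
  moreover have "card (X - Y) = card (Y - X)"
    using assms(3) by (metis card_Diff_subset_Int finite Int_commute)
  ultimately show ?thesis by simp
qed

lemma image_mset_eq_bij_betw:
  assumes "finite A" "finite B" and images_eq: "image_mset f (mset_set A) = image_mset g (mset_set B)"
  obtains h where "bij_betw h A B" "\<And>x. x \<in> A \<Longrightarrow> g (h x) = f x"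
proof -
  have "card A = card B"
    using arg_cong[OF images_eq, of size] by simp
  then obtain b where bij: "bij_betw b A B"
    using assms(1,2) by (metis bij_betw_iff_card)
  then have "mset_set B = image_mset b (mset_set A)"
    by (metis bij_betw_def image_mset_mset_set)
  then have "image_mset f (mset_set A) = image_mset (g \<circ> b) (mset_set A)"
    using images_eq by (simp add: multiset.map_comp)
  then obtain p where permutation: "p permutes A" "\<forall>x\<in>A. f x = (g \<circ> b) (p x)"
    using image_mset_eq_implies_permutes[OF assms(1)] by blast
  then show thesis
    using that[of "b \<circ> p"] bij_betw_trans[OF permutes_imp_bij[OF permutation(1)] bij] by simp
qed

lemma exists_exchange_bijection:
  fixes G W :: "'v::finite set set"
  assumes "has_edge_sums r M G" "has_edge_sums r M W"
  obtains h where "bij_betw h (W - G) (G - W)" "\<And>Y. Y \<in> W - G \<Longrightarrow> sum r (h Y) = sum r Y"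
    "\<And>v. vertex_degree W v \<le> vertex_degree G v + card {Y \<in> W - G. v \<in> Y \<and> v \<notin> h Y}"
proof -
  have split: "image_mset (sum r) (mset_set F) =
      image_mset (sum r) (mset_set (F \<inter> F')) + image_mset (sum r) (mset_set (F - F'))"
    for F F' :: "'v set set"
    by (metis Int_Diff_Un Int_Diff_disjoint finite image_mset_union mset_set_Union)
  have "image_mset (sum r) (mset_set (W - G)) = image_mset (sum r) (mset_set (G - W))"
    using assms split[of W G] split[of G W] unfolding has_edge_sums_def
    by (metis Int_commute add_left_imp_eq)
  then obtain h where exchange: "bij_betw h (W - G) (G - W)" "\<And>Y. Y \<in> W - G \<Longrightarrow> sum r (h Y) = sum r Y"
    using image_mset_eq_bij_betw[of "W - G" "G - W"] by (metis finite)
  have "vertex_degree W v \<le> vertex_degree G v + card {Y \<in> W - G. v \<in> Y \<and> v \<notin> h Y}" for v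
  proof -
    let ?kept = "{Y \<in> W - G. v \<in> Y \<and> v \<in> h Y}" and ?gained = "{Y \<in> W - G. v \<in> Y \<and> v \<notin> h Y}"
    have "inj_on h ?kept"
      using exchange(1) by (auto simp: bij_betw_def intro: inj_on_subset)
    moreover have "h ` ?kept \<subseteq> {X \<in> G - W. v \<in> X}"
      using exchange(1) by (auto simp: bij_betw_def)
    ultimately have "card ?kept \<le> card {X \<in> G - W. v \<in> X}"
      by (intro card_inj_on_le) auto
    moreover have "vertex_degree W v = card {X \<in> W \<inter> G. v \<in> X} + card (?kept \<union> ?gained)"
      unfolding vertex_degree_def
      by (subst card_Un_disjoint[symmetric]) (auto intro: arg_cong[of _ _ card])
    moreover have "card (?kept \<union> ?gained) \<le> card ?kept + card ?gained"
      by (rule card_Un_le)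
    moreover have "vertex_degree G v = card {X \<in> W \<inter> G. v \<in> X} + card {X \<in> G - W. v \<in> X}"
      unfolding vertex_degree_def
      by (subst card_Un_disjoint[symmetric]) (auto intro: arg_cong[of _ _ card])
    ultimately show ?thesis by linarith
  qed
  with exchange show thesis by (rule that)
qed

section \<open>The pentagon\<close>

lemma UNIV_5: "(UNIV :: 5 set) = {0, 1, 2, 3, 4}"
  by (rule sym, rule card_subset_eq) auto

lemma numeral_mod_5 [simp]:
  "(5::5) = 0" "(6::5) = 1" "(7::5) = 2" "(8::5) = 3" "(9::5) = 4" "(- 1 :: 5) = 4"
  by simp_all

lemma exhaust_5:
  fixes x :: 5
  obtains "x = 0" | "x = 1" | "x = 2" | "x = 3" | "x = 4"
  using UNIV_I[of x] unfolding UNIV_5 by auto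

lemma sum_5: "sum f (UNIV :: 5 set) = f 0 + f 1 + f 2 + f 3 + f 4"
  unfolding UNIV_5 by (simp add: add_ac)

lemma UNIV_eq_distinct5:
  assumes "distinct [a, b, c, d, e :: 5]"
  shows "UNIV = {a, b, c, d, e}"
  by (rule sym, rule card_subset_eq) (use assms in auto)

lemma distinct5_cases:
  assumes "distinct [a, b, c, d, e :: 5]"
  obtains "x = a" | "x = b" | "x = c" | "x = d" | "x = e"
proof -
  have "x \<in> {a, b, c, d, e}"
    unfolding UNIV_eq_distinct5[OF assms, symmetric] by simp
  then show thesis
    using that by blast
qed

lemma exists_bij_5:
  assumes "distinct [a, b, c, d, e :: 5]"
  obtains \<sigma> :: "5 \<Rightarrow> 5" where "bij \<sigma>" "\<sigma> 0 = a" "\<sigma> 1 = b" "\<sigma> 2 = c" "\<sigma> 3 = d" "\<sigma> 4 = e"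
proof -
  define \<sigma> :: "5 \<Rightarrow> 5"
    where "\<sigma> i = (if i = 0 then a else if i = 1 then b else if i = 2 then c else if i = 3 then d else e)"
      for i
  have "\<sigma> ` {0, 1, 2, 3, 4} = {a, b, c, d, e}"
    by (auto simp: \<sigma>_def)
  then have "range \<sigma> = UNIV"
    by (simp only: UNIV_5[symmetric] UNIV_eq_distinct5[OF assms, symmetric])
  then have "bij \<sigma>"
    by (simp add: bij_def finite_UNIV_surj_inj)
  then show thesis
    by (rule that) (simp_all add: \<sigma>_def)
qed

lemma two_regular_triangle_free:
  fixes G :: "5 set set"
  assumes edge_sums: "has_edge_sums r M G" and regular: "\<And>v. vertex_degree G v = 2"
    and neighbours_a: "neighbours G a = {b, c}" and "b \<noteq> c"
  shows "neighbours G b \<noteq> {a, c}"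
proof
  assume neighbours_b: "neighbours G b = {a, c}"
  have degree_2: "card (neighbours G v) = 2" for v
    using regular vertex_degree_eq_card_neighbours[OF edge_sums] by simp
  have new: "b \<noteq> a" "c \<noteq> a"
    using not_neighbour_self[OF edge_sums, of a] neighbours_a by auto
  have "a \<in> neighbours G c" "b \<in> neighbours G c"
    using neighbours_a neighbours_b neighbours_sym[of c G a] neighbours_sym[of c G b] by auto
  then have neighbours_c: "neighbours G c = {a, b}"
    using degree_2[of c] new by (intro card_subset_eq[symmetric]) auto
  obtain p where outside: "p \<notin> {a, b, c}"
    using card_mono[of "{a, b, c}" UNIV] \<open>b \<noteq> c\<close> new by fastforce
  then have "neighbours G p \<subseteq> UNIV - {a, b, c, p}"
    using neighbours_a neighbours_b neighbours_c not_neighbour_self[OF edge_sums, of p]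
      neighbours_sym[of a G p] neighbours_sym[of b G p] neighbours_sym[of c G p] by auto
  then have "card (neighbours G p) \<le> card (UNIV - {a, b, c, p})"
    by (intro card_mono) auto
  then show False
    using outside \<open>b \<noteq> c\<close> new degree_2[of p] by (auto simp: card_Diff_subset card_insert_if)
qed

lemma five_cycle_of_edges:
  fixes G :: "5 set set"
  assumes distinct: "distinct [a, b, c, d, e]" and "card G = 5"
    and edges: "{a, b} \<in> G" "{b, c} \<in> G" "{c, d} \<in> G" "{d, e} \<in> G" "{e, a} \<in> G"
  obtains \<sigma> :: "5 \<Rightarrow> 5" where "bij \<sigma>" "G = range (\<lambda>i. {\<sigma> i, \<sigma> (i + 1)})"
proof -
  obtain \<sigma> :: "5 \<Rightarrow> 5" where "bij \<sigma>" and \<sigma>_values: "\<sigma> 0 = a" "\<sigma> 1 = b" "\<sigma> 2 = c" "\<sigma> 3 = d" "\<sigma> 4 = e"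
    using distinct by (rule exists_bij_5)
  have "range (\<lambda>i. {\<sigma> i, \<sigma> (i + 1)}) = {{a, b}, {b, c}, {c, d}, {d, e}, {e, a}}"
    by (subst UNIV_5) (simp add: \<sigma>_values)
  moreover have "G = {{a, b}, {b, c}, {c, d}, {d, e}, {e, a}}"
    using edges distinct \<open>card G = 5\<close>
    by (intro card_subset_eq[symmetric]) (auto simp: doubleton_eq_iff)
  ultimately show thesis
    using that[OF \<open>bij \<sigma>\<close>] by simp
qed

lemma two_regular_five_cycle:
  fixes G :: "5 set set"
  assumes edge_sums: "has_edge_sums r M G" and regular: "\<And>v. vertex_degree G v = 2"
  obtains \<sigma> :: "5 \<Rightarrow> 5" where "bij \<sigma>" "G = range (\<lambda>i. {\<sigma> i, \<sigma> (i + 1)})"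
proof -
  have degree_2: "card (neighbours G v) = 2" for v
    using regular vertex_degree_eq_card_neighbours[OF edge_sums] by simp
  note loopless = not_neighbour_self[OF edge_sums]
  obtain b e where neighbours_0: "neighbours G 0 = {b, e}" and "b \<noteq> e"
    using degree_2[of 0] by (auto simp: card_2_iff)
  then have nonzero: "b \<noteq> 0" "e \<noteq> 0"
    using loopless[of 0] by auto
  have "neighbours G b \<noteq> {0, e}"
    using two_regular_triangle_free[OF edge_sums regular neighbours_0 \<open>b \<noteq> e\<close>] .
  then have "\<not> neighbours G b \<subseteq> {0, e}"
    using degree_2[of b] nonzero card_subset_eq[of "{0, e}" "neighbours G b"] by auto
  then obtain c where new_c: "c \<in> neighbours G b" "c \<notin> {0, b, e}"
    using loopless[of b] by blast
  then have neighbours_b: "neighbours G b = {0, c}"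
    using degree_2[of b] neighbours_0 neighbours_sym[of b G 0] by (intro card_subset_eq[symmetric]) auto
  have "card (UNIV - {0, b, c, e}) = 1"
    using \<open>b \<noteq> e\<close> nonzero new_c by (auto simp: card_Diff_subset card_insert_if)
  then obtain d where "UNIV - {0, b, c, e} = {d}"
    by (auto simp: card_1_singleton_iff)
  then have new_d: "d \<notin> {0, b, c, e}" and cover: "x \<in> {0, b, c, d, e}" for x
    by blast+
  have "x \<in> {c, e}" if "x \<in> neighbours G d" for x
    using cover[of x] that neighbours_0 neighbours_b new_d loopless[of d]
      neighbours_sym[of 0 G d] neighbours_sym[of b G d] by auto
  then have "neighbours G d = {c, e}"
    using degree_2[of d] new_c by (intro card_subset_eq) auto
  then have edges: "{0, b} \<in> G" "{b, c} \<in> G" "{c, d} \<in> G" "{d, e} \<in> G" "{e, 0} \<in> G"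
    using neighbours_0 neighbours_b by (auto simp: neighbours_def insert_commute)
  have "2 * int (card G) = 10"
    using sum_vertex_degree[of G "\<lambda>_. 1"] regular edge_sums by (simp add: has_edge_sums_def)
  moreover have "distinct [0, b, c, d, e]"
    using \<open>b \<noteq> e\<close> nonzero new_c new_d by auto
  ultimately show thesis
    using five_cycle_of_edges[OF _ _ edges] that by auto
qed

lemma isolated_vertex_degrees:
  fixes a b c d e :: 5
  assumes "distinct [a, b, c, d, e]"
  defines "G \<equiv> {{a, b}, {a, c}, {a, d}, {b, c}, {b, d}}"
  shows "vertex_degree G a = 3" "vertex_degree G b = 3" "vertex_degree G c = 2"
    "vertex_degree G d = 2" "vertex_degree G e = 0"
  using assms(1) distinct_rev[of "[a, b, c, d, e]"] unfolding G_def
  by (simp_all add: vertex_degree_insert doubleton_eq_iff)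

lemma dominating_vertex_degrees:
  fixes a b c d e :: 5
  assumes "distinct [a, b, c, d, e]"
  defines "G \<equiv> {{a, b}, {a, c}, {a, d}, {a, e}, {b, c}}"
  shows "vertex_degree G a = 4" "vertex_degree G b = 2" "vertex_degree G c = 2"
    "vertex_degree G d = 1" "vertex_degree G e = 1"
  using assms(1) distinct_rev[of "[a, b, c, d, e]"] unfolding G_def
  by (simp_all add: vertex_degree_insert doubleton_eq_iff)

text \<open>The hypothesis says that \<open>M\<close> consists of the edge sums of a fractional 2-regular graph.\<close>

locale balanced_edge_sums =
  fixes r :: "5 \<Rightarrow> int" and M :: "int multiset"
  assumes balanced: "\<And>y :: 5 \<Rightarrow> int. \<exists>W. has_edge_sums r M W \<and> 2 * sum y UNIV \<le> (\<Sum>X\<in>W. sum y X)"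
begin

abbreviation realises :: "5 set set \<Rightarrow> bool" where "realises \<equiv> has_edge_sums r M"

definition most_regular :: "5 set set \<Rightarrow> bool"
  where "most_regular G \<longleftrightarrow> realises G \<and> (\<forall>W. realises W \<longrightarrow> irregularity G \<le> irregularity W)"

lemma most_regular_realises: "most_regular G \<Longrightarrow> realises G"
  by (simp add: most_regular_def)

lemma card_realises:
  assumes "realises G"
  shows "card G = 5"
proof -
  have size: "card W = size M" if "realises W" for W
    using that by (auto simp: has_edge_sums_def)
  have "10 * c \<le> 2 * c * int (size M)" for c :: int
  proof -
    obtain W where W_realises: "realises W" "2 * sum (\<lambda>_. c) (UNIV :: 5 set) \<le> (\<Sum>X\<in>W. sum (\<lambda>_. c) X)"
      using balanced[of "\<lambda>_. c"] by blast
    moreover have "(\<Sum>X\<in>W. sum (\<lambda>_. c) X) = 2 * c * int (size M)"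
      using W_realises(1) size[OF W_realises(1)] by (simp add: has_edge_sums_def)
    ultimately show ?thesis by simp
  qed
  from this[of 1] this[of "- 1"] show ?thesis
    using size[OF assms] by simp
qed

lemma sum_degree_weighted:
  assumes "realises G"
  shows "(\<Sum>v\<in>UNIV. int (vertex_degree G v) * r v) = 2 * sum r UNIV"
proof -
  have sums: "(\<Sum>X\<in>W. sum r X) = sum_mset M" if "realises W" for W
    using that by (auto simp: has_edge_sums_def sum_unfold_sum_mset[of "sum r"])
  have "(\<Sum>X\<in>W. sum (\<lambda>v. - r v) X) = - sum_mset M" if "realises W" for W
    by (simp add: sum_negf sums[OF that])
  then have "sum_mset M = 2 * sum r UNIV"
    using balanced[of r] balanced[of "\<lambda>v. - r v"] sums by (force simp: sum_negf)
  then show ?thesis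
    by (simp add: sum_vertex_degree sums[OF assms])
qed

lemma exists_degree_ge_2: "\<exists>W. realises W \<and> 2 \<le> vertex_degree W v"
  using balanced[of "\<lambda>u. of_bool (u = v)"] unfolding sum_vertex_degree[symmetric] by simp

lemma exists_degree_le_2: "\<exists>W. realises W \<and> vertex_degree W v \<le> 2"
  using balanced[of "\<lambda>u. - of_bool (u = v)"] unfolding sum_vertex_degree[symmetric]
  by (simp add: sum_negf)

lemma exists_most_regular: "\<exists>G. most_regular G"
proof -
  obtain W where W_realises: "realises W"
    using balanced by blast
  define G where "G = arg_min_on irregularity {W. realises W}"
  have "realises G" and "\<not> (\<exists>W. realises W \<and> irregularity W < irregularity G)"
    using arg_min_if_finite[of "{W. realises W}" irregularity] W_realises unfolding G_def by auto
  then show ?thesis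
    unfolding most_regular_def by (metis not_less)
qed

lemma most_regular_exchange:
  assumes "most_regular G" "X \<in> G" "Y \<notin> G" "card Y = 2" "sum r X = sum r Y"
  shows "(\<Sum>v\<in>X. vertex_degree G v) \<le> (\<Sum>v\<in>Y. vertex_degree G v) + card (Y - X)"
    "(\<Sum>v\<in>X. vertex_degree G v) = (\<Sum>v\<in>Y. vertex_degree G v) + card (Y - X) \<Longrightarrow>
      most_regular (insert Y (G - {X}))"
proof -
  have G_realises: "realises G" "card X = card Y"
    using assms by (auto simp: most_regular_def has_edge_sums_def)
  note change = irregularity_exchange[OF assms(2,3) G_realises(2)]
  have realises: "realises (insert Y (G - {X}))"
    by (rule has_edge_sums_exchange[OF G_realises(1) assms(2-5)])
  then have "irregularity G \<le> irregularity (insert Y (G - {X}))"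
    using assms(1) by (simp add: most_regular_def)
  then show "(\<Sum>v\<in>X. vertex_degree G v) \<le> (\<Sum>v\<in>Y. vertex_degree G v) + card (Y - X)"
    unfolding change by (simp flip: of_nat_sum)
  assume "(\<Sum>v\<in>X. vertex_degree G v) = (\<Sum>v\<in>Y. vertex_degree G v) + card (Y - X)"
  then have "irregularity (insert Y (G - {X})) = irregularity G"
    unfolding change by (simp flip: of_nat_sum)
  then show "most_regular (insert Y (G - {X}))"
    using assms(1) realises by (simp add: most_regular_def)
qed

lemma isolated_vertex_graph:
  assumes G_realises: "realises G" and isolated: "vertex_degree G e = 0"
  obtains a b c d where "distinct [a, b, c, d, e]" "G = {{a, b}, {a, c}, {a, d}, {b, c}, {b, d}}"
proof -
  define pairs where "pairs = {X. X \<subseteq> UNIV - {e} \<and> card X = 2}"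
  have card_pairs: "card pairs = 6"
    using n_subsets[of "UNIV - {e}" 2] by (simp add: pairs_def choose_two)
  have "e \<notin> X" if "X \<in> G" for X
    using that isolated by (auto simp: vertex_degree_def)
  then have "G \<subseteq> pairs"
    using G_realises by (auto simp: pairs_def has_edge_sums_def)
  moreover have "G \<noteq> pairs"
    using card_realises[OF G_realises] card_pairs by auto
  ultimately obtain X where missing: "X \<in> pairs" "X \<notin> G"
    by blast
  then obtain c d where X_eq: "X = {c, d}" "c \<noteq> d"
    by (auto simp: pairs_def card_2_iff)
  have "c \<noteq> e" "d \<noteq> e"
    using missing X_eq by (auto simp: pairs_def)
  then have "card (UNIV - {c, d, e}) = 2"
    using X_eq by (simp add: card_Diff_subset)
  then obtain a b where rest: "UNIV - {c, d, e} = {a, b}" "a \<noteq> b"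
    by (auto simp: card_2_iff)
  then have "a \<notin> {c, d, e}" "b \<notin> {c, d, e}"
    by blast+
  then have distinct: "distinct [a, b, c, d, e]"
    using rest X_eq \<open>c \<noteq> e\<close> \<open>d \<noteq> e\<close> by auto
  have "G = pairs - {X}"
    using \<open>G \<subseteq> pairs\<close> missing card_realises[OF G_realises] card_pairs by (intro card_subset_eq) auto
  then have "{{a, b}, {a, c}, {a, d}, {b, c}, {b, d}} \<subseteq> G"
    using distinct by (auto simp: pairs_def X_eq(1) doubleton_eq_iff)
  then have "{{a, b}, {a, c}, {a, d}, {b, c}, {b, d}} = G"
    using distinct card_realises[OF G_realises] by (intro card_subset_eq) (auto simp: doubleton_eq_iff)
  with distinct show thesis
    using that by blast
qed

lemma dominating_vertex_graph:
  assumes G_realises: "realises G" and dominating: "vertex_degree G a = 4"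
  obtains b c d e where "distinct [a, b, c, d, e]" "G = {{a, b}, {a, c}, {a, d}, {a, e}, {b, c}}"
proof -
  have "neighbours G a = UNIV - {a}"
    using dominating not_neighbour_self[OF G_realises, of a]
    by (intro card_subset_eq) (auto simp: vertex_degree_eq_card_neighbours[OF G_realises])
  then have spokes: "{a, x} \<in> G" if "x \<noteq> a" for x
    using that by (auto simp: neighbours_def)
  have "card (G - {X \<in> G. a \<in> X}) = 1"
    using card_realises[OF G_realises] dominating by (simp add: card_Diff_subset vertex_degree_def)
  then obtain X where "G - {X \<in> G. a \<in> X} = {X}"
    by (auto simp: card_1_singleton_iff)
  then have "X \<in> G" "a \<notin> X"
    by auto
  then have "card X = 2"
    using G_realises by (simp add: has_edge_sums_def)
  then obtain b c where X_eq: "X = {b, c}" "b \<noteq> c"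
    by (auto simp: card_2_iff)
  then have "card (UNIV - {a, b, c}) = 2"
    using \<open>a \<notin> X\<close> by (simp add: card_Diff_subset)
  then obtain d e where rest: "UNIV - {a, b, c} = {d, e}" "d \<noteq> e"
    by (auto simp: card_2_iff)
  then have "d \<notin> {a, b, c}" "e \<notin> {a, b, c}"
    by blast+
  then have distinct: "distinct [a, b, c, d, e]"
    using rest X_eq \<open>a \<notin> X\<close> by auto
  have "{{a, b}, {a, c}, {a, d}, {a, e}, {b, c}} = G"
    using distinct card_realises[OF G_realises] spokes \<open>X \<in> G\<close> X_eq(1)
    by (intro card_subset_eq) (auto simp: doubleton_eq_iff)
  with distinct show thesis
    using that by blast
qed

lemma most_regular_same_label:
  assumes regular: "most_regular G" and "r i = r j"
  shows "vertex_degree G i \<le> Suc (vertex_degree G j)"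
proof (rule ccontr)
  assume "\<not> vertex_degree G i \<le> Suc (vertex_degree G j)"
  then have gap: "Suc (card (neighbours G j)) < card (neighbours G i)"
    by (simp add: vertex_degree_eq_card_neighbours[OF most_regular_realises[OF regular]])
  have "\<not> neighbours G i \<subseteq> insert j (neighbours G j)"
  proof
    assume "neighbours G i \<subseteq> insert j (neighbours G j)"
    then have "card (neighbours G i) \<le> card (insert j (neighbours G j))"
      by (intro card_mono) auto
    then show False
      using gap card_insert_le_m1[of "Suc (card (neighbours G j))" "neighbours G j" j] by simp
  qed
  then obtain w where neighbour: "w \<in> neighbours G i" "w \<noteq> j" "w \<notin> neighbours G j"
    by blast
  have "w \<noteq> i" "i \<noteq> j"
    using neighbour not_neighbour_self[OF most_regular_realises[OF regular]] by auto
  have "(\<Sum>v\<in>{i, w}. vertex_degree G v) \<le> (\<Sum>v\<in>{j, w}. vertex_degree G v) + card ({j, w} - {i, w})"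
    using neighbour \<open>w \<noteq> i\<close> \<open>r i = r j\<close>
    by (intro most_regular_exchange(1)[OF regular]) (auto simp: neighbours_def)
  then show False
    using neighbour \<open>w \<noteq> i\<close> \<open>i \<noteq> j\<close> \<open>\<not> vertex_degree G i \<le> Suc (vertex_degree G j)\<close>
    by (auto simp: insert_Diff_if)
qed

lemma most_regular_disjoint_exchange:
  assumes regular: "most_regular G" and exchange: "X \<in> G" "Y \<notin> G" "card Y = 2" "sum r X = sum r Y"
    and "X \<inter> Y = {}"
  shows "sum (vertex_degree G) X \<le> sum (vertex_degree G) Y + 2"
    "sum (vertex_degree G) X = sum (vertex_degree G) Y + 2 \<Longrightarrow> most_regular (insert Y (G - {X}))"
  using most_regular_exchange[OF regular exchange] assms(4,6) by (simp_all add: Diff_triv Int_commute)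

lemma isolated_vertex_exchanges:
  assumes regular: "most_regular G" and G_eq: "G = {{a, b}, {a, c}, {a, d}, {b, c}, {b, d}}"
    and distinct: "distinct [a, b, c, d, e]"
    and exchange: "X \<in> G" "Y \<notin> G" "card Y = 2" "sum r X = sum r Y" and "e \<in> Y"
  shows "Y = {a, e} \<and> X \<in> {{b, c}, {b, d}} \<or> Y = {b, e} \<and> X \<in> {{a, c}, {a, d}}"
proof -
  note degrees = isolated_vertex_degrees[OF distinct, folded G_eq]
  have reversed: "distinct [e, d, c, b, a]"
    using distinct by auto
  obtain x where Y_eq: "Y = {x, e}" "x \<noteq> e"
    using edgeE[OF exchange(3) \<open>e \<in> Y\<close>] by (metis insert_commute)
  have x_cases: "x = a \<or> x = b \<or> x = c \<or> x = d"
    by (rule distinct5_cases[OF distinct, of x]) (use Y_eq(2) in auto)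
  have X_cases: "X = {a, b} \<or> X = {a, c} \<or> X = {a, d} \<or> X = {b, c} \<or> X = {b, d}"
    using exchange(1) unfolding G_eq by simp
  have sums: "sum r X = r x + r e"
    using exchange(4) Y_eq by simp
  have disjoint: "X \<inter> Y = {}"
  proof (rule ccontr)
    assume "X \<inter> Y \<noteq> {}"
    moreover have "e \<notin> X" "card X = 2"
      using X_cases distinct reversed by auto
    ultimately obtain u where X_eq: "X = {x, u}" "u \<noteq> x"
      using edgeE[of X x] unfolding Y_eq(1) by auto
    then have "vertex_degree G u \<le> 1"
      using most_regular_same_label[OF regular, of u e] sums degrees by simp
    moreover have "u \<noteq> e"
      using X_eq(1) \<open>e \<notin> X\<close> by auto
    ultimately show False
      by (cases u rule: distinct5_cases[OF distinct]) (use degrees in auto)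
  qed
  have "sum (vertex_degree G) X \<le> vertex_degree G x + 2"
    using most_regular_disjoint_exchange(1)[OF regular exchange disjoint] Y_eq degrees by simp
  then show ?thesis
    using X_cases x_cases disjoint distinct reversed degrees unfolding Y_eq(1) by (elim disjE) simp_all
qed

lemma isolated_vertex_no_double_exchange:
  assumes regular: "most_regular G" and G_eq: "G = {{a, b}, {a, c}, {a, d}, {b, c}, {b, d}}"
    and distinct: "distinct [a, b, c, d, e]" and ends: "u \<in> {c, d}" "w \<in> {c, d}"
    and sum_u: "sum r {b, u} = sum r {a, e}" and sum_w: "sum r {a, w} = sum r {b, e}"
  shows False
proof -
  have degrees: "vertex_degree G a = 3" "vertex_degree G b = 3" "vertex_degree G u = 2"
    "vertex_degree G w = 2" "vertex_degree G e = 0"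
    using isolated_vertex_degrees[OF distinct, folded G_eq] ends by auto
  have new: "u \<noteq> a" "u \<noteq> b" "u \<noteq> e" "w \<noteq> a" "w \<noteq> b" "w \<noteq> e" "a \<noteq> b" "a \<noteq> e" "b \<noteq> e"
    using ends distinct by auto
  show False
  proof (cases "u = w")
    case True
    then have "r u = r e"
      using sum_u sum_w new by simp
    then show False
      using most_regular_same_label[OF regular, of u e] degrees by simp
  next
    case False
    let ?G' = "insert {b, e} (G - {{a, w}})"
    have exchange_w: "{a, w} \<in> G" "{b, e} \<notin> G"
      using distinct ends(2) by (auto simp: G_eq doubleton_eq_iff)
    have "most_regular ?G'"
      by (rule most_regular_disjoint_exchange(2)[OF regular exchange_w _ sum_w])
        (use degrees new in auto)
    then have "sum (vertex_degree ?G') {b, u} \<le> sum (vertex_degree ?G') {a, e} + 2"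
    proof (rule most_regular_disjoint_exchange(1)[OF _ _ _ _ sum_u])
      show "{b, u} \<in> ?G'"
        using distinct ends(1) new by (auto simp: G_eq doubleton_eq_iff)
      show "{a, e} \<notin> ?G'"
        using distinct new by (auto simp: G_eq doubleton_eq_iff)
    qed (use new in auto)
    moreover have "int (vertex_degree ?G' b) = 4" "int (vertex_degree ?G' u) = 2"
      "int (vertex_degree ?G' a) = 2" "int (vertex_degree ?G' e) = 1"
      unfolding vertex_degree_exchange[OF exchange_w] using degrees new False by auto
    ultimately show False
      using new by simp
  qed
qed

lemma most_regular_no_isolated_vertex:
  assumes regular: "most_regular G"
  shows "vertex_degree G e \<noteq> 0"
proof
  assume isolated: "vertex_degree G e = 0"
  then obtain a b c d where distinct: "distinct [a, b, c, d, e]"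
    and G_eq: "G = {{a, b}, {a, c}, {a, d}, {b, c}, {b, d}}"
    using isolated_vertex_graph[OF most_regular_realises[OF regular]] by blast
  obtain W where W_degree: "realises W" "2 \<le> vertex_degree W e"
    using exists_degree_ge_2 by blast
  obtain h where bij: "bij_betw h (W - G) (G - W)" and same_sum: "\<And>Y. Y \<in> W - G \<Longrightarrow> sum r (h Y) = sum r Y"
    and degree_gain: "\<And>v. vertex_degree W v \<le> vertex_degree G v + card {Y \<in> W - G. v \<in> Y \<and> v \<notin> h Y}"
    by (rule exists_exchange_bijection[OF most_regular_realises[OF regular] W_degree(1)]) (rule that)
  let ?gained = "{Y \<in> W - G. e \<in> Y \<and> e \<notin> h Y}"
  have exchanges: "Y = {a, e} \<and> h Y \<in> {{b, c}, {b, d}} \<or> Y = {b, e} \<and> h Y \<in> {{a, c}, {a, d}}"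
    if "Y \<in> ?gained" for Y
  proof (rule isolated_vertex_exchanges[OF regular G_eq distinct])
    show "h Y \<in> G"
      using that bij by (auto simp: bij_betw_def)
  qed (use that same_sum W_degree(1) in \<open>auto simp: has_edge_sums_def\<close>)
  then have "?gained \<subseteq> {{a, e}, {b, e}}"
    by blast
  moreover have "card {{a, e}, {b, e}} \<le> card ?gained"
    using degree_gain[of e] W_degree(2) isolated by (simp add: card_insert_if)
  ultimately have "?gained = {{a, e}, {b, e}}"
    by (intro card_seteq) auto
  then have gained: "{a, e} \<in> ?gained" "{b, e} \<in> ?gained"
    by simp_all
  obtain u where h_ae: "u \<in> {c, d}" "h {a, e} = {b, u}"
    using exchanges[OF gained(1)] distinct by (auto simp: doubleton_eq_iff)
  obtain w where h_be: "w \<in> {c, d}" "h {b, e} = {a, w}"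
    using exchanges[OF gained(2)] distinct by (auto simp: doubleton_eq_iff)
  have "sum r {b, u} = sum r {a, e}" "sum r {a, w} = sum r {b, e}"
    using same_sum[of "{a, e}"] same_sum[of "{b, e}"] gained h_ae h_be by auto
  then show False
    by (rule isolated_vertex_no_double_exchange[OF regular G_eq distinct h_ae(1) h_be(1)])
qed

lemma dominating_vertex_exchange:
  assumes regular: "most_regular G" and G_eq: "G = {{a, b}, {a, c}, {a, d}, {a, e}, {b, c}}"
    and distinct: "distinct [a, b, c, d, e]"
    and exchange: "X \<in> G" "Y \<notin> G" "card Y = 2" "sum r X = sum r Y" and loses_a: "a \<in> X" "a \<notin> Y"
  obtains u where "u \<in> X" "u \<notin> Y" "vertex_degree G u = 1" "most_regular (insert Y (G - {X}))"
proof -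
  note degrees = dominating_vertex_degrees[OF distinct, folded G_eq]
  have degree_1: "1 \<le> vertex_degree G v" for v
    by (cases v rule: distinct5_cases[OF distinct]) (simp_all add: degrees)
  have degree_2: "vertex_degree G v \<le> 2" "vertex_degree G v = 2 \<Longrightarrow> v \<in> {b, c}" if "v \<noteq> a" for v
    using that by (cases v rule: distinct5_cases[OF distinct]; simp add: degrees)+
  have "card X = 2"
    using exchange(1) most_regular_realises[OF regular] by (simp add: has_edge_sums_def)
  then obtain u where X_eq: "X = {a, u}" "u \<noteq> a"
    using edgeE loses_a(1) by metis
  have "u \<notin> Y"
  proof
    assume "u \<in> Y"
    then obtain z where Y_eq_uz: "Y = {u, z}" "z \<noteq> u"
      using edgeE[OF exchange(3)] by blast
    then have "4 \<le> Suc (vertex_degree G z)"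
      using most_regular_same_label[OF regular, of a z] exchange(4) X_eq degrees(1) by simp
    then show False
      using degree_2(1)[of z] Y_eq_uz(1) loses_a(2) by fastforce
  qed
  obtain y z where Y_eq: "Y = {y, z}" "y \<noteq> z"
    using exchange(3) by (auto simp: card_2_iff)
  have "{y, z} \<noteq> {b, c}"
    using exchange(2) Y_eq(1) G_eq by auto
  then have "\<not> (vertex_degree G y = 2 \<and> vertex_degree G z = 2)"
    using degree_2(2)[of y] degree_2(2)[of z] Y_eq loses_a(2) by auto
  then have "sum (vertex_degree G) Y \<le> 3"
    using degree_2(1)[of y] degree_2(1)[of z] Y_eq loses_a(2) by auto
  moreover have "sum (vertex_degree G) X = 4 + vertex_degree G u"
    using X_eq degrees(1) by simp
  moreover have disjoint: "X \<inter> Y = {}"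
    using X_eq loses_a(2) \<open>u \<notin> Y\<close> by simp
  ultimately have "vertex_degree G u = 1" "sum (vertex_degree G) X = sum (vertex_degree G) Y + 2"
    using most_regular_disjoint_exchange(1)[OF regular exchange disjoint] degree_1[of u] by linarith+
  then show thesis
    using that[of u] most_regular_disjoint_exchange(2)[OF regular exchange disjoint] X_eq(1) \<open>u \<notin> Y\<close>
    by simp
qed

lemma most_regular_no_dominating_vertex:
  assumes regular: "most_regular G"
  shows "vertex_degree G a \<noteq> 4"
proof
  assume dominating: "vertex_degree G a = 4"
  then obtain b c d e where distinct: "distinct [a, b, c, d, e]"
    and G_eq: "G = {{a, b}, {a, c}, {a, d}, {a, e}, {b, c}}"
    using dominating_vertex_graph[OF most_regular_realises[OF regular]] by blast
  obtain W where W_degree: "realises W" "vertex_degree W a \<le> 2"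
    using exists_degree_le_2 by blast
  obtain h where bijection: "bij_betw h (G - W) (W - G)" "\<And>X. X \<in> G - W \<Longrightarrow> sum r (h X) = sum r X"
    "\<And>v. vertex_degree G v \<le> vertex_degree W v + card {X \<in> G - W. v \<in> X \<and> v \<notin> h X}"
    by (rule exists_exchange_bijection[OF W_degree(1) most_regular_realises[OF regular]]) (rule that)
  have "card {X \<in> G - W. a \<in> X \<and> a \<notin> h X} \<noteq> 0"
    using bijection(3)[of a] W_degree(2) dominating by linarith
  then obtain X where loses_a: "X \<in> G - W" "a \<in> X" "a \<notin> h X"
    by (auto simp: card_eq_0_iff)
  then have "h X \<in> W - G"
    using bijection(1) by (auto simp: bij_betw_def)
  then have exchange: "X \<in> G" "h X \<notin> G" "card (h X) = 2" "sum r X = sum r (h X)"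
    using loses_a bijection(2)[of X] W_degree(1) by (auto simp: has_edge_sums_def)
  obtain u where exchanged: "u \<in> X" "u \<notin> h X" "vertex_degree G u = 1"
    "most_regular (insert (h X) (G - {X}))"
    by (rule dominating_vertex_exchange[OF regular G_eq distinct exchange loses_a(2,3)])
  then have "int (vertex_degree (insert (h X) (G - {X})) u) = 0"
    by (simp add: vertex_degree_exchange[OF exchange(1,2)])
  with exchanged(4) show False
    using most_regular_no_isolated_vertex by auto
qed

lemma most_regular_degree_ge_1: "most_regular G \<Longrightarrow> 1 \<le> vertex_degree G v"
  using most_regular_no_isolated_vertex[of G v] by simp

lemma most_regular_degree_le_3:
  assumes regular: "most_regular G"
  shows "vertex_degree G v \<le> 3"
proof -
  have "neighbours G v \<subseteq> UNIV - {v}"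
    using not_neighbour_self[OF most_regular_realises[OF regular]] by blast
  then have "card (neighbours G v) \<le> card (UNIV - {v})"
    by (intro card_mono) auto
  then show ?thesis
    using most_regular_no_dominating_vertex[OF regular, of v]
    by (simp add: vertex_degree_eq_card_neighbours[OF most_regular_realises[OF regular]])
qed

lemma degree_3_adjacent:
  fixes G :: "5 set set"
  assumes edge_sums: "has_edge_sums r M G"
    and degrees: "vertex_degree G i = 3" "vertex_degree G p = 3" "vertex_degree G j = 1"
    and "i \<noteq> p"
  shows "{i, p} \<in> G"
proof (rule ccontr)
  assume nonedge: "{i, p} \<notin> G"
  have "neighbours G x = UNIV - {i, p}" if "x \<in> {i, p}" for x
  proof (rule card_subset_eq)
    show "neighbours G x \<subseteq> UNIV - {i, p}"
      using that nonedge not_neighbour_self[OF edge_sums] by (auto simp: neighbours_def insert_commute)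
    show "card (neighbours G x) = card (UNIV - {i, p})"
      using that degrees \<open>i \<noteq> p\<close>
      by (auto simp: card_Diff_subset simp flip: vertex_degree_eq_card_neighbours[OF edge_sums])
  qed simp
  moreover have "j \<noteq> i" "j \<noteq> p"
    using degrees by auto
  ultimately have "{i, p} \<subseteq> neighbours G j"
    using neighbours_sym[of j G i] neighbours_sym[of j G p] by simp
  then have "card {i, p} \<le> card (neighbours G j)"
    by (intro card_mono) auto
  then show False
    using degrees(3) \<open>i \<noteq> p\<close> by (simp add: vertex_degree_eq_card_neighbours[OF edge_sums])
qed

lemma degree_1_nonadjacent:
  fixes G :: "5 set set"
  assumes edge_sums: "has_edge_sums r M G"
    and degrees: "vertex_degree G j = 1" "vertex_degree G q = 1" "vertex_degree G i = 3"
    and "j \<noteq> q"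
  shows "{j, q} \<notin> G"
proof
  note card_neighbours = degrees[unfolded vertex_degree_eq_card_neighbours[OF edge_sums]]
  have distinct: "i \<noteq> j" "i \<noteq> q"
    using degrees by auto
  assume "{j, q} \<in> G"
  then have "q \<in> neighbours G j" "j \<in> neighbours G q"
    by (auto simp: neighbours_def insert_commute)
  then have "neighbours G j = {q}" "neighbours G q = {j}"
    using card_neighbours by (auto simp: card_1_singleton_iff)
  then have "neighbours G i \<subseteq> UNIV - {i, j, q}"
    using distinct not_neighbour_self[OF edge_sums, of i] neighbours_sym[of j G i]
      neighbours_sym[of q G i] by auto
  then have "card (neighbours G i) \<le> card (UNIV - {i, j, q})"
    by (intro card_mono) auto
  then show False
    using card_neighbours(3) distinct \<open>j \<noteq> q\<close> by (simp add: card_Diff_subset)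
qed

lemma most_regular_degree_3_pair:
  assumes regular: "most_regular G" and three: "vertex_degree G i = 3" "vertex_degree G p = 3" "i \<noteq> p"
    and one: "vertex_degree G j = 1" "vertex_degree G q = 1" "j \<noteq> q"
  shows "r i + r p \<noteq> r j + r q"
proof
  assume labels: "r i + r p = r j + r q"
  note realises = most_regular_realises[OF regular]
  have "{i, p} \<in> G" "{j, q} \<notin> G"
    using degree_3_adjacent[OF realises three(1,2) one(1) three(3)]
      degree_1_nonadjacent[OF realises one(1,2) three(1) one(3)] .
  moreover have "i \<noteq> j" "i \<noteq> q" "p \<noteq> j" "p \<noteq> q"
    using three one by auto
  ultimately have "sum (vertex_degree G) {i, p} \<le> sum (vertex_degree G) {j, q} + 2"
    using labels three(3) one(3) by (intro most_regular_disjoint_exchange(1)[OF regular]) auto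
  then show False
    using three one by simp
qed

lemma most_regular_excess:
  assumes "most_regular G"
  shows "int (vertex_degree G v) - 2 = of_bool (vertex_degree G v = 3) - of_bool (vertex_degree G v = 1)"
proof -
  have "vertex_degree G v = 1 \<or> vertex_degree G v = 2 \<or> vertex_degree G v = 3"
    using most_regular_degree_ge_1[OF assms, of v] most_regular_degree_le_3[OF assms, of v] by linarith
  then show ?thesis
    by auto
qed

lemma most_regular_degree_3_1_balance:
  assumes regular: "most_regular G"
  defines "high \<equiv> {v. vertex_degree G v = 3}" and "low \<equiv> {v. vertex_degree G v = 1}"
  shows "card high = card low" "sum r high = sum r low" "card low \<le> 2"
proof -
  note realises = most_regular_realises[OF regular]
  have weighted: "sum y high - sum y low = (\<Sum>v\<in>UNIV. int (vertex_degree G v) * y v) - 2 * sum y UNIV"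
    for y :: "5 \<Rightarrow> int"
  proof -
    have "(\<Sum>v\<in>UNIV. int (vertex_degree G v) * y v) - 2 * sum y UNIV =
        (\<Sum>v\<in>UNIV. (int (vertex_degree G v) - 2) * y v)"
      by (simp add: left_diff_distrib sum_subtractf sum_distrib_left)
    then show ?thesis
      unfolding most_regular_excess[OF regular]
      by (simp add: left_diff_distrib sum_subtractf high_def low_def)
  qed
  have "(\<Sum>v\<in>UNIV. int (vertex_degree G v) * 1) = 10"
    using realises card_realises[OF realises] unfolding sum_vertex_degree
    by (simp add: has_edge_sums_def)
  then show card_eq: "card high = card low"
    using weighted[of "\<lambda>_. 1"] by simp
  show "sum r high = sum r low"
    using weighted[of r] sum_degree_weighted[OF realises] by simp
  have "card (high \<union> low) \<le> card (UNIV :: 5 set)"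
    by (intro card_mono) auto
  moreover have "high \<inter> low = {}"
    by (auto simp: high_def low_def)
  ultimately show "card low \<le> 2"
    using card_eq by (simp add: card_Un_disjoint)
qed

lemma most_regular_two_regular:
  assumes regular: "most_regular G"
  shows "vertex_degree G v = 2"
proof -
  let ?high = "{v. vertex_degree G v = 3}" and ?low = "{v. vertex_degree G v = 1}"
  note balance = most_regular_degree_3_1_balance[OF regular]
  consider "card ?low = 0" | "card ?low = 1" | "card ?low = 2"
    using balance(3) by linarith
  then show ?thesis
  proof cases
    case 1
    then have "?low = {}" "?high = {}"
      using balance(1) by simp_all
    then show ?thesis
      using most_regular_excess[OF regular, of v] by simp
  next
    case 2
    then obtain i j where singletons: "?high = {i}" "?low = {j}"
      using balance(1) by (auto simp: card_1_singleton_iff)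
    then have "vertex_degree G i = 3" "vertex_degree G j = 1"
      by auto
    moreover have "r i = r j"
      using balance(2) unfolding singletons by simp
    ultimately show ?thesis
      using most_regular_same_label[OF regular, of i j] by simp
  next
    case 3
    then have "card ?high = 2"
      using balance(1) by simp
    with 3 obtain i p j q where pairs: "?high = {i, p}" "i \<noteq> p" "?low = {j, q}" "j \<noteq> q"
      unfolding card_2_iff by blast
    then have "vertex_degree G i = 3" "vertex_degree G p = 3" "vertex_degree G j = 1"
      "vertex_degree G q = 1"
      by auto
    moreover have "r i + r p = r j + r q"
      using balance(2) pairs(2,4) unfolding pairs(1,3) by simp
    ultimately show ?thesis
      using most_regular_degree_3_pair[OF regular] pairs(2,4) by blast
  qed
qed

theorem exists_five_cycle:
  obtains \<sigma> :: "5 \<Rightarrow> 5" where "bij \<sigma>" "M = image_mset (\<lambda>i. r (\<sigma> i) + r (\<sigma> (i + 1))) (mset_set UNIV)"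
proof -
  obtain G where regular: "most_regular G"
    using exists_most_regular by blast
  then obtain \<sigma> :: "5 \<Rightarrow> 5" where cycle: "bij \<sigma>" "G = range (\<lambda>i. {\<sigma> i, \<sigma> (i + 1)})"
    using two_regular_five_cycle[OF most_regular_realises[OF regular] most_regular_two_regular] by blast
  let ?edge = "\<lambda>i. {\<sigma> i, \<sigma> (i + 1)}"
  have "card (range ?edge) = card (UNIV :: 5 set)"
    using card_realises[OF most_regular_realises[OF regular]] cycle(2) by simp
  then have "inj ?edge"
    by (intro eq_card_imp_inj_on) auto
  then have "mset_set G = image_mset ?edge (mset_set UNIV)"
    unfolding cycle(2) by (rule image_mset_mset_set[symmetric])
  moreover have "M = image_mset (sum r) (mset_set G)"
    using most_regular_realises[OF regular] by (simp add: has_edge_sums_def)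
  ultimately have "M = image_mset (\<lambda>i. sum r (?edge i)) (mset_set UNIV)"
    by (simp add: multiset.map_comp comp_def)
  moreover have "\<sigma> i \<noteq> \<sigma> (i + 1)" for i
    using cycle(1) by (simp add: bij_def inj_eq)
  ultimately have "M = image_mset (\<lambda>i. r (\<sigma> i) + r (\<sigma> (i + 1))) (mset_set UNIV)"
    by simp
  with cycle(1) show thesis by (rule that)
qed

end

section \<open>Weights without a pentagon\<close>

definition has_pentagon :: "(5 \<Rightarrow> int) \<Rightarrow> (5 \<Rightarrow> int) \<Rightarrow> bool"
  where "has_pentagon r s \<longleftrightarrow>
    (\<exists>(\<sigma> :: 5 \<Rightarrow> 5) (\<tau> :: 5 \<Rightarrow> 5). bij \<sigma> \<and> bij \<tau> \<and> (\<forall>i. r (\<sigma> i) + r (\<sigma> (i + 1)) + s (\<tau> i) = 0))"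

abbreviation neg_part :: "int \<Rightarrow> int" where "neg_part a \<equiv> max 0 (- a)"

lemma semistable_edge_sums:
  fixes \<Phi> :: "complex model" and y :: "5 \<Rightarrow> int"
  assumes inv: "invariant_of_weight w p" "p \<in> model_polys" "w > 0"
    and model: "\<Phi> \<in> X\<^sub>5 UNIV" "eval_model p \<Phi> \<noteq> 0"
    and weight_0: "\<And>i j k. \<Phi> $ i $ j $ k \<noteq> 0 \<Longrightarrow> r i + r j + s k = 0"
  shows "\<exists>W. has_edge_sums r (image_mset (\<lambda>k. - s k) (mset_set UNIV)) W \<and> 2 * sum y UNIV \<le> (\<Sum>X\<in>W. sum y X)"
proof -
  obtain H :: "5 \<Rightarrow> 5 \<times> 5" where selection: "\<And>k. fst (H k) < snd (H k)"
    "det (\<chi> k. \<Phi> $ fst (H k) $ snd (H k)) \<noteq> 0"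
    "2 * sum y UNIV \<le> (\<Sum>k\<in>UNIV. y (fst (H k)) + y (snd (H k)))"
    by (rule weighted_row_selection[OF inv model, of y]) (rule that)
  define edge where "edge k = {fst (H k), snd (H k)}" for k
  have sum_edge: "sum f (edge k) = f (fst (H k)) + f (snd (H k))" for f :: "5 \<Rightarrow> int" and k
    using selection(1)[of k] by (simp add: edge_def)
  obtain q where transversal: "q permutes UNIV" "\<And>k. \<Phi> $ fst (H k) $ snd (H k) $ q k \<noteq> 0"
    using det_nonzero_transversal[OF selection(2)] by auto
  have "inj edge"
  proof (rule injI, rule ccontr)
    fix k l assume "edge k = edge l" "k \<noteq> l"
    then have "H k = H l"
      using selection(1)[of k] selection(1)[of l] by (auto simp: edge_def doubleton_eq_iff prod_eq_iff)
    then have "det (\<chi> k. \<Phi> $ fst (H k) $ snd (H k)) = 0"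
      using \<open>k \<noteq> l\<close> by (intro det_identical_rows[of k l]) (auto simp: row_def)
    with selection(2) show False by simp
  qed
  have "image_mset (sum r) (mset_set (range edge)) = image_mset (\<lambda>k. sum r (edge k)) (mset_set UNIV)"
    by (simp add: multiset.map_comp comp_def flip: image_mset_mset_set[OF \<open>inj edge\<close>])
  also have "\<dots> = image_mset (\<lambda>k. - s (q k)) (mset_set UNIV)"
    using weight_0[OF transversal(2)] by (intro image_mset_cong) (simp add: sum_edge eq_neg_iff_add_eq_0)
  also have "\<dots> = image_mset (\<lambda>k. - s k) (image_mset q (mset_set UNIV))"
    by (simp add: multiset.map_comp comp_def)
  also have "image_mset q (mset_set UNIV) = mset_set UNIV"
    using transversal(1) by (simp add: image_mset_mset_set permutes_inj permutes_image)
  finally have "has_edge_sums r (image_mset (\<lambda>k. - s k) (mset_set UNIV)) (range edge)"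
    using selection(1) by (auto simp: has_edge_sums_def edge_def card_insert_if dest: less_imp_neq)
  moreover have "(\<Sum>X\<in>range edge. sum y X) = (\<Sum>k\<in>UNIV. y (fst (H k)) + y (snd (H k)))"
    by (simp add: sum.reindex[OF \<open>inj edge\<close>] sum_edge)
  ultimately show ?thesis
    using selection(3) by auto
qed

lemma semistable_has_pentagon:
  fixes \<Phi> :: "complex model"
  assumes "invariant_of_weight w p" "p \<in> model_polys" "w > 0" "\<Phi> \<in> X\<^sub>5 UNIV" "eval_model p \<Phi> \<noteq> 0"
    and "\<And>i j k. \<Phi> $ i $ j $ k \<noteq> 0 \<Longrightarrow> r i + r j + s k = 0"
  shows "has_pentagon r s"
proof -
  interpret balanced_edge_sums r "image_mset (\<lambda>k. - s k) (mset_set UNIV)"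
    by unfold_locales (rule semistable_edge_sums[OF assms])
  obtain \<sigma> :: "5 \<Rightarrow> 5" where cycle: "bij \<sigma>"
    "image_mset (\<lambda>k. - s k) (mset_set UNIV) = image_mset (\<lambda>i. r (\<sigma> i) + r (\<sigma> (i + 1))) (mset_set UNIV)"
    by (rule exists_five_cycle)
  obtain \<tau> where matching: "bij_betw \<tau> UNIV UNIV" "\<And>i. - s (\<tau> i) = r (\<sigma> i) + r (\<sigma> (i + 1))"
    using image_mset_eq_bij_betw[OF finite finite cycle(2)[symmetric]] by auto
  then have "r (\<sigma> i) + r (\<sigma> (i + 1)) + s (\<tau> i) = 0" for i
    using matching(2)[of i] by linarith
  with cycle(1) matching(1) show ?thesis
    unfolding has_pentagon_def by blast
qed

lemma neg_weight_without_pentagon: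
  assumes inv: "invariant_of_weight w p" "p \<in> model_polys" "w > 0"
    and total: "2 * sum r UNIV + sum s UNIV = 0" and "\<not> has_pentagon r s"
    and monomial: "m \<in> monomials p"
  shows "1 \<le> mono_weight (\<lambda>u. neg_part (coord_weight r s u)) m"
proof (rule ccontr)
  let ?t = "coord_weight r s"
  assume "\<not> 1 \<le> mono_weight (\<lambda>u. neg_part (?t u)) m"
  then have "mono_weight (\<lambda>u. neg_part (?t u)) m = 0"
    using mono_weight_nonneg[of m "\<lambda>u. neg_part (?t u)"] by simp
  then have nonneg: "0 \<le> ?t u" if "u \<in> vars m" for u
    using mono_weight_eq_0D[of "\<lambda>u. neg_part (?t u)" m u] that by auto
  have "mono_weight ?t m = 0"
    using invariant_mono_weight[OF inv(1,2) monomial] total by simp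
  then have "vars m \<subseteq> {u. ?t u = 0}"
    using mono_weight_eq_0D[of ?t m] nonneg by auto
  then obtain \<psi> :: "5 \<times> 5 \<times> 5 \<Rightarrow> complex" where supported: "\<And>u. ?t u \<noteq> 0 \<Longrightarrow> \<psi> u = 0" "int_eval \<psi> p \<noteq> 0"
    using exists_supported_nonzero[OF monomial, of "{u. ?t u = 0}"] by auto
  have "has_pentagon r s"
  proof (rule semistable_has_pentagon[OF inv coord_model_mem[of \<psi>]])
    show "eval_model p (coord_model \<psi>) \<noteq> 0"
      using supported(2) by (simp add: eval_model_coord_model[OF inv(2)])
    show "r i + r j + s k = 0" if "coord_model \<psi> $ i $ j $ k \<noteq> 0" for i j k
      using that supported(1)[of "(i, j, k)"] supported(1)[of "(j, i, k)"]
      by (auto simp: add.commute split: if_splits)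
  qed
  with \<open>\<not> has_pentagon r s\<close> show False by simp
qed

lemma discriminant_neg_weight_without_pentagon:
  assumes discriminant: "is_discriminant D"
    and no_pentagon: "2 * sum r UNIV + sum s UNIV = 0" "\<not> has_pentagon r s"
    and monomial: "m \<in> monomials D"
  shows "2 \<le> mono_weight (\<lambda>u. neg_part (coord_weight r s u)) m"
proof -
  let ?W = "mono_weight (\<lambda>u. neg_part (coord_weight r s u))"
  obtain c4 c6 where c4_c6: "c4 \<in> model_polys" "invariant_of_weight 4 c4" "c6 \<in> model_polys"
    "invariant_of_weight 6 c6"
    and relation: "c4 ^ 3 - c6 ^ 2 = 1728 * D"
    using discriminant unfolding is_discriminant_def by blast
  have c4_ge: "1 \<le> ?W n" if "n \<in> monomials c4" for n
    using neg_weight_without_pentagon[OF c4_c6(2,1) _ no_pentagon that] by simp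
  have c6_ge: "1 \<le> ?W n" if "n \<in> monomials c6" for n
    using neg_weight_without_pentagon[OF c4_c6(4,3) _ no_pentagon that] by simp
  have c4_square_ge: "2 \<le> ?W n" if "n \<in> monomials (c4 * c4)" for n
    using mono_weight_mult_ge[OF c4_ge c4_ge that] by simp
  have "m \<in> monomials (1728 * D)"
    using monomial mcoeff_of_int_mult[of 1728 D m] by (simp add: in_keys_iff)
  then have "m \<in> monomials (c4 * (c4 * c4)) \<or> m \<in> monomials (c6 * c6)"
    using keys_diff[of "c4 ^ 3" "c6 ^ 2"] unfolding relation[symmetric]
    by (auto simp: power3_eq_cube power2_eq_square mult.assoc)
  then show ?thesis
  proof
    assume "m \<in> monomials (c4 * (c4 * c4))"
    from mono_weight_mult_ge[OF c4_ge c4_square_ge this] show ?thesis by simp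
  next
    assume "m \<in> monomials (c6 * c6)"
    from mono_weight_mult_ge[OF c6_ge c6_ge this] show ?thesis by simp
  qed
qed

section \<open>First-order invariance\<close>

lemma int_eval_partial_deriv:
  fixes p :: "('x, int) mvpoly"
  shows "int_eval x (partial_deriv v p) =
    (\<Sum>m\<in>monomials p. of_int (mcoeff p m) * (of_nat (exponent m v) * mono_eval x (m - var_monomial v)))"
  by (simp add: partial_deriv_def int_eval.eval_mvmonom mult_ac)

lemma pderiv_mono_eval:
  fixes f :: "'x::finite \<Rightarrow> 'a::idom poly"
  shows "pderiv (mono_eval f m) =
    (\<Sum>v\<in>UNIV. of_nat (exponent m v) * mono_eval f (m - var_monomial v) * pderiv (f v))"
proof -
  have "mono_eval f (m - var_monomial v) =
      f v ^ (exponent m v - 1) * (\<Prod>u\<in>UNIV - {v}. f u ^ exponent m u)" for v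
  proof -
    have "mono_eval f (m - var_monomial v) = (\<Prod>u\<in>UNIV. f u ^ exponent (m - var_monomial v) u)"
      by (rule mono_eval_superset) auto
    also have "\<dots> = f v ^ (exponent m v - 1) * (\<Prod>u\<in>UNIV - {v}. f u ^ exponent m u)"
      by (subst prod.remove[of _ v])
        (auto simp: lookup_minus lookup_single when_def intro!: prod.cong arg_cong2[of _ _ _ _ "(*)"])
    finally show ?thesis .
  qed
  moreover have "mono_eval f m = (\<Prod>v\<in>UNIV. f v ^ exponent m v)"
    by (rule mono_eval_superset) auto
  ultimately show ?thesis
    by (simp add: pderiv_prod pderiv_power of_nat_poly mult_ac)
qed

lemma pderiv_int_eval:
  fixes f :: "'x::finite \<Rightarrow> 'a::idom poly"
  shows "pderiv (int_eval f p) = (\<Sum>v\<in>UNIV. int_eval f (partial_deriv v p) * pderiv (f v))"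
proof -
  have "pderiv (of_int c * q) = of_int c * pderiv q" for c and q :: "'a poly"
    by (simp add: of_int_poly pderiv_smult)
  then have "pderiv (int_eval f p) = (\<Sum>m\<in>monomials p. \<Sum>v\<in>UNIV.
      of_int (mcoeff p m) * (of_nat (exponent m v) * mono_eval f (m - var_monomial v)) * pderiv (f v))"
    by (simp add: int_eval.eval_eq_sum higher_pderiv_sum[of 1, simplified]
      pderiv_mono_eval sum_distrib_left mult_ac)
  also have "\<dots> = (\<Sum>v\<in>UNIV. int_eval f (partial_deriv v p) * pderiv (f v))"
    by (subst sum.swap) (simp add: int_eval_partial_deriv sum_distrib_right)
  finally show ?thesis .
qed

lemma mcoeff_partial_deriv:
  fixes p :: "('x, int) mvpoly"
  shows "mcoeff (partial_deriv v p) n = (int (exponent n v) + 1) * mcoeff p (n + var_monomial v)"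
proof -
  have "mcoeff (mvmonom (m - var_monomial v) (of_nat (exponent m v) * mcoeff p m)) n =
      (if m = n + var_monomial v then int (exponent m v) * mcoeff p m else 0)" for m
  proof (cases "exponent m v = 0")
    case True
    then have "m \<noteq> n + var_monomial v"
      by (auto simp: lookup_add)
    then show ?thesis
      using True by simp
  next
    case False
    then have "m - var_monomial v + var_monomial v = m"
      by (intro poly_mapping_eqI) (auto simp: lookup_add lookup_minus lookup_single when_def)
    then have "m - var_monomial v = n \<longleftrightarrow> m = n + var_monomial v"
      by auto
    then show ?thesis
      by (simp add: lookup_single when_def)
  qed
  then show ?thesis
    by (auto simp: partial_deriv_def lookup_sum in_keys_iff lookup_add)
qed

lemma invariant_first_order:
  fixes \<psi> \<eta> :: "5 \<times> 5 \<times> 5 \<Rightarrow> 'a::idom"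
  assumes inv: "invariant_of_weight w p" "p \<in> model_polys"
    and act: "act A B (coord_model (\<lambda>u. [:\<psi> u:])) = coord_model (\<lambda>u. [:\<psi> u, \<eta> u:])"
    and det: "act_det A B = [:1, c:]"
  shows "(\<Sum>u\<in>UNIV. \<eta> u * int_eval \<psi> (partial_deriv u p)) = of_nat w * c * int_eval \<psi> p"
proof -
  have expansion: "int_eval (\<lambda>u. [:\<psi> u, \<eta> u:]) p = [:1, c:] ^ w * int_eval (\<lambda>u. [:\<psi> u:]) p"
    using invariant_of_weight_act[OF inv(1) coord_model_mem[of "\<lambda>u. [:\<psi> u:]"], of A B]
    by (simp add: act det eval_model_coord_model[OF inv(2)])
  have "poly (pderiv (int_eval (\<lambda>u. [:\<psi> u, \<eta> u:]) p)) 0 = (\<Sum>u\<in>UNIV. \<eta> u * int_eval \<psi> (partial_deriv u p))"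
    by (simp add: pderiv_int_eval poly_sum poly_int_eval pderiv_pCons mult.commute)
  moreover have "poly (pderiv ([:1, c:] ^ w * int_eval (\<lambda>u. [:\<psi> u:]) p)) 0 = of_nat w * c * int_eval \<psi> p"
    by (simp add: pderiv_mult pderiv_int_eval pderiv_power pderiv_pCons poly_int_eval mult_ac)
  ultimately show ?thesis
    by (simp add: expansion)
qed

definition row_variation :: "5 \<Rightarrow> 5 \<Rightarrow> (5 \<times> 5 \<times> 5 \<Rightarrow> 'a::comm_ring_1) \<Rightarrow> 5 \<times> 5 \<times> 5 \<Rightarrow> 'a"
  where "row_variation x b \<psi> = (\<lambda>(i, j, k). if i < j then
     (if i = x then coord_model \<psi> $ b $ j $ k else 0) +
     (if j = x then coord_model \<psi> $ i $ b $ k else 0) else 0)"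

definition column_variation :: "5 \<Rightarrow> 5 \<Rightarrow> (5 \<times> 5 \<times> 5 \<Rightarrow> 'a::comm_ring_1) \<Rightarrow> 5 \<times> 5 \<times> 5 \<Rightarrow> 'a"
  where "column_variation x b \<psi> = (\<lambda>(i, j, k). if k = x then \<psi> (i, j, b) else 0)"

lemma int_eval_row_variation:
  "int_eval y (row_variation x b \<psi> u) = row_variation x b (\<lambda>v. int_eval y (\<psi> v)) u"
  by (auto simp: row_variation_def split: prod.split)

lemma int_eval_column_variation:
  "int_eval y (column_variation x b \<psi> u) = column_variation x b (\<lambda>v. int_eval y (\<psi> v)) u"
  by (auto simp: column_variation_def split: prod.split)

lemma row_variation_add: "row_variation x b (\<lambda>v. \<psi> v + \<phi> v) u = row_variation x b \<psi> u + row_variation x b \<phi> u"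
  by (auto simp: row_variation_def split: prod.split)

lemma row_variation_of_int: "row_variation x b (\<lambda>v. of_int (c v)) u = of_int (row_variation x b c u)"
  by (auto simp: row_variation_def split: prod.split)

lemma row_invariance:
  assumes "invariant_of_weight w p" "p \<in> model_polys" "x \<noteq> b"
  shows "(\<Sum>u\<in>UNIV. row_variation x b var u * partial_deriv u p) = 0"
proof (rule int_eval_complex_eq_0)
  fix \<psi> :: "5 \<times> 5 \<times> 5 \<Rightarrow> complex"
  let ?A = "row_addition b (\<lambda>i. if i = x then [:0, 1 :: complex:] else 0)"
  have "act ?A (mat 1) (coord_model (\<lambda>u. [:\<psi> u:])) = coord_model (\<lambda>u. [:\<psi> u, row_variation x b \<psi> u:])"
    by (simp only: vec_eq_iff act_row_addition_left[OF coord_model_mem]) (auto simp: row_variation_def)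
  moreover have "act_det ?A (mat 1) = [:1, 0:]"
    unfolding act_det_def det_row_addition det_I using assms(3) by (simp add: one_pCons power2_eq_square)
  ultimately have "(\<Sum>u\<in>UNIV. row_variation x b \<psi> u * int_eval \<psi> (partial_deriv u p)) = 0"
    using invariant_first_order[OF assms(1,2)] by fastforce
  then show "int_eval \<psi> (\<Sum>u\<in>UNIV. row_variation x b var u * partial_deriv u p) = 0"
    by (simp add: int_eval_row_variation)
qed

lemma column_invariance:
  assumes "invariant_of_weight w p" "p \<in> model_polys"
  shows "(\<Sum>u\<in>UNIV. column_variation x b var u * partial_deriv u p) = of_int (int w * of_bool (x = b)) * p"
proof (rule int_eval_complex_eqI)
  fix \<psi> :: "5 \<times> 5 \<times> 5 \<Rightarrow> complex"
  let ?B = "row_addition b (\<lambda>i. if i = x then [:0, 1 :: complex:] else 0)"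
  have "act (mat 1) ?B (coord_model (\<lambda>u. [:\<psi> u:])) = coord_model (\<lambda>u. [:\<psi> u, column_variation x b \<psi> u:])"
    by (simp only: vec_eq_iff act_row_addition_right) (auto simp: column_variation_def)
  moreover have "act_det (mat 1) ?B = [:1, of_bool (x = b):]"
    unfolding act_det_def det_row_addition det_I by (simp add: one_pCons power2_eq_square)
  ultimately have "(\<Sum>u\<in>UNIV. column_variation x b \<psi> u * int_eval \<psi> (partial_deriv u p)) =
      of_nat w * of_bool (x = b) * int_eval \<psi> p"
    using invariant_first_order[OF assms] by blast
  then show "int_eval \<psi> (\<Sum>u\<in>UNIV. column_variation x b var u * partial_deriv u p) =
      int_eval \<psi> (of_int (int w * of_bool (x = b)) * p)"
    unfolding int_eval.eval_mult int_eval_of_int by (simp add: int_eval_column_variation)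
qed

section \<open>Taylor expansion of invariants\<close>

definition taylor_shift :: "('x \<Rightarrow> int) \<Rightarrow> ('x, int) mvpoly \<Rightarrow> ('x, int) mvpoly"
  where "taylor_shift c p = int_eval (\<lambda>v. var v + of_int (c v)) p"

lemma int_eval_taylor_shift: "int_eval x (taylor_shift c p) = int_eval (\<lambda>v. x v + of_int (c v)) p"
  by (simp add: taylor_shift_def int_eval_compose)

lemma taylor_shift_mult: "taylor_shift c (p * q) = taylor_shift c p * taylor_shift c q"
  by (simp add: taylor_shift_def)

lemma taylor_shift_sum: "taylor_shift c (\<Sum>i\<in>I. f i) = (\<Sum>i\<in>I. taylor_shift c (f i))"
  by (simp add: taylor_shift_def)

lemma taylor_shift_of_int: "taylor_shift c (of_int n) = of_int n"
  by (simp add: taylor_shift_def)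

lemma mcoeff_taylor_shift_0:
  "of_int (mcoeff (taylor_shift c p) 0) = (int_eval (\<lambda>v. of_int (c v)) p :: 'a::comm_ring_1)"
  by (simp add: int_eval_taylor_shift flip: int_eval_at_0)

lemma partial_deriv_taylor_shift:
  fixes p :: "('x::finite, int) mvpoly"
  shows "partial_deriv v (taylor_shift c p) = taylor_shift c (partial_deriv v p)"
proof (rule int_eval_complex_eqI)
  fix x :: "'x \<Rightarrow> complex"
  have directional: "int_eval y (partial_deriv v q) =
      poly (pderiv (int_eval (\<lambda>u. [:y u, of_bool (u = v):]) q)) 0"
    for y :: "'x \<Rightarrow> complex" and q
    by (simp add: pderiv_int_eval poly_sum poly_int_eval pderiv_pCons)
  have "int_eval (\<lambda>u. [:x u, of_bool (u = v):]) (taylor_shift c p) =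
      int_eval (\<lambda>u. [:x u + of_int (c u), of_bool (u = v):]) p"
    by (simp add: int_eval_taylor_shift of_int_poly)
  then show "int_eval x (partial_deriv v (taylor_shift c p)) =
      int_eval x (taylor_shift c (partial_deriv v p))"
    by (simp add: directional int_eval_taylor_shift)
qed

lemma taylor_shift_row_variation:
  "taylor_shift c (row_variation x b var u) =
    of_int (row_variation x b c u) + row_variation x b var u"
  by (simp add: taylor_shift_def int_eval_row_variation row_variation_add row_variation_of_int)

lemma taylor_shift_column_variation:
  "taylor_shift c (column_variation x b var u) =
    of_int (column_variation x b c u) + column_variation x b var u"
  by (auto simp: taylor_shift_def int_eval_column_variation)
    (auto simp: column_variation_def split: prod.split)

lemma shifted_row_invariance:
  assumes "invariant_of_weight w p" "p \<in> model_polys" "x \<noteq> b"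
  shows "(\<Sum>u\<in>UNIV. (of_int (row_variation x b c u) + row_variation x b var u) *
      partial_deriv u (taylor_shift c p)) = of_int 0 * taylor_shift c p"
  using arg_cong[OF row_invariance[OF assms], of "taylor_shift c"] taylor_shift_of_int[of c 0]
  by (simp add: taylor_shift_sum taylor_shift_mult taylor_shift_row_variation partial_deriv_taylor_shift)

lemma shifted_column_invariance:
  assumes "invariant_of_weight w p" "p \<in> model_polys"
  shows "(\<Sum>u\<in>UNIV. (of_int (column_variation x b c u) + column_variation x b var u) *
      partial_deriv u (taylor_shift c p)) = of_int (int w * of_bool (x = b)) * taylor_shift c p"
  using arg_cong[OF column_invariance[OF assms], of "taylor_shift c"]
  by (simp only: taylor_shift_sum taylor_shift_mult taylor_shift_column_variation
      partial_deriv_taylor_shift taylor_shift_of_int)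

lemma taylor_shift_model_polys:
  assumes "p \<in> model_polys"
  shows "taylor_shift c p \<in> model_polys"
proof -
  let ?t = "\<lambda>(i, j, k). of_bool (\<not> i < j) :: int"
  have "vars m \<subseteq> {(i, j, k). i < j}" if "m \<in> monomials (taylor_shift c p)" for m
  proof -
    have "mono_weight ?t m = 0"
    proof (rule mono_weight_of_quasi_homogeneous[OF _ that])
      fix z :: complex and x :: "5 \<times> 5 \<times> 5 \<Rightarrow> complex"
      show "int_eval (\<lambda>v. z powi ?t v * x v) (taylor_shift c p) = z powi 0 * int_eval x (taylor_shift c p)"
        unfolding int_eval_taylor_shift power_int_0_right mult_1
        by (rule int_eval_model_poly_cong[OF assms]) simp
    qed
    then have "?t v = 0" if "v \<in> vars m" for v
      by (rule mono_weight_eq_0D) (use that in auto)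
    then show ?thesis by auto
  qed
  then show ?thesis
    unfolding model_polys_def by blast
qed

text \<open>The Taylor expansion of an invariant satisfies first-order differential equations whose constant
  parts lower the degree; they exchange a variable of a monomial of least degree for another one.\<close>

definition least_low_monomial :: "('x \<Rightarrow> int) \<Rightarrow> int \<Rightarrow> ('x, int) mvpoly \<Rightarrow> ('x \<Rightarrow>\<^sub>0 nat) \<Rightarrow> bool"
  where "least_low_monomial t N p m \<longleftrightarrow> m \<in> monomials p \<and> mono_weight (\<lambda>v. \<bar>t v\<bar>) m < N \<and>
    (\<forall>n\<in>monomials p. mono_weight (\<lambda>v. \<bar>t v\<bar>) n < N \<longrightarrow> mono_weight (\<lambda>_. 1) m \<le> mono_weight (\<lambda>_. 1) n)"

lemma exists_least_low_monomial:
  assumes "m \<in> monomials p" "mono_weight (\<lambda>v. \<bar>t v\<bar>) m < N"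
  obtains n where "least_low_monomial t N p n"
proof -
  let ?low = "{m \<in> monomials p. mono_weight (\<lambda>v. \<bar>t v\<bar>) m < N}"
  have "arg_min_on (mono_weight (\<lambda>_. 1)) ?low \<in> ?low"
    and "\<not> (\<exists>n\<in>?low. mono_weight (\<lambda>_. 1) n < mono_weight (\<lambda>_. 1) (arg_min_on (mono_weight (\<lambda>_. 1)) ?low))"
    using arg_min_if_finite[of ?low "mono_weight (\<lambda>_. 1)"] assms by auto
  then have "least_low_monomial t N p (arg_min_on (mono_weight (\<lambda>_. 1)) ?low)"
    by (auto simp: least_low_monomial_def not_less)
  then show thesis by (rule that)
qed

lemma var_monomial_split: "v \<in> vars m \<Longrightarrow> m = m - var_monomial v + var_monomial v"
  by (intro poly_mapping_eqI) (auto simp: lookup_add lookup_minus lookup_single when_def in_keys_iff)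

lemma least_low_monomial_replace:
  assumes least: "least_low_monomial t N p m" "v \<in> vars m"
    and same_weight: "\<bar>t u\<bar> = \<bar>t v\<bar>" "m - var_monomial v + var_monomial u \<in> monomials p"
  shows "least_low_monomial t N p (m - var_monomial v + var_monomial u)"
proof -
  have "mono_weight s m = mono_weight s (m - var_monomial v) + s v" for s
    using mono_weight_plus[of s "m - var_monomial v" "var_monomial v"] var_monomial_split[OF least(2)]
    by simp
  then show ?thesis
    using least(1) same_weight by (simp add: least_low_monomial_def mono_weight_plus)
qed

lemma mcoeff_linear_mult_partial_deriv_eq_0:
  assumes linear: "\<And>k. k \<in> monomials L \<Longrightarrow> \<exists>u. k = var_monomial u \<and> \<bar>t v\<bar> \<le> \<bar>t u\<bar> + \<bar>t a\<bar>"
    and least: "least_low_monomial t N p (n + var_monomial a)"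
  shows "mcoeff (L * partial_deriv v p) n = 0"
proof (rule ccontr)
  assume "mcoeff (L * partial_deriv v p) n \<noteq> 0"
  then have "n \<in> monomials (L * partial_deriv v p)"
    by (simp add: in_keys_iff)
  then obtain k k' where product: "n = k + k'" "k \<in> monomials L" "k' \<in> monomials (partial_deriv v p)"
    using keys_mult[of L "partial_deriv v p"] by blast
  obtain u where k_eq: "k = var_monomial u" "\<bar>t v\<bar> \<le> \<bar>t u\<bar> + \<bar>t a\<bar>"
    using linear[OF product(2)] by blast
  have "k' + var_monomial v \<in> monomials p"
    using product(3) by (auto simp: in_keys_iff mcoeff_partial_deriv)
  then show False
    using least k_eq by (auto simp: least_low_monomial_def product(1) mono_weight_plus)
qed

lemma least_low_monomial_exchange:
  fixes p :: "('x::finite, int) mvpoly"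
  assumes deriv: "(\<Sum>v\<in>UNIV. (of_int (\<eta> v) + L v) * partial_deriv v p) = of_int \<kappa> * p"
    and linear: "\<And>v k. k \<in> monomials (L v) \<Longrightarrow> \<exists>u. k = var_monomial u \<and> \<bar>t v\<bar> \<le> \<bar>t u\<bar> + \<bar>t a\<bar>"
    and least: "least_low_monomial t N p m" and "a \<in> vars m" "\<eta> a \<noteq> 0"
  obtains v where "v \<noteq> a" "\<eta> v \<noteq> 0" "m - var_monomial a + var_monomial v \<in> monomials p"
proof -
  define n where "n = m - var_monomial a"
  have m_eq: "m = n + var_monomial a"
    unfolding n_def by (rule var_monomial_split[OF \<open>a \<in> vars m\<close>])
  note no_linear = mcoeff_linear_mult_partial_deriv_eq_0[OF linear least[unfolded m_eq]]
  have "mcoeff p n = 0"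
    using least by (force simp: least_low_monomial_def m_eq mono_weight_plus in_keys_iff)
  then have "0 = mcoeff (of_int \<kappa> * p) n"
    by (simp add: mcoeff_of_int_mult)
  also have "\<dots> = (\<Sum>v\<in>UNIV. \<eta> v * ((int (exponent n v) + 1) * mcoeff p (n + var_monomial v)))"
    unfolding deriv[symmetric]
    by (simp add: lookup_sum distrib_right lookup_add no_linear mcoeff_of_int_mult mcoeff_partial_deriv)
  finally have sum_0: "(\<Sum>v\<in>UNIV. \<eta> v * ((int (exponent n v) + 1) * mcoeff p (n + var_monomial v))) = 0" ..
  have "\<exists>v. v \<noteq> a \<and> \<eta> v \<noteq> 0 \<and> n + var_monomial v \<in> monomials p"
  proof (rule ccontr)
    assume "\<nexists>v. v \<noteq> a \<and> \<eta> v \<noteq> 0 \<and> n + var_monomial v \<in> monomials p"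
    then have "(\<Sum>v\<in>UNIV - {a}. \<eta> v * ((int (exponent n v) + 1) * mcoeff p (n + var_monomial v))) = 0"
      by (intro sum.neutral) (auto simp: in_keys_iff)
    then have "\<eta> a * ((int (exponent n a) + 1) * mcoeff p m) = 0"
      using sum_0 by (simp add: m_eq sum.remove[of UNIV a])
    then show False
      using \<open>\<eta> a \<noteq> 0\<close> least by (auto simp: least_low_monomial_def in_keys_iff)
  qed
  then show thesis
    using that by (auto simp: n_def)
qed

section \<open>Expansion at the pentagon\<close>

text \<open>The coordinates of the model with \<open>\<Phi>\<^bsub>i,i+1\<^esub> = x\<^sub>i\<close> for \<open>i\<close> modulo 5; its curve is a cycle of five lines.\<close>

definition pent :: "5 \<times> 5 \<times> 5 \<Rightarrow> int"
  where "pent = (\<lambda>(i, j, k).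
    if i < j then if j = i + 1 \<and> k = i then 1 else if i = j + 1 \<and> k = j then - 1 else 0 else 0)"

definition pent_weight :: "(5 \<Rightarrow> int) \<Rightarrow> 5 \<times> 5 \<times> 5 \<Rightarrow> int"
  where "pent_weight r = coord_weight r (\<lambda>i. - (r i + r (i + 1)))"

text \<open>The vertices \<open>\<mu> + 1\<close> and \<open>\<mu> + 4\<close> of the pentagon are the neighbours of \<open>\<mu>\<close>, and \<open>x\<^sub>\<mu>\<^sub>+\<^sub>2\<close>
  belongs to the edge opposite to \<open>\<mu>\<close>: this coordinate smooths a node of the curve.\<close>

definition node_coord :: "5 \<Rightarrow> 5 \<times> 5 \<times> 5"
  where "node_coord \<mu> = (min (\<mu> + 1) (\<mu> + 4), max (\<mu> + 1) (\<mu> + 4), \<mu> + 2)"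

lemma pent_weight_apply: "pent_weight r (i, j, k) = r i + r j - r k - r (k + 1)"
  by (simp add: pent_weight_def)

lemma pent_neq_0_iff: "pent (i, j, k) \<noteq> 0 \<longleftrightarrow> i < j \<and> (j = i + 1 \<and> k = i \<or> i = j + 1 \<and> k = j)"
  by (simp add: pent_def)

lemma pent_weight_eq_0: "pent u \<noteq> 0 \<Longrightarrow> pent_weight r u = 0"
  by (cases u) (auto simp: pent_neq_0_iff pent_weight_apply)

lemma coord_model_pent:
  "coord_model pent $ i $ j $ k = (if j = i + 1 \<and> k = i then 1 else if i = j + 1 \<and> k = j then - 1 else 0)"
  by (cases i j rule: linorder_cases) (auto simp: pent_def add.assoc)

lemma coord_model_of_int: "coord_model (\<lambda>u. of_int (c u)) $ i $ j $ k = of_int (coord_model c $ i $ j $ k)"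
  by simp

lemma taylor_shift_pent_weight:
  assumes inv: "invariant_of_weight w p" "p \<in> model_polys"
    and monomial: "m \<in> monomials (taylor_shift pent p)"
  shows "mono_weight (pent_weight r) m = 0"
proof (rule mono_weight_of_quasi_homogeneous[OF _ monomial])
  fix z :: complex and x :: "5 \<times> 5 \<times> 5 \<Rightarrow> complex"
  assume "z \<noteq> 0"
  let ?s = "\<lambda>i. - (r i + r (i + 1))"
  have "(\<Sum>i\<in>UNIV. r (i + 1)) = sum r UNIV"
    by (rule sum.reindex_bij_betw[OF bij_plus_right])
  then have total: "2 * sum r UNIV + sum ?s UNIV = 0"
    by (simp add: sum_negf sum.distrib sum_subtractf)
  have "z powi pent_weight r u * x u + of_int (pent u) =
      z powi coord_weight r ?s u * (x u + of_int (pent u))" for u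
    using pent_weight_eq_0[of u r] unfolding pent_weight_def
    by (cases "pent u = 0") (auto simp: distrib_left)
  then show "int_eval (\<lambda>u. z powi pent_weight r u * x u) (taylor_shift pent p) =
      z powi 0 * int_eval x (taylor_shift pent p)"
    using invariant_torus_action[OF inv \<open>z \<noteq> 0\<close>, of r ?s] total by (simp add: int_eval_taylor_shift)
qed

lemma eq_add_1_iff:
  fixes i j :: 5
  shows "i = j + 1 \<longleftrightarrow> j = i + 4"
proof -
  have "j + 1 + 4 = j" "i + 4 + 1 = i"
    by (simp_all add: add.assoc)
  then show ?thesis by metis
qed

lemma row_variation_pent_neq_0_iff:
  assumes "x \<noteq> b"
  shows "row_variation x b pent (i, j, k) \<noteq> 0 \<longleftrightarrow>
    i < j \<and> (k = b \<and> {i, j} = {x, b + 1} \<or> k = b + 4 \<and> {i, j} = {x, b + 4})"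
proof (cases "i < j")
  case True
  then show ?thesis
    using assms eq_add_1_iff[of b j] eq_add_1_iff[of i b] unfolding row_variation_def
    by (simp add: coord_model_pent doubleton_eq_iff del: coord_model_nth) auto
qed (simp add: row_variation_def)

lemma pent_weight_row_variation:
  assumes "x \<noteq> b" "row_variation x b pent u \<noteq> 0"
  shows "pent_weight r u = r x - r b"
proof -
  obtain i j k where u_eq: "u = (i, j, k)"
    by (cases u)
  show ?thesis
    using assms(2) unfolding u_eq row_variation_pent_neq_0_iff[OF assms(1)]
    by (auto simp: pent_weight_apply doubleton_eq_iff add.assoc)
qed

lemma monomials_row_variation_var:
  assumes "k \<in> monomials (row_variation x b var v)"
  shows "\<exists>u. k = var_monomial u \<and> pent_weight r v = pent_weight r u + (r x - r b)"
proof -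
  obtain i j l where v_eq: "v = (i, j, l)"
    by (cases v)
  have coord: "k = var_monomial (p, q, l) \<or> k = var_monomial (q, p, l)"
    if "k \<in> monomials (coord_model var $ p $ q $ l)" for p q
    using that by (auto simp: var_def split: if_splits)
  have "i = x \<and> k \<in> monomials (coord_model var $ b $ j $ l) \<or>
      j = x \<and> k \<in> monomials (coord_model var $ i $ b $ l)"
    using assms keys_add[of "if i = x then coord_model var $ b $ j $ l else 0"
      "if j = x then coord_model var $ i $ b $ l else 0"]
    by (auto simp: v_eq row_variation_def simp del: coord_model_nth split: if_splits)
  then have "\<exists>p q. (k = var_monomial (p, q, l) \<or> k = var_monomial (q, p, l)) \<and>
      r i + r j = r p + r q + (r x - r b)"
    using coord by fastforce
  then show ?thesis
    by (elim exE conjE disjE) (auto simp: v_eq pent_weight_apply intro!: exI)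
qed

lemma monomials_column_variation_var:
  assumes "k \<in> monomials (column_variation x b var v)"
  shows "\<exists>u. k = var_monomial u \<and> pent_weight r v = pent_weight r u + (r b + r (b + 1) - r x - r (x + 1))"
proof -
  obtain i j l where v_eq: "v = (i, j, l)"
    by (cases v)
  have "l = x" "k = var_monomial (i, j, b)"
    using assms by (auto simp: v_eq column_variation_def var_def split: if_splits)
  then show ?thesis
    by (intro exI[of _ "(i, j, b)"]) (simp add: v_eq pent_weight_apply)
qed

lemma nonadjacent_5:
  fixes i j :: 5
  assumes "i \<noteq> j" "j \<noteq> i + 1" "i \<noteq> j + 1"
  obtains \<mu> where "{i, j} = {\<mu> + 1, \<mu> + 4}"
proof -
  have j_eq: "j = i + (j - i)"
    by simp
  show thesis
  proof (cases "j - i" rule: exhaust_5)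
    case 3
    then have "j = i + 2"
      using j_eq by simp
    then show thesis
      by (intro that[of "i + 1"]) (auto simp: add.assoc)
  next
    case 4
    then have "j = i + 3"
      using j_eq by simp
    then show thesis
      by (intro that[of "i + 4"]) (auto simp: add.assoc)
  next
    case 5
    then have "j + 1 = i + 4 + 1"
      using j_eq by simp
    then show thesis
      using assms(3) by (simp add: add.assoc)
  qed (use assms j_eq in auto)
qed

lemma pent_on_edge: "{i, j} = {c, c + 1} \<Longrightarrow> i < j \<Longrightarrow> \<exists>k. pent (i, j, k) \<noteq> 0"
  by (auto simp: pent_neq_0_iff doubleton_eq_iff)

lemma row_variation_pent_reaches_via:
  assumes edge: "i < j" "{i, j} = {x, c}" and "x \<noteq> b"
    and side: "c = b + 1 \<and> k = b \<and> d = b + 4 \<or> c = b + 4 \<and> k = b + 4 \<and> d = b + 1"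
    and other: "x = d \<or> (\<exists>l. {x, d} = {l, l + 1})"
  shows "\<exists>x b. x \<noteq> b \<and> row_variation x b pent (i, j, k) \<noteq> 0 \<and>
    (\<forall>i' j' k'. row_variation x b pent (i', j', k') \<noteq> 0 \<longrightarrow>
      (i', j', k') = (i, j, k) \<or> (\<exists>c. pent (i', j', c) \<noteq> 0))"
proof (rule exI[of _ x], rule exI[of _ b], intro conjI allI impI)
  note nonzero_iff = row_variation_pent_neq_0_iff[OF \<open>x \<noteq> b\<close>]
  show "row_variation x b pent (i, j, k) \<noteq> 0"
    unfolding nonzero_iff using edge side by auto
  fix i' j' k' assume "row_variation x b pent (i', j', k') \<noteq> 0"
  then have "i' < j'" and "k' = k \<and> {i', j'} = {i, j} \<or> {i', j'} = {x, d}"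
    unfolding nonzero_iff edge(2) using side by auto
  then consider "k' = k" "{i', j'} = {i, j}" | l where "{i', j'} = {l, l + 1}"
    using other by fastforce
  then show "(i', j', k') = (i, j, k) \<or> (\<exists>c. pent (i', j', c) \<noteq> 0)"
    using edge(1) \<open>i' < j'\<close> pent_on_edge[of i' j'] by cases (auto simp: doubleton_eq_iff)
qed (rule \<open>x \<noteq> b\<close>)

text \<open>The coordinate directions other than the five \<open>node_coord \<mu>\<close> are tangent to the orbit of the pentagon:
  those on an edge by changes of variables, the others by row operations and modulo the former.\<close>

lemma row_variation_pent_reaches:
  assumes nonadjacent: "i < j" "j \<noteq> i + 1" "i \<noteq> j + 1" and not_node: "(i, j, k) \<notin> range node_coord"
  shows "\<exists>x b. x \<noteq> b \<and> row_variation x b pent (i, j, k) \<noteq> 0 \<and>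
    (\<forall>i' j' k'. row_variation x b pent (i', j', k') \<noteq> 0 \<longrightarrow>
      (i', j', k') = (i, j, k) \<or> (\<exists>c. pent (i', j', c) \<noteq> 0))"
proof -
  obtain \<mu> where ij_eq: "{i, j} = {\<mu> + 1, \<mu> + 4}" "{i, j} = {\<mu> + 4, \<mu> + 1}"
    using nonadjacent_5[of i j] nonadjacent by (metis insert_commute less_irrefl)
  have k_eq: "k = \<mu> + (k - \<mu>)"
    by simp
  note via = row_variation_pent_reaches_via[OF nonadjacent(1)]
  show ?thesis
  proof (cases "k - \<mu>" rule: exhaust_5)
    case 1
    then have "k = \<mu>"
      using k_eq by simp
    then show ?thesis
      by (intro via[of "\<mu> + 4" "\<mu> + 1" \<mu> k "\<mu> + 4", OF ij_eq(2)]) auto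
  next
    case 2
    then have "k = \<mu> + 1" "{\<mu> + 4, \<mu> + 3} = {\<mu> + 3, \<mu> + 3 + 1}"
      using k_eq by (auto simp: add.assoc)
    then show ?thesis
      by (intro via[of "\<mu> + 4" "\<mu> + 1" "\<mu> + 2" k "\<mu> + 3", OF ij_eq(2)]) (auto simp: add.assoc)
  next
    case 3
    then have "(i, j, k) = node_coord \<mu>"
      using ij_eq nonadjacent(1) k_eq by (auto simp: node_coord_def doubleton_eq_iff min_def max_def)
    then show ?thesis
      using not_node by blast
  next
    case 4
    then have "k = \<mu> + 3" "{\<mu> + 1, \<mu> + 2} = {\<mu> + 1, \<mu> + 1 + 1}"
      using k_eq by (auto simp: add.assoc)
    then show ?thesis
      by (intro via[of "\<mu> + 1" "\<mu> + 4" "\<mu> + 3" k "\<mu> + 2", OF ij_eq(1)]) (auto simp: add.assoc)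
  next
    case 5
    then have "k = \<mu> + 4"
      using k_eq by simp
    then show ?thesis
      by (intro via[of "\<mu> + 1" "\<mu> + 4" \<mu> k "\<mu> + 1", OF ij_eq(1)]) auto
  qed
qed

section \<open>The discriminant near the pentagon\<close>

text \<open>The curve is reducible, since one of the Pfaffians is \<open>x\<^sub>0 x\<^sub>2\<close>.\<close>

lemma pentagon_singular:
  fixes \<Phi> :: "complex model"
  assumes "\<Phi> = coord_model (\<lambda>u. of_int (pent u))"
  shows "\<not> nonsingular \<Phi>"
proof -
  have \<Phi>_nth: "\<Phi> $ i $ j = (if j = i + 1 then axis i 1 else if i = j + 1 then - axis j 1 else 0)" for i j
    unfolding vec_eq_iff assms coord_model_of_int coord_model_pent by (auto simp: axis_def)
  have form_at_axis: "eval_mvpoly id (($) (axis l 1)) (form_poly c) = c $ l" for c :: "complex^5" and l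
    by (simp add: form_poly_def id_eval.eval_mvmonom axis_def if_distrib[of "\<lambda>x. _ * x"] cong: if_cong)
  have on_curve: "axis l 1 \<in> curve_points \<Phi>" for l
    by (auto simp: curve_points_def pfaffian_def Let_def form_at_axis \<Phi>_nth)
      (auto simp: axis_def add.assoc)
  let ?f = "form_poly (\<Phi> $ 0 $ 1)" and ?g = "form_poly (\<Phi> $ 2 $ 3)"
  have "pfaffian \<Phi> 4 = ?f * ?g"
    by (simp add: pfaffian_def Let_def \<Phi>_nth form_poly_def)
  then have "eval_mvpoly id (($) y) (?f * ?g) = 0" if "y \<in> curve_points \<Phi>" for y
    using that by (metis (mono_tags, lifting) curve_points_def mem_Collect_eq)
  moreover have "eval_mvpoly id (($) (axis 0 1)) ?f \<noteq> 0" "eval_mvpoly id (($) (axis 2 1)) ?g \<noteq> 0"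
    by (simp_all add: form_at_axis \<Phi>_nth)
  ultimately have "\<not> irreducible_curve \<Phi>"
    using on_curve unfolding irreducible_curve_def by blast
  then show ?thesis
    by (simp add: nonsingular_def)
qed

lemma mcoeff_discriminant_pent:
  assumes "is_discriminant D"
  shows "mcoeff (taylor_shift pent D) 0 = 0"
proof -
  let ?\<Phi> = "coord_model (\<lambda>u. of_int (pent u)) :: complex model"
  have discriminant: "D \<in> model_polys" "eval_model D ?\<Phi> \<noteq> 0 \<longleftrightarrow> nonsingular ?\<Phi>"
    using assms coord_model_mem[of "\<lambda>u. complex_of_int (pent u)"] unfolding is_discriminant_def by blast+
  have "complex_of_int (mcoeff (taylor_shift pent D) 0) = eval_model D ?\<Phi>"
    by (simp add: mcoeff_taylor_shift_0 eval_model_coord_model[OF discriminant(1)])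
  also have "\<dots> = 0"
    using discriminant(2) pentagon_singular by blast
  finally show ?thesis by simp
qed

text \<open>The sum of the absolute values is even, and \<open>5 (f i - f (i + 1))\<close> is a combination of the five numbers
  with coefficients at most 2 in absolute value.\<close>

lemma pentagon_spread:
  fixes f :: "5 \<Rightarrow> int"
  assumes "(\<Sum>\<mu>\<in>UNIV. \<bar>f (\<mu> + 1) + f (\<mu> + 4) - f (\<mu> + 2) - f (\<mu> + 3)\<bar>) < 4"
  shows "f i = f j"
proof -
  define e where "e \<mu> = f (\<mu> + 1) + f (\<mu> + 4) - f (\<mu> + 2) - f (\<mu> + 3)" for \<mu>
  have "(\<Sum>\<mu>\<in>UNIV. e \<mu>) = 0"
    by (simp add: e_def sum_5)
  moreover have "even (\<Sum>\<mu>\<in>UNIV. \<bar>e \<mu>\<bar>) \<longleftrightarrow> even (\<Sum>\<mu>\<in>UNIV. e \<mu>)"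
    by (simp add: sum_5)
  ultimately have even: "even (\<Sum>\<mu>\<in>UNIV. \<bar>e \<mu>\<bar>)"
    by simp
  have "(\<Sum>\<mu>\<in>UNIV. \<bar>e \<mu>\<bar>) < 4"
    using assms by (simp add: e_def)
  with even have small: "(\<Sum>\<mu>\<in>UNIV. \<bar>e \<mu>\<bar>) \<le> 2"
    by presburger
  have step: "f k = f (k + 1)" for k
  proof -
    have "5 * (f k - f (k + 1)) = 2 * e (k + 4) - e k + e (k + 1) - 2 * e (k + 2)"
      by (simp add: e_def add.assoc)
    moreover have "\<bar>e k\<bar> + \<bar>e (k + 1)\<bar> + \<bar>e (k + 2)\<bar> + \<bar>e (k + 4)\<bar> \<le> 2"
    proof -
      have "(\<Sum>\<mu>\<in>{k, k + 1, k + 2, k + 4}. \<bar>e \<mu>\<bar>) \<le> (\<Sum>\<mu>\<in>UNIV. \<bar>e \<mu>\<bar>)"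
        by (intro sum_mono2) auto
      then show ?thesis
        using small by simp
    qed
    ultimately have "\<bar>5 * (f k - f (k + 1))\<bar> \<le> 4"
      by linarith
    then show ?thesis
      by presburger
  qed
  have "f k = f 0" for k
    using step[of 0] step[of 1] step[of 2] step[of 3] by (cases k rule: exhaust_5) simp_all
  then show ?thesis by metis
qed

lemma inj_node_coord: "inj node_coord"
  by (rule injI) (simp add: node_coord_def)

lemma pent_weight_node_coord: "pent_weight r (node_coord \<mu>) = r (\<mu> + 1) + r (\<mu> + 4) - r (\<mu> + 2) - r (\<mu> + 3)"
  by (simp add: node_coord_def min_def max_def pent_weight_apply add.assoc)

lemma node_monomial_weight:
  assumes inv: "invariant_of_weight w p" "p \<in> model_polys"
    and monomial: "m \<in> monomials (taylor_shift pent p)"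
    and "vars m \<subseteq> range node_coord" "m \<noteq> 0" and not_constant: "r i \<noteq> r j"
  shows "4 \<le> mono_weight (\<lambda>u. \<bar>pent_weight r u\<bar>) m"
proof -
  define k where "k \<mu> = int (exponent m (node_coord \<mu>))" for \<mu>
  have weight: "mono_weight t m = (\<Sum>\<mu>\<in>UNIV. k \<mu> * t (node_coord \<mu>))" for t
    using mono_weight_superset[of "range node_coord" m t] assms(4)
    by (simp add: sum.reindex[OF inj_node_coord] k_def)
  have "k (\<nu> + 1) + k (\<nu> + 4) - k (\<nu> + 2) - k (\<nu> + 3) = 0" for \<nu>
  proof -
    have "mono_weight (pent_weight (\<lambda>i. of_bool (i = \<nu>))) m = 0"
      by (rule taylor_shift_pent_weight[OF inv monomial])
    then show ?thesis
      by (cases \<nu> rule: exhaust_5) (simp_all add: weight pent_weight_node_coord sum_5)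
  qed
  then have "k \<mu> = k 0" for \<mu>
    by (intro pentagon_spread) simp
  then obtain n where k_eq: "\<And>\<mu>. k \<mu> = n"
    by blast
  have "n \<noteq> 0"
  proof
    assume "n = 0"
    then have "u \<notin> vars m" if "u \<in> range node_coord" for u
      using k_eq that by (auto simp: k_def in_keys_iff)
    then have "vars m = {}"
      using assms(4) by blast
    with \<open>m \<noteq> 0\<close> show False by simp
  qed
  then have "1 \<le> n"
    using k_eq[of 0] by (simp add: k_def)
  let ?spread = "\<Sum>\<mu>\<in>UNIV. \<bar>r (\<mu> + 1) + r (\<mu> + 4) - r (\<mu> + 2) - r (\<mu> + 3)\<bar>"
  have "4 \<le> ?spread"
    using pentagon_spread[of r i j] not_constant by linarith
  also have "?spread \<le> n * ?spread"
    using mult_right_mono[OF \<open>1 \<le> n\<close>, of ?spread] by (simp add: sum_nonneg)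
  also have "n * ?spread = mono_weight (\<lambda>u. \<bar>pent_weight r u\<bar>) m"
    by (simp add: weight pent_weight_node_coord sum_distrib_left k_eq)
  finally show ?thesis .
qed

lemma least_low_monomial_off_pentagon:
  assumes inv: "invariant_of_weight w p" "p \<in> model_polys"
    and least: "least_low_monomial (pent_weight r) N (taylor_shift pent p) m"
    and v_in: "(i, j, k) \<in> vars m"
  shows "pent (i, j, c) = 0"
proof (rule ccontr)
  assume on_pentagon: "pent (i, j, c) \<noteq> 0"
  then have weight_eq: "pent_weight r (i, j, k) = r c + r (c + 1) - r k - r (k + 1)"
    using pent_weight_eq_0[OF on_pentagon, of r] by (simp add: pent_weight_apply)
  obtain u where "u \<noteq> (i, j, k)" "column_variation k c pent u \<noteq> 0"
  proof (rule least_low_monomial_exchange[OF shifted_column_invariance[OF inv] _ least v_in])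
    show "\<exists>u. z = var_monomial u \<and> \<bar>pent_weight r v\<bar> \<le> \<bar>pent_weight r u\<bar> + \<bar>pent_weight r (i, j, k)\<bar>"
      if "z \<in> monomials (column_variation k c var v)" for z v
      using monomials_column_variation_var[OF that, of r] abs_triangle_ineq unfolding weight_eq by metis
    show "column_variation k c pent (i, j, k) \<noteq> 0"
      using on_pentagon by (simp add: column_variation_def)
  qed
  then show False
    using on_pentagon by (cases u) (auto simp: column_variation_def pent_neq_0_iff split: if_splits)
qed

lemma least_low_monomial_node:
  assumes inv: "invariant_of_weight w p" "p \<in> model_polys"
    and least: "least_low_monomial (pent_weight r) N (taylor_shift pent p) m"
    and v_in: "(i, j, k) \<in> vars m"
  shows "(i, j, k) \<in> range node_coord"
proof (rule ccontr)
  assume not_node: "(i, j, k) \<notin> range node_coord"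
  have i_less_j: "i < j"
    using least v_in taylor_shift_model_polys[OF inv(2), of pent]
    by (auto simp: least_low_monomial_def model_polys_def)
  moreover have "j \<noteq> i + 1" "i \<noteq> j + 1"
    using least_low_monomial_off_pentagon[OF inv least v_in, of i]
      least_low_monomial_off_pentagon[OF inv least v_in, of j] i_less_j
    by (auto simp: pent_def)
  ultimately obtain x b where variation: "x \<noteq> b" "row_variation x b pent (i, j, k) \<noteq> 0"
    and reached: "\<And>i' j' k'. row_variation x b pent (i', j', k') \<noteq> 0 \<Longrightarrow>
      (i', j', k') = (i, j, k) \<or> (\<exists>c. pent (i', j', c) \<noteq> 0)"
    using row_variation_pent_reaches[OF _ _ _ not_node] by blast
  note variation_weight = pent_weight_row_variation[OF variation(1), of _ r]
  obtain u where exchanged: "u \<noteq> (i, j, k)" "row_variation x b pent u \<noteq> 0"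
    "m - var_monomial (i, j, k) + var_monomial u \<in> monomials (taylor_shift pent p)"
  proof (rule least_low_monomial_exchange[OF shifted_row_invariance[OF inv variation(1)]
    _ least v_in variation(2)])
    show "\<exists>u. z = var_monomial u \<and> \<bar>pent_weight r v\<bar> \<le> \<bar>pent_weight r u\<bar> + \<bar>pent_weight r (i, j, k)\<bar>"
      if "z \<in> monomials (row_variation x b var v)" for z v
      using monomials_row_variation_var[OF that, of r] abs_triangle_ineq
      unfolding variation_weight[OF variation(2)] by metis
  qed
  obtain i' j' k' where u_eq: "u = (i', j', k')"
    by (cases u)
  then obtain c where "pent (i', j', c) \<noteq> 0"
    using reached exchanged(1,2) by blast
  moreover have "least_low_monomial (pent_weight r) N (taylor_shift pent p)
      (m - var_monomial (i, j, k) + var_monomial u)"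
    by (rule least_low_monomial_replace[OF least v_in _ exchanged(3)])
      (simp add: variation_weight variation(2) exchanged(2))
  moreover have "(i', j', k') \<in> vars (m - var_monomial (i, j, k) + var_monomial u)"
    by (simp add: in_keys_iff lookup_add u_eq)
  ultimately show False
    using least_low_monomial_off_pentagon[OF inv] by blast
qed

theorem discriminant_abs_weight_at_pentagon:
  assumes discriminant: "is_discriminant D" and not_constant: "r i \<noteq> r j"
    and monomial: "m \<in> monomials (taylor_shift pent D)"
  shows "4 \<le> mono_weight (\<lambda>u. \<bar>pent_weight r u\<bar>) m"
proof (rule ccontr)
  have inv: "invariant_of_weight 12 D" "D \<in> model_polys"
    using discriminant by (auto simp: is_discriminant_def)
  assume "\<not> 4 \<le> mono_weight (\<lambda>u. \<bar>pent_weight r u\<bar>) m"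
  then obtain n where least: "least_low_monomial (pent_weight r) 4 (taylor_shift pent D) n"
    using exists_least_low_monomial[OF monomial] by (metis not_le)
  then have "n \<noteq> 0"
    using mcoeff_discriminant_pent[OF discriminant] by (auto simp: least_low_monomial_def in_keys_iff)
  moreover have "vars n \<subseteq> range node_coord"
    using least_low_monomial_node[OF inv least] by auto
  ultimately show False
    using node_monomial_weight[OF inv _ _ _ not_constant, of n] least
    by (auto simp: least_low_monomial_def)
qed

section \<open>Discrete valuations\<close>

locale discrete_valuation =
  fixes v :: "'k::field \<Rightarrow> int extended"
  assumes normalised: "normalised_discrete_valuation v"
begin

abbreviation \<O> :: "'k set" where "\<O> \<equiv> valuation_ring v"

definition at_least :: "int \<Rightarrow> 'k \<Rightarrow> bool" where "at_least n x \<longleftrightarrow> Fin n \<le> v x"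

lemma v_0 [simp]: "v 0 = Pinf" and v_eq_Pinf_iff: "v x = Pinf \<longleftrightarrow> x = 0"
  and v_mult: "v (x * y) = v x + v y" and v_add: "min (v x) (v y) \<le> v (x + y)"
  and v_not_Minf: "v x \<noteq> Minf"
  using normalised unfolding normalised_discrete_valuation_def by blast+

lemma v_FinE:
  assumes "x \<noteq> 0"
  obtains n where "v x = Fin n"
  using assms v_eq_Pinf_iff[of x] v_not_Minf[of x] by (cases "v x") auto

lemma v_1 [simp]: "v 1 = Fin 0"
proof -
  obtain n where "v 1 = Fin n"
    using v_FinE[of 1] by auto
  then show ?thesis
    using v_mult[of 1 1] by simp
qed

lemma v_minus_1: "v (- 1) = Fin 0"
proof -
  obtain n where "v (- 1) = Fin n"
    using v_FinE[of "- 1"] by auto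
  then show ?thesis
    using v_mult[of "- 1" "- 1"] by simp
qed

lemma v_inverse:
  assumes "v x = Fin n"
  shows "v (inverse x) = Fin (- n)"
proof -
  have "x \<noteq> 0"
    using assms by auto
  then obtain m where "v (inverse x) = Fin m"
    using v_FinE[of "inverse x"] by auto
  moreover have "v (x * inverse x) = Fin 0"
    using \<open>x \<noteq> 0\<close> by simp
  ultimately show ?thesis
    by (simp add: v_mult assms)
qed

lemma v_power: "v x = Fin a \<Longrightarrow> v (x ^ n) = Fin (int n * a)"
  by (induction n) (auto simp: v_mult distrib_right)

lemma v_powi:
  assumes "v x = Fin a"
  shows "v (x powi n) = Fin (n * a)"
proof (cases "n \<ge> 0")
  case True
  then show ?thesis
    using v_power[OF assms, of "nat n"] by (simp add: power_int_def)
next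
  case False
  then show ?thesis
    using v_power[OF v_inverse[OF assms], of "nat (- n)"] by (simp add: power_int_def)
qed

lemma at_least_0 [simp]: "at_least n 0"
  by (simp add: at_least_def)

lemma at_least_mono: "at_least a x \<Longrightarrow> b \<le> a \<Longrightarrow> at_least b x"
  unfolding at_least_def by (meson less_eq_extended.simps(1) order_trans)

lemma at_least_add: "at_least n x \<Longrightarrow> at_least n y \<Longrightarrow> at_least n (x + y)"
  using v_add[of x y] unfolding at_least_def by (meson min.bounded_iff order_trans)

lemma at_least_mult: "at_least a x \<Longrightarrow> at_least b y \<Longrightarrow> at_least (a + b) (x * y)"
  unfolding at_least_def v_mult using v_not_Minf[of x] v_not_Minf[of y]
  by (cases "v x"; cases "v y") auto

lemma at_least_minus: "at_least n x \<Longrightarrow> at_least n (- x)"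
  using at_least_mult[of 0 "- 1" n x] v_minus_1 by (simp add: at_least_def)

lemma at_least_diff: "at_least n x \<Longrightarrow> at_least n y \<Longrightarrow> at_least n (x - y)"
  using at_least_add[of n x "- y"] at_least_minus[of n y] by simp

lemma at_least_sum: "(\<And>i. i \<in> I \<Longrightarrow> at_least n (f i)) \<Longrightarrow> at_least n (\<Sum>i\<in>I. f i)"
  by (induction I rule: infinite_finite_induct) (auto intro: at_least_add)

lemma at_least_prod: "(\<And>i. i \<in> I \<Longrightarrow> at_least (n i) (f i)) \<Longrightarrow> at_least (\<Sum>i\<in>I. n i) (\<Prod>i\<in>I. f i)"
  by (induction I rule: infinite_finite_induct) (auto simp: at_least_def[of 0 1] intro: at_least_mult)

lemma at_least_power: "at_least a x \<Longrightarrow> at_least (int n * a) (x ^ n)"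
  using at_least_prod[of "{..<n}" "\<lambda>_. a" "\<lambda>_. x"] by simp

lemma mem_valuation_ring_iff: "x \<in> \<O> \<longleftrightarrow> at_least 0 x"
  by (simp add: valuation_ring_def at_least_def)

lemma valuation_ring_closed:
  shows "0 \<in> \<O>" "1 \<in> \<O>" "x \<in> \<O> \<Longrightarrow> y \<in> \<O> \<Longrightarrow> x + y \<in> \<O>" "x \<in> \<O> \<Longrightarrow> y \<in> \<O> \<Longrightarrow> x * y \<in> \<O>" "x \<in> \<O> \<Longrightarrow> - x \<in> \<O>"
  using at_least_add[of 0 x y] at_least_mult[of 0 x 0 y] at_least_minus[of 0 x]
  by (auto simp: mem_valuation_ring_iff at_least_def[of 0 1])

lemma valuation_ring_sum: "(\<And>i. i \<in> I \<Longrightarrow> f i \<in> \<O>) \<Longrightarrow> (\<Sum>i\<in>I. f i) \<in> \<O>"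
  unfolding mem_valuation_ring_iff by (rule at_least_sum)

lemma valuation_ring_prod: "(\<And>i. i \<in> I \<Longrightarrow> f i \<in> \<O>) \<Longrightarrow> (\<Prod>i\<in>I. f i) \<in> \<O>"
  unfolding mem_valuation_ring_iff using at_least_prod[of I "\<lambda>_. 0" f] by simp

lemma of_int_mem_valuation_ring: "of_int c \<in> \<O>"
proof -
  have nat: "of_nat n \<in> \<O>" for n
    by (induction n) (auto intro: valuation_ring_closed)
  show ?thesis
    using nat valuation_ring_closed(5)[OF nat] by (cases c rule: int_cases2) auto
qed

lemma valuation_ring_det: "(\<And>i j. A $ i $ j \<in> \<O>) \<Longrightarrow> det A \<in> \<O>"
  unfolding det_def by (intro valuation_ring_sum valuation_ring_closed valuation_ring_prod)
    (auto intro: of_int_mem_valuation_ring)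

lemma at_least_int_eval:
  assumes x_ge: "\<And>u. at_least (t u) (x u)" and weight_ge: "\<And>m. m \<in> monomials p \<Longrightarrow> N \<le> mono_weight t m"
  shows "at_least N (int_eval x p)"
  unfolding int_eval.eval_eq_sum
proof (rule at_least_sum)
  fix m assume "m \<in> monomials p"
  have "at_least (mono_weight t m) (mono_eval x m)"
    unfolding mono_weight_def mono_eval_def by (intro at_least_prod at_least_power x_ge)
  then have "at_least (0 + mono_weight t m) (of_int (mcoeff p m) * mono_eval x m)"
    using of_int_mem_valuation_ring by (intro at_least_mult) (simp add: mem_valuation_ring_iff)
  then show "at_least N (of_int (mcoeff p m) * mono_eval x m)"
    using at_least_mono weight_ge[OF \<open>m \<in> monomials p\<close>] by simp
qed

lemma v_unit: "x \<in> \<O> \<Longrightarrow> y \<in> \<O> \<Longrightarrow> x * y = 1 \<Longrightarrow> v x = Fin 0"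
  using v_mult[of x y] by (cases "v x"; cases "v y") (auto simp: valuation_ring_def)

lemma divide_mem_valuation_ring:
  assumes "v x \<le> v y" "x \<noteq> 0"
  shows "y / x \<in> \<O>"
proof (cases "y = 0")
  case False
  obtain a b where valuations: "v x = Fin a" "v y = Fin b"
    using assms(2) False by (metis v_FinE)
  have "v (y / x) = Fin (b - a)"
    by (simp add: divide_inverse v_mult v_inverse[OF valuations(1)] valuations(2))
  then show ?thesis
    using assms(1) valuations by (simp add: valuation_ring_def)
qed (simp add: valuation_ring_closed)

end

section \<open>Smith normal form over a discrete valuation ring\<close>

definition invertible_over :: "'a::comm_ring_1 set \<Rightarrow> 'a^'n^'n \<Rightarrow> bool"
  where "invertible_over R A \<longleftrightarrow> (\<forall>i j. A $ i $ j \<in> R) \<and>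
    (\<exists>A'. (\<forall>i j. A' $ i $ j \<in> R) \<and> A ** A' = mat 1 \<and> A' ** A = mat 1)"

definition decoupled :: "'n set \<Rightarrow> 'a::zero^'n^'n \<Rightarrow> bool"
  where "decoupled S A \<longleftrightarrow> (\<forall>a\<in>S. \<forall>b. b \<noteq> a \<longrightarrow> A $ a $ b = 0 \<and> A $ b $ a = 0)"

lemma mem_GL5_iff: "A \<in> GL5 R \<longleftrightarrow> invertible_over R A"
  by (simp add: GL5_def invertible_over_def)

lemma invertible_overI:
  assumes "\<And>i j. A $ i $ j \<in> R" "\<And>i j. A' $ i $ j \<in> R" "A ** A' = mat 1" "A' ** A = mat 1"
  shows "invertible_over R A"
  using assms unfolding invertible_over_def by blast

lemma invertible_overE:
  assumes "invertible_over R A"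
  obtains A' where "invertible_over R A'" "A ** A' = mat 1" "A' ** A = mat 1"
  using assms unfolding invertible_over_def by blast

lemma invertible_over_entry: "invertible_over R A \<Longrightarrow> A $ i $ j \<in> R"
  unfolding invertible_over_def by blast

lemma row_addition_mult: "(row_addition b \<rho> ** A) $ i $ j = A $ i $ j + \<rho> i * A $ b $ j"
  by (simp add: matrix_matrix_mult_def sum_row_addition)

lemma mult_transpose_row_addition: "(A ** transpose (row_addition b \<rho>)) $ i $ j = A $ i $ j + A $ i $ b * \<rho> j"
proof -
  have "A ** transpose (row_addition b \<rho>) = transpose (row_addition b \<rho> ** transpose A)"
    by (simp add: matrix_transpose_mul)
  then show ?thesis
    by (simp add: transpose_def row_addition_mult mult.commute)
qed

lemma row_addition_inverse:
  assumes "\<rho> b = 0"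
  shows "row_addition b \<rho> ** row_addition b (\<lambda>i. - \<rho> i) = mat 1"
  unfolding vec_eq_iff row_addition_mult using assms by (auto simp: row_addition_def mat_def)

lemma mult_monomial_mat:
  assumes "bij \<sigma>"
  shows "(A ** monomial_mat \<sigma> \<alpha>) $ i $ \<sigma> j = A $ i $ j * \<alpha> j"
  using assms by (simp add: matrix_matrix_mult_def monomial_mat_def bij_def inj_eq
    if_distrib[of "\<lambda>u. _ * u"] cong: if_cong)

lemma mat_mult_commute: "A ** mat c = mat c ** (A :: 'a::comm_ring_1^'n^'n)"
proof -
  have "(A ** mat c) $ i $ j = A $ i $ j * c" for i j
    unfolding mat_eq_diag_mat using mult_monomial_mat[of id A "\<lambda>_. c" i j] by simp
  moreover have "(mat c ** A) $ i $ j = c * A $ i $ j" for i j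
    by (simp add: mat_eq_diag_mat matrix_matrix_mult_def sum_monomial_mat)
  ultimately show ?thesis
    by (simp add: vec_eq_iff mult.commute)
qed

lemma mat_mult_mat: "mat a ** mat b = (mat (a * b) :: 'a::comm_ring_1^'n^'n)"
  by (simp add: mat_eq_diag_mat monomial_mat_mult)

context discrete_valuation begin

lemma invertible_over_mult:
  assumes "invertible_over \<O> A" "invertible_over \<O> B"
  shows "invertible_over \<O> (A ** B)"
proof -
  have entries: "(M ** N) $ i $ j \<in> \<O>" if "invertible_over \<O> M" "invertible_over \<O> N"
    for M N :: "'k^'n^'n" and i j
    unfolding matrix_matrix_mult_def using that
    by (simp add: valuation_ring_sum valuation_ring_closed invertible_over_entry)
  obtain A' B' where inverse_A: "invertible_over \<O> A'" "A ** A' = mat 1" "A' ** A = mat 1"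
    and inverse_B: "invertible_over \<O> B'" "B ** B' = mat 1" "B' ** B = mat 1"
    using assms by (metis invertible_overE)
  have "(A ** B) ** (B' ** A') = A ** (B ** B') ** A'" "(B' ** A') ** (A ** B) = B' ** (A' ** A) ** B"
    by (simp_all add: matrix_mul_assoc)
  then show ?thesis
    using assms inverse_A inverse_B by (intro invertible_overI[of _ _ "B' ** A'"]) (auto intro: entries)
qed

lemma invertible_over_transpose:
  assumes "invertible_over \<O> A"
  shows "invertible_over \<O> (transpose A)"
proof -
  obtain A' where inverse_A: "invertible_over \<O> A'" "A ** A' = mat 1" "A' ** A = mat 1"
    using assms by (rule invertible_overE)
  have "transpose A ** transpose A' = mat 1" "transpose A' ** transpose A = mat 1"
    using inverse_A by (simp_all flip: matrix_transpose_mul)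
  then show ?thesis
    using assms inverse_A(1) by (intro invertible_overI) (auto simp: transpose_def invertible_over_entry)
qed

lemma v_det_invertible_over:
  assumes "invertible_over \<O> A"
  shows "v (det A) = Fin 0"
proof -
  obtain A' where inverse_A: "invertible_over \<O> A'" "A ** A' = mat 1"
    using assms by (rule invertible_overE)
  then have "det A * det A' = 1"
    by (metis det_I det_mul)
  then show ?thesis
    using assms inverse_A(1)
    by (intro v_unit[of _ "det A'"]) (auto intro: valuation_ring_det invertible_over_entry)
qed

lemma invertible_over_row_addition:
  assumes "\<And>i. \<rho> i \<in> \<O>" "\<rho> b = 0"
  shows "invertible_over \<O> (row_addition b \<rho>)"
proof (rule invertible_overI)
  show "row_addition b \<rho> ** row_addition b (\<lambda>i. - \<rho> i) = mat 1"
    by (rule row_addition_inverse[of \<rho>, OF assms(2)])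
  show "row_addition b (\<lambda>i. - \<rho> i) ** row_addition b \<rho> = mat 1"
    using row_addition_inverse[of "\<lambda>i. - \<rho> i" b] assms(2) by simp
qed (auto simp: row_addition_def assms(2) intro!: valuation_ring_closed assms(1))

lemma invertible_over_monomial_mat:
  assumes "bij \<sigma>" and units: "\<And>i. v (\<alpha> i) = Fin 0"
  shows "invertible_over \<O> (monomial_mat \<sigma> \<alpha>)"
proof (rule invertible_overI)
  let ?\<tau> = "inv_into UNIV \<sigma>"
  have "\<alpha> i \<noteq> 0" for i
    using units[of i] by auto
  moreover have "\<sigma> (?\<tau> i) = i" "?\<tau> (\<sigma> i) = i" for i
    using assms(1) by (simp_all add: bij_def surj_f_inv_f)
  ultimately show "monomial_mat \<sigma> \<alpha> ** monomial_mat ?\<tau> (\<lambda>i. inverse (\<alpha> (?\<tau> i))) = mat 1"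
    "monomial_mat ?\<tau> (\<lambda>i. inverse (\<alpha> (?\<tau> i))) ** monomial_mat \<sigma> \<alpha> = mat 1"
    by (simp_all add: monomial_mat_mult mat_eq_diag_mat comp_def id_def)
  have "\<alpha> i \<in> \<O>" "inverse (\<alpha> i) \<in> \<O>" for i
    using units[of i] v_inverse[OF units[of i]] by (simp_all add: valuation_ring_def)
  then show "monomial_mat \<sigma> \<alpha> $ i $ j \<in> \<O>" "monomial_mat ?\<tau> (\<lambda>i. inverse (\<alpha> (?\<tau> i))) $ i $ j \<in> \<O>" for i j
    by (simp_all add: monomial_mat_def valuation_ring_closed)
qed

lemma invertible_over_mat_1: "invertible_over \<O> (mat 1)"
  unfolding mat_eq_diag_mat by (rule invertible_over_monomial_mat) auto

lemma exists_minimal_pivot: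
  fixes A :: "'k^'n^'n"
  assumes "det A \<noteq> 0" "decoupled S A" "S \<noteq> UNIV"
  obtains i j where "i \<notin> S" "j \<notin> S" "A $ i $ j \<noteq> 0" "\<And>a b. a \<notin> S \<Longrightarrow> b \<notin> S \<Longrightarrow> v (A $ i $ j) \<le> v (A $ a $ b)"
proof -
  let ?block = "(- S) \<times> (- S)" and ?f = "\<lambda>(a, b). v (A $ a $ b)"
  obtain c where c_notin: "c \<notin> S"
    using assms(3) by blast
  then have "Min (?f ` ?block) \<in> ?f ` ?block"
    by (intro Min_in) auto
  then obtain i j where minimal: "i \<notin> S" "j \<notin> S" "v (A $ i $ j) = Min (?f ` ?block)"
    by auto
  have least: "v (A $ i $ j) \<le> v (A $ a $ b)" if "a \<notin> S" "b \<notin> S" for a b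
    unfolding minimal(3) using that by (intro Min_le) auto
  have "A $ i $ j \<noteq> 0"
  proof
    assume "A $ i $ j = 0"
    then have "v (A $ c $ b) = Pinf" if "b \<notin> S" for b
      using least[OF c_notin that] by (cases "v (A $ c $ b)") auto
    then have "A $ c $ b = 0" if "b \<notin> S" for b
      using that v_eq_Pinf_iff by blast
    moreover have "A $ c $ b = 0" if "b \<in> S" for b
      using assms(2) c_notin that unfolding decoupled_def by metis
    ultimately have "A $ c $ b = 0" for b
      by blast
    then have "row c A = 0"
      by (simp add: row_def vec_eq_iff)
    then show False
      using assms(1) det_zero_row by blast
  qed
  with minimal(1,2) show thesis
    using least by (rule that)
qed

lemma clear_diagonal_pivot:
  fixes A :: "'k^'n^'n"
  assumes decoupled: "decoupled S A" and pivot: "A $ i $ i \<noteq> 0"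
    and column: "\<And>a. v (A $ i $ i) \<le> v (A $ a $ i)" and row: "\<And>b. v (A $ i $ i) \<le> v (A $ i $ b)"
  obtains P Q A' where "invertible_over \<O> P" "invertible_over \<O> Q" "A = P ** A' ** Q"
    "decoupled (insert i S) A'"
proof -
  define \<rho> where "\<rho> a = (if a = i then 0 else A $ a $ i / A $ i $ i)" for a
  define \<kappa> where "\<kappa> b = (if b = i then 0 else A $ i $ b / A $ i $ i)" for b
  define P where "P = row_addition i \<rho>"
  define Q where "Q = transpose (row_addition i \<kappa>)"
  define A' where "A' = row_addition i (\<lambda>a. - \<rho> a) ** A ** transpose (row_addition i (\<lambda>b. - \<kappa> b))"
  have entry: "A' $ a $ b = A $ a $ b - \<rho> a * A $ i $ b - (A $ a $ i - \<rho> a * A $ i $ i) * \<kappa> b" for a b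
    by (simp add: A'_def mult_transpose_row_addition row_addition_mult algebra_simps)
  show thesis
  proof (rule that)
    have "\<rho> a \<in> \<O>" "\<kappa> a \<in> \<O>" for a
      using divide_mem_valuation_ring[OF column pivot] divide_mem_valuation_ring[OF row pivot]
      by (auto simp: \<rho>_def \<kappa>_def valuation_ring_closed)
    then show "invertible_over \<O> P" "invertible_over \<O> Q"
      unfolding P_def Q_def
      by (auto simp: \<rho>_def \<kappa>_def intro!: invertible_over_transpose invertible_over_row_addition)
    have "P ** row_addition i (\<lambda>a. - \<rho> a) = mat 1"
      unfolding P_def by (rule row_addition_inverse) (simp add: \<rho>_def)
    moreover have "transpose (row_addition i (\<lambda>b. - \<kappa> b)) ** Q = mat 1"
      unfolding Q_def matrix_transpose_mul[symmetric]
      by (subst row_addition_inverse) (simp_all add: \<kappa>_def)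
    ultimately show "A = P ** A' ** Q"
      unfolding A'_def by (simp add: matrix_mul_assoc) (simp flip: matrix_mul_assoc)
    have cleared: "A' $ a $ i = 0" "A' $ i $ a = 0" if "a \<noteq> i" for a
      using that pivot by (simp_all add: entry \<rho>_def \<kappa>_def)
    have "A' $ a $ b = 0 \<and> A' $ b $ a = 0" if "a \<in> S" "a \<noteq> i" "b \<noteq> a" for a b
    proof -
      have "A $ a $ i = 0" "A $ i $ a = 0"
        using decoupled that by (auto simp: decoupled_def)
      then have "\<rho> a = 0" "\<kappa> a = 0"
        by (simp_all add: \<rho>_def \<kappa>_def)
      then show ?thesis
        using decoupled that \<open>A $ a $ i = 0\<close> \<open>A $ i $ a = 0\<close> by (simp add: entry decoupled_def)
    qed
    with cleared show "decoupled (insert i S) A'"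
      by (auto simp: decoupled_def)
  qed
qed

lemma decouple_one_more:
  fixes A :: "'k^'n^'n"
  assumes "det A \<noteq> 0" "decoupled S A" "S \<noteq> UNIV"
  obtains i P Q A' where "i \<notin> S" "invertible_over \<O> P" "invertible_over \<O> Q" "A = P ** A' ** Q"
    "decoupled (insert i S) A'"
proof -
  obtain i j where pivot: "i \<notin> S" "j \<notin> S" "A $ i $ j \<noteq> 0"
    and least: "\<And>a b. a \<notin> S \<Longrightarrow> b \<notin> S \<Longrightarrow> v (A $ i $ j) \<le> v (A $ a $ b)"
    using exists_minimal_pivot[OF assms] by blast
  define \<tau> where "\<tau> = Transposition.transpose i j"
  define T :: "'k^'n^'n" where "T = monomial_mat \<tau> (\<lambda>_. 1)"
  have swap: "bij \<tau>" "\<And>b. \<tau> (\<tau> b) = b" "\<tau> i = j" "\<And>a. a \<in> S \<Longrightarrow> \<tau> a = a"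
    using pivot by (auto simp: \<tau>_def Transposition.transpose_def)
  have T_invertible: "invertible_over \<O> T"
    unfolding T_def using swap(1) by (rule invertible_over_monomial_mat) simp
  have T_involution: "T ** T = mat 1"
    using swap(2) by (simp add: T_def monomial_mat_mult mat_eq_diag_mat comp_def id_def)
  have swapped: "(A ** T) $ a $ b = A $ a $ \<tau> b" for a b
    using mult_monomial_mat[OF swap(1), of A "\<lambda>_. 1" a "\<tau> b"] by (simp add: T_def swap(2))
  have decoupled: "decoupled S (A ** T)"
    using assms(2) swap(2,4) unfolding decoupled_def swapped by metis
  have zero: "(A ** T) $ a $ i = 0" "(A ** T) $ i $ a = 0" if "a \<in> S" for a
    using decoupled that pivot(1) by (auto simp: decoupled_def)
  obtain P Q A' where "invertible_over \<O> P" "invertible_over \<O> Q" "A ** T = P ** A' ** Q"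
    "decoupled (insert i S) A'"
  proof (rule clear_diagonal_pivot[OF decoupled, of i])
    show "(A ** T) $ i $ i \<noteq> 0"
      using pivot(3) by (simp add: swapped swap(3))
    show "v ((A ** T) $ i $ i) \<le> v ((A ** T) $ a $ i)" for a
      using least[of a j] pivot(2) zero(1)[of a] by (cases "a \<in> S") (auto simp: swapped swap(3))
    show "v ((A ** T) $ i $ i) \<le> v ((A ** T) $ i $ b)" for b
      using least[OF pivot(1), of "\<tau> b"] zero(2)[of b] swap(2,4)
      by (cases "b \<in> S") (auto simp: swapped swap(3), metis+)
  qed
  moreover from this(3) have "A = P ** A' ** (Q ** T)"
    using T_involution by (metis matrix_mul_assoc matrix_mul_rid)
  ultimately show thesis
    using that[OF pivot(1)] invertible_over_mult[OF _ T_invertible] by blast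
qed

lemma decouple_all:
  fixes A :: "'k^'n^'n"
  assumes det: "det A \<noteq> 0"
  obtains P Q d where "invertible_over \<O> P" "invertible_over \<O> Q" "A = P ** diag_mat d ** Q"
proof -
  have "\<exists>S P Q A'. card S = n \<and> invertible_over \<O> P \<and> invertible_over \<O> Q \<and> A = P ** A' ** Q \<and> decoupled S A'"
    if "n \<le> CARD('n)" for n
    using that
  proof (induction n)
    case 0
    then show ?case
      by (intro exI[of _ "{}"] exI[of _ "mat 1"] exI[of _ A])
        (simp add: invertible_over_mat_1 decoupled_def)
  next
    case (Suc n)
    then obtain S P Q A' where IH: "card S = n" "invertible_over \<O> P" "invertible_over \<O> Q"
      "A = P ** A' ** Q" "decoupled S A'"
      by auto
    have "det A' \<noteq> 0"
      using det unfolding IH(4) det_mul by auto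
    moreover have "S \<noteq> UNIV"
      using IH(1) Suc.prems by auto
    ultimately obtain i P' Q' A'' where step: "i \<notin> S" "invertible_over \<O> P'" "invertible_over \<O> Q'"
      "A' = P' ** A'' ** Q'"
      "decoupled (insert i S) A''"
      using decouple_one_more[OF _ IH(5)] by metis
    have "A = (P ** P') ** A'' ** (Q' ** Q)"
      unfolding IH(4) step(4) by (simp add: matrix_mul_assoc)
    moreover have "card (insert i S) = Suc n"
      using IH(1) step(1) by simp
    ultimately show ?case
      using invertible_over_mult[OF IH(2) step(2)] invertible_over_mult[OF step(3) IH(3)] step(5)
      by blast
  qed
  from this[of "CARD('n)"] obtain S P Q A' where all: "card S = CARD('n)" "invertible_over \<O> P"
    "invertible_over \<O> Q"
    "A = P ** A' ** Q" "decoupled S A'"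
    by auto
  have "S = UNIV"
    using all(1) by (intro card_subset_eq) auto
  then have "A' = diag_mat (\<lambda>i. A' $ i $ i)"
    using all(5) by (auto simp: decoupled_def vec_eq_iff monomial_mat_def)
  then show thesis
    using that[OF all(2,3)] all(4) by metis
qed

theorem smith_normal_form:
  fixes A :: "'k^'n^'n"
  assumes uniformiser: "v \<pi> = Fin 1" and det: "det A \<noteq> 0"
  obtains P Q r where "invertible_over \<O> P" "invertible_over \<O> Q"
    "A = P ** diag_mat (\<lambda>i. \<pi> powi r i) ** Q"
proof -
  obtain P Q d where diagonal: "invertible_over \<O> P" "invertible_over \<O> Q" "A = P ** diag_mat d ** Q"
    by (rule decouple_all[OF det])
  have "det (diag_mat d) \<noteq> 0"
    using det unfolding diagonal(3) det_mul by auto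
  then have "\<exists>n. v (d i) = Fin n" for i
    using v_FinE[of "d i"] by (auto simp: det_diag_mat)
  then obtain r where valuations: "\<And>i. v (d i) = Fin (r i)"
    by metis
  define u where "u i = d i * \<pi> powi (- r i)" for i
  have "\<pi> \<noteq> 0"
    using uniformiser by auto
  have "v (u i) = Fin 0" for i
    by (simp add: u_def v_mult valuations v_powi[OF uniformiser])
  then have "invertible_over \<O> (diag_mat u)"
    by (intro invertible_over_monomial_mat) auto
  moreover have "diag_mat d = diag_mat u ** diag_mat (\<lambda>i. \<pi> powi r i)"
    using \<open>\<pi> \<noteq> 0\<close> by (simp add: monomial_mat_mult u_def power_int_minus mult.assoc)
  then have "A = (P ** diag_mat u) ** diag_mat (\<lambda>i. \<pi> powi r i) ** Q"
    unfolding diagonal(3) by (simp add: matrix_mul_assoc)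
  ultimately show thesis
    using that invertible_over_mult[OF diagonal(1)] diagonal(2) by blast
qed

end

section \<open>Transformations between models of small discriminant\<close>

lemma act_scalar_multiples:
  assumes "a\<^sup>2 * b = 1"
  shows "act (mat a ** U) (mat b ** V) \<Phi> = act U V \<Phi>"
proof -
  have "act (mat a ** U) (mat b ** V) \<Phi> = act (mat a) (mat b) (act U V \<Phi>)"
    by (simp add: act_act)
  then show ?thesis
    using assms by (simp add: vec_eq_iff act_mat)
qed

context discrete_valuation begin

lemma act_integral:
  assumes "invertible_over \<O> A" "invertible_over \<O> B" "\<Phi> \<in> X\<^sub>5 \<O>"
  shows "act A B \<Phi> \<in> X\<^sub>5 \<O>"
proof (rule pfaffian_modelsI)
  show "act A B \<Phi> $ i $ j $ k \<in> \<O>" for i j k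
    unfolding act_nth using assms pfaffian_modelsD(3)[OF assms(3)]
    by (intro valuation_ring_sum valuation_ring_closed) (auto intro: invertible_over_entry)
qed (rule pfaffian_modelsD[OF act_mem_UNIV[OF assms(3)]])+

lemma v_act_det_integral:
  assumes "invertible_over \<O> A" "invertible_over \<O> B"
  shows "v (act_det A B) = Fin 0"
  using assms by (simp add: act_det_def v_mult v_det_invertible_over power2_eq_square)

lemma v_discriminant_act:
  assumes "is_discriminant D" "\<Phi> \<in> X\<^sub>5 R" "v (act_det A B) = Fin e"
  shows "v (eval_model D (act A B \<Phi>)) = Fin (12 * e) + v (eval_model D \<Phi>)"
proof -
  have "invariant_of_weight 12 D"
    using assms(1) by (simp add: is_discriminant_def)
  then show ?thesis
    using invariant_of_weight_act[OF _ assms(2)] v_power[OF assms(3), of 12] by (simp add: v_mult)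
qed

lemma v_discriminant_act_integral:
  assumes "is_discriminant D" "\<Phi> \<in> X\<^sub>5 R" "invertible_over \<O> A" "invertible_over \<O> B"
  shows "v (eval_model D (act A B \<Phi>)) = v (eval_model D \<Phi>)"
  using v_discriminant_act[OF assms(1,2) v_act_det_integral[OF assms(3,4)]]
  by (cases "v (eval_model D \<Phi>)") auto

lemma v_discriminant_nonneg: "\<Phi> \<in> X\<^sub>5 \<O> \<Longrightarrow> Fin 0 \<le> v (eval_model D \<Phi>)"
  using at_least_int_eval[of "\<lambda>_. 0" "coords \<Phi>" D 0] pfaffian_modelsD(3)[of \<Phi> \<O>]
  by (auto simp: eval_model_eq_int_eval at_least_def mem_valuation_ring_iff mono_weight_def)

lemma v_act_det_small_discriminants:
  assumes "is_discriminant D" "\<Phi> \<in> X\<^sub>5 \<O>" "act A B \<Phi> \<in> X\<^sub>5 \<O>"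
    and small: "v (eval_model D \<Phi>) \<le> Fin 1" "v (eval_model D (act A B \<Phi>)) \<le> Fin 1"
    and v_det: "v (act_det A B) = Fin e"
  shows "e = 0"
proof -
  obtain a where v_before: "v (eval_model D \<Phi>) = Fin a" "0 \<le> a" "a \<le> 1"
    using small(1) v_discriminant_nonneg[OF assms(2), of D] by (cases "v (eval_model D \<Phi>)") auto
  obtain b where v_after: "v (eval_model D (act A B \<Phi>)) = Fin b" "0 \<le> b" "b \<le> 1"
    using small(2) v_discriminant_nonneg[OF assms(3), of D]
    by (cases "v (eval_model D (act A B \<Phi>))") auto
  have "b = 12 * e + a"
    using v_discriminant_act[OF assms(1,2) v_det] v_before(1) v_after(1) by simp
  then show ?thesis
    using v_before v_after by linarith
qed

lemma discriminant_ge_2_without_pentagon: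
  assumes "is_discriminant D" "2 * sum r UNIV + sum s UNIV = 0" "\<not> has_pentagon r s"
    and "\<And>i j k. at_least (neg_part (r i + r j + s k)) (\<Phi> $ i $ j $ k)"
  shows "at_least 2 (eval_model D \<Phi>)"
  unfolding eval_model_eq_int_eval
proof (rule at_least_int_eval[OF _ discriminant_neg_weight_without_pentagon[OF assms(1-3)]])
  show "at_least (neg_part (coord_weight r s u)) (coords \<Phi> u)" for u
    using assms(4) by (cases u) auto
qed

lemma discriminant_ge_2_at_pentagon:
  assumes discriminant: "is_discriminant D" and not_constant: "r i0 \<noteq> r j0"
    and \<Phi>_ge: "\<And>i j k. at_least (neg_part (pent_weight r (i, j, k))) (\<Phi> $ i $ j $ k)"
  shows "at_least 2 (eval_model D \<Phi>)"
proof -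
  let ?t = "pent_weight r" and ?x = "\<lambda>u. coords \<Phi> u - of_int (pent u)"
  have inv: "invariant_of_weight 12 D" "D \<in> model_polys"
    using discriminant by (auto simp: is_discriminant_def)
  have weight: "2 \<le> mono_weight (\<lambda>u. neg_part (?t u)) m"
    if monomial: "m \<in> monomials (taylor_shift pent D)" for m
  proof -
    have "mono_weight (\<lambda>u. \<bar>?t u\<bar>) m = mono_weight ?t m + 2 * mono_weight (\<lambda>u. neg_part (?t u)) m"
      unfolding mono_weight_def sum_distrib_left sum.distrib[symmetric]
      by (intro sum.cong refl) (auto simp: max_def algebra_simps abs_if)
    then show ?thesis
      using discriminant_abs_weight_at_pentagon[OF discriminant not_constant monomial]
        taylor_shift_pent_weight[OF inv monomial, of r] by simp
  qed
  have "at_least (neg_part (?t u)) (?x u)" for u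
  proof (rule at_least_diff)
    show "at_least (neg_part (?t u)) (coords \<Phi> u)"
      using \<Phi>_ge by (cases u) auto
    show "at_least (neg_part (?t u)) (of_int (pent u))"
      using pent_weight_eq_0[of u r] of_int_mem_valuation_ring
      by (cases "pent u = 0") (auto simp: mem_valuation_ring_iff)
  qed
  then have "at_least 2 (int_eval ?x (taylor_shift pent D))"
    using weight by (rule at_least_int_eval)
  then show ?thesis
    by (simp add: int_eval_taylor_shift eval_model_eq_int_eval)
qed

theorem weights_constant_of_small_discriminant:
  assumes discriminant: "is_discriminant D" and model: "\<Phi> \<in> X\<^sub>5 \<O>"
    and total: "2 * sum r UNIV + sum s UNIV = 0"
    and \<Phi>_ge: "\<And>i j k. at_least (- (r i + r j + s k)) (\<Phi> $ i $ j $ k)"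
    and small: "v (eval_model D \<Phi>) \<le> Fin 1"
  shows "r i = r 0" "s k = - 2 * r 0"
proof -
  have neg: "at_least (neg_part (r i + r j + s k)) (\<Phi> $ i $ j $ k)" for i j k
    using \<Phi>_ge[of i j k] pfaffian_modelsD(3)[OF model, of i j k]
    by (auto simp: mem_valuation_ring_iff max_def)
  have not_ge_2: "\<not> at_least 2 (eval_model D \<Phi>)"
    using small unfolding at_least_def by (cases "v (eval_model D \<Phi>)") auto
  have "has_pentagon r s"
    using discriminant_ge_2_without_pentagon[OF discriminant total _ neg] not_ge_2 by blast
  then obtain \<sigma> \<tau> :: "5 \<Rightarrow> 5" where pentagon: "bij \<sigma>" "bij \<tau>" "\<And>i. r (\<sigma> i) + r (\<sigma> (i + 1)) + s (\<tau> i) = 0"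
    by (auto simp: has_pentagon_def)
  let ?P = "monomial_mat \<sigma> (\<lambda>_. 1)" and ?Q = "monomial_mat \<tau> (\<lambda>_. 1)"
  have "r (\<sigma> i) = r (\<sigma> j)" for i j
  proof (rule ccontr)
    assume "r (\<sigma> i) \<noteq> r (\<sigma> j)"
    then have "at_least 2 (eval_model D (act ?P ?Q \<Phi>))"
    proof (rule discriminant_ge_2_at_pentagon[OF discriminant, of "\<lambda>i. r (\<sigma> i)"])
      fix i j k
      have "pent_weight (\<lambda>i. r (\<sigma> i)) (i, j, k) = r (\<sigma> i) + r (\<sigma> j) + s (\<tau> k)"
        using pentagon(3)[of k] by (simp add: pent_weight_apply)
      then show "at_least (neg_part (pent_weight (\<lambda>i. r (\<sigma> i)) (i, j, k))) (act ?P ?Q \<Phi> $ i $ j $ k)"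
        using neg[of "\<sigma> i" "\<sigma> j" "\<tau> k"] by (simp add: act_monomial_mat)
    qed
    moreover have "v (eval_model D (act ?P ?Q \<Phi>)) = v (eval_model D \<Phi>)"
      by (rule v_discriminant_act_integral[OF discriminant model]; rule invertible_over_monomial_mat)
        (simp_all add: pentagon)
    ultimately show False
      using not_ge_2 by (simp add: at_least_def)
  qed
  then show r_const: "r i = r 0" for i
    using pentagon(1) by (metis bij_pointE)
  show "s k = - 2 * r 0"
  proof -
    obtain i where "\<tau> i = k"
      using pentagon(2) by (metis bij_pointE)
    moreover have "s (\<tau> i) = - 2 * r 0"
      using pentagon(3)[of i] r_const[of "\<sigma> i"] r_const[of "\<sigma> (i + 1)"] by linarith
    ultimately show ?thesis by simp
  qed
qed

lemma diagonal_transformation_scalar: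
  assumes uniformiser: "v \<pi> = Fin 1" and discriminant: "is_discriminant D"
    and models: "\<Phi> \<in> X\<^sub>5 \<O>" "act (diag_mat (\<lambda>i. \<pi> powi r i)) (diag_mat (\<lambda>k. \<pi> powi s k)) \<Phi> \<in> X\<^sub>5 \<O>"
    and small: "v (eval_model D \<Phi>) \<le> Fin 1"
      "v (eval_model D (act (diag_mat (\<lambda>i. \<pi> powi r i)) (diag_mat (\<lambda>k. \<pi> powi s k)) \<Phi>)) \<le> Fin 1"
  shows "diag_mat (\<lambda>i. \<pi> powi r i) = mat (\<pi> powi r 0)"
    "diag_mat (\<lambda>k. \<pi> powi s k) = mat (\<pi> powi (- 2 * r 0))"
proof -
  have "\<pi> \<noteq> 0"
    using uniformiser by auto
  then have "v (act_det (diag_mat (\<lambda>i. \<pi> powi r i)) (diag_mat (\<lambda>k. \<pi> powi s k))) =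
      Fin (2 * sum r UNIV + sum s UNIV)"
    by (simp add: act_det_diag_mat_powi v_powi[OF uniformiser])
  then have total: "2 * sum r UNIV + sum s UNIV = 0"
    by (rule v_act_det_small_discriminants[OF discriminant models small])
  have \<Phi>_ge: "at_least (- (r i + r j + s k)) (\<Phi> $ i $ j $ k)" for i j k
  proof -
    have "at_least 0 (\<pi> powi (r i + r j + s k) * \<Phi> $ i $ j $ k)"
      using pfaffian_modelsD(3)[OF models(2), of i j k] \<open>\<pi> \<noteq> 0\<close>
      by (simp add: mem_valuation_ring_iff act_monomial_mat power_int_add)
    then show ?thesis
      unfolding at_least_def v_mult v_powi[OF uniformiser] by (cases "v (\<Phi> $ i $ j $ k)") auto
  qed
  note constant_weights =
    weights_constant_of_small_discriminant[OF discriminant models(1) total \<Phi>_ge small(1)]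
  show "diag_mat (\<lambda>i. \<pi> powi r i) = mat (\<pi> powi r 0)"
    unfolding mat_eq_diag_mat
    by (intro arg_cong[of _ _ diag_mat] ext arg_cong[of _ _ "(powi) \<pi>"] constant_weights(1))
  show "diag_mat (\<lambda>k. \<pi> powi s k) = mat (\<pi> powi (- 2 * r 0))"
    unfolding mat_eq_diag_mat
    by (intro arg_cong[of _ _ diag_mat] ext arg_cong[of _ _ "(powi) \<pi>"] constant_weights(2))
qed

theorem small_discriminant_transformation:
  assumes uniformiser: "v \<pi> = Fin 1" and discriminant: "is_discriminant D"
    and nonsingular: "A \<in> GL5 UNIV" "B \<in> GL5 UNIV" and models: "\<Phi> \<in> X\<^sub>5 \<O>" "act A B \<Phi> \<in> X\<^sub>5 \<O>"
    and small: "v (eval_model D \<Phi>) \<le> Fin 1" "v (eval_model D (act A B \<Phi>)) \<le> Fin 1"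
  obtains n U V where "U \<in> GL5 \<O>" "V \<in> GL5 \<O>" "A = mat (\<pi> powi n) ** U" "B = mat (\<pi> powi (- 2 * n)) ** V"
proof -
  obtain P Q r where A_eq: "invertible_over \<O> P" "invertible_over \<O> Q"
    "A = P ** diag_mat (\<lambda>i. \<pi> powi r i) ** Q"
    using smith_normal_form[OF uniformiser] nonsingular(1) unfolding GL5_UNIV_iff_det by metis
  obtain P' Q' s where B_eq: "invertible_over \<O> P'" "invertible_over \<O> Q'"
    "B = P' ** diag_mat (\<lambda>i. \<pi> powi s i) ** Q'"
    using smith_normal_form[OF uniformiser] nonsingular(2) unfolding GL5_UNIV_iff_det by metis
  obtain I I' where inverse_P: "invertible_over \<O> I" "I ** P = mat 1"
    and inverse_P': "invertible_over \<O> I'" "I' ** P' = mat 1"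
    using A_eq(1) B_eq(1) by (metis invertible_overE)
  let ?E = "diag_mat (\<lambda>i. \<pi> powi r i)" and ?F = "diag_mat (\<lambda>i. \<pi> powi s i)" and ?\<Psi> = "act Q Q' \<Phi>"
  have "I ** A = ?E ** Q" "I' ** B = ?F ** Q'"
    unfolding A_eq(3) B_eq(3) by (simp_all add: matrix_mul_assoc inverse_P(2) inverse_P'(2))
  then have transformed: "act ?E ?F ?\<Psi> = act I I' (act A B \<Phi>)"
    by (simp add: act_act)
  have \<Psi>_int: "?\<Psi> \<in> X\<^sub>5 \<O>" "act ?E ?F ?\<Psi> \<in> X\<^sub>5 \<O>"
    unfolding transformed by (intro act_integral A_eq B_eq inverse_P inverse_P' models)+
  have \<Psi>_small: "v (eval_model D ?\<Psi>) \<le> Fin 1" "v (eval_model D (act ?E ?F ?\<Psi>)) \<le> Fin 1"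
    unfolding transformed using small
      v_discriminant_act_integral[OF discriminant models(1) A_eq(2) B_eq(2)]
      v_discriminant_act_integral[OF discriminant models(2) inverse_P(1) inverse_P'(1)] by simp_all
  note scalar = diagonal_transformation_scalar[OF uniformiser discriminant \<Psi>_int \<Psi>_small]
  have "A = mat (\<pi> powi r 0) ** (P ** Q)"
    unfolding A_eq(3) scalar mat_mult_commute[of P] by (simp add: matrix_mul_assoc)
  moreover have "B = mat (\<pi> powi (- 2 * r 0)) ** (P' ** Q')"
    unfolding B_eq(3) scalar mat_mult_commute[of P'] by (simp add: matrix_mul_assoc)
  moreover have "P ** Q \<in> GL5 \<O>" "P' ** Q' \<in> GL5 \<O>"
    using A_eq(1,2) B_eq(1,2) by (simp_all add: mem_GL5_iff invertible_over_mult)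
  ultimately show thesis
    using that by blast
qed

end

section \<open>Equivalence and stabilisers\<close>

lemma group_GL5: "group (GL5_group (UNIV :: 'k::field set))"
proof (rule groupI)
  fix A assume "A \<in> carrier (GL5_group (UNIV :: 'k set))"
  then obtain A' where "A' \<in> GL5 UNIV" "A' ** A = mat 1"
    by (auto simp: GL5_group_def mem_GL5_iff elim: invertible_overE)
  then show "\<exists>A'\<in>carrier (GL5_group UNIV). A' \<otimes>\<^bsub>GL5_group UNIV\<^esub> A = \<one>\<^bsub>GL5_group UNIV\<^esub>"
    by (auto simp: GL5_group_def)
qed (auto simp: GL5_group_def GL5_UNIV_iff_det det_mul matrix_mul_assoc)

lemma scalar_pair_mem_generate:
  fixes \<pi> :: "'k::field"
  assumes "\<pi> \<noteq> 0" and generator_mem: "(mat (inverse \<pi>), mat (\<pi>\<^sup>2)) \<in> H"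
  shows "(mat (\<pi> powi n), mat (\<pi> powi (- 2 * n))) \<in> generate (GL5_group UNIV \<times>\<times> GL5_group UNIV) H"
proof -
  let ?G = "GL5_group (UNIV :: 'k set) \<times>\<times> GL5_group (UNIV :: 'k set)"
  interpret G: group ?G
    by (intro DirProd_group group_GL5)
  let ?pair = "\<lambda>n. (mat (\<pi> powi n) :: 'k^5^5, mat (\<pi> powi (- 2 * n)) :: 'k^5^5)"
  have mult: "?pair m \<otimes>\<^bsub>?G\<^esub> ?pair n = ?pair (m + n)" for m n
    using assms(1) by (simp add: GL5_group_def mat_mult_mat power_int_add[symmetric] algebra_simps)
  have carrier: "?pair n \<in> carrier ?G" for n
    using assms(1) by (simp add: GL5_group_def GL5_UNIV_iff_det mat_eq_diag_mat det_diag_mat)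
  have one: "?pair 0 = \<one>\<^bsub>?G\<^esub>"
    by (simp add: GL5_group_def)
  have generator: "?pair (- 1) \<in> H"
    using generator_mem by (simp add: power_int_minus)
  have "inv\<^bsub>?G\<^esub> (?pair (- 1)) = ?pair 1"
    by (rule G.inv_equality[OF _ carrier carrier]) (simp only: mult one[symmetric], simp)
  then have inverse: "?pair 1 \<in> generate ?G H"
    using generate.inv[OF generator, of ?G] by (simp only:)
  show ?thesis
  proof (induction n rule: int_induct[of _ 0])
    case base
    then show ?case
      using generate.one[of ?G H] by (simp only: one)
  next
    case (step1 n)
    from generate.eng[OF step1.IH inverse] show ?case
      by (simp only: mult)
  next
    case (step2 n)
    from generate.eng[OF step2.IH generate.incl[OF generator, of ?G]] show ?case
      by (simp only: mult diff_conv_add_uminus)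
  qed
qed

lemma powi_square_mult_powi: "\<pi> \<noteq> 0 \<Longrightarrow> (\<pi> powi n)\<^sup>2 * \<pi> powi (- 2 * n) = (1 :: 'a::field)"
  by (simp add: power2_eq_square flip: power_int_add)

context discrete_valuation begin

lemma small_discriminant_scalar_GL5:
  assumes "v \<pi> = Fin 1" "is_discriminant D" "A \<in> GL5 UNIV" "B \<in> GL5 UNIV" "\<Phi> \<in> X\<^sub>5 \<O>" "act A B \<Phi> \<in> X\<^sub>5 \<O>"
    and "v (eval_model D \<Phi>) \<le> Fin 1" "v (eval_model D (act A B \<Phi>)) \<le> Fin 1"
  shows "A \<in> scalar_GL5 \<O>" "B \<in> scalar_GL5 \<O>"
proof -
  obtain n U V where "U \<in> GL5 \<O>" "V \<in> GL5 \<O>" "A = mat (\<pi> powi n) ** U" "B = mat (\<pi> powi (- 2 * n)) ** V"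
    using assms by (rule small_discriminant_transformation)
  moreover have "\<pi> powi n \<noteq> 0" for n
    using \<open>v \<pi> = Fin 1\<close> by auto
  ultimately show "A \<in> scalar_GL5 \<O>" "B \<in> scalar_GL5 \<O>"
    unfolding scalar_GL5_def by blast+
qed

lemma small_discriminant_equivalent_over:
  assumes uniformiser: "v \<pi> = Fin 1" and discriminant: "is_discriminant D"
    and models: "\<Phi> \<in> X\<^sub>5 \<O>" "\<Phi>' \<in> X\<^sub>5 \<O>"
    and small: "v (eval_model D \<Phi>) \<le> Fin 1" "v (eval_model D \<Phi>') \<le> Fin 1"
    and equivalent: "equivalent_over UNIV \<Phi> \<Phi>'"
  shows "equivalent_over \<O> \<Phi> \<Phi>'"
proof -
  obtain A B where nonsingular: "A \<in> GL5 UNIV" "B \<in> GL5 UNIV" and \<Phi>'_eq: "\<Phi>' = act A B \<Phi>"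
    using equivalent unfolding equivalent_over_def by blast
  obtain n U V where integral: "U \<in> GL5 \<O>" "V \<in> GL5 \<O>"
    and "A = mat (\<pi> powi n) ** U" "B = mat (\<pi> powi (- 2 * n)) ** V"
    using models small unfolding \<Phi>'_eq
    by (rule small_discriminant_transformation[OF uniformiser discriminant nonsingular])
  moreover have "act (mat (\<pi> powi n) ** U) (mat (\<pi> powi (- 2 * n)) ** V) \<Phi> = act U V \<Phi>"
    using uniformiser by (intro act_scalar_multiples powi_square_mult_powi) auto
  ultimately have "\<Phi>' = act U V \<Phi>"
    unfolding \<Phi>'_eq by (simp only:)
  then show ?thesis
    using integral by (auto simp: equivalent_over_def)
qed

lemma small_discriminant_stabiliser:
  assumes uniformiser: "v \<pi> = Fin 1" and discriminant: "is_discriminant D" and model: "\<Phi> \<in> X\<^sub>5 \<O>"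
    and small: "v (eval_model D \<Phi>) \<le> Fin 1"
  shows "stabiliser UNIV \<Phi> \<subseteq> generate (GL5_group UNIV \<times>\<times> GL5_group UNIV)
    (GL5 \<O> \<times> GL5 \<O> \<union> {(mat (inverse \<pi>), mat (\<pi>\<^sup>2))})" (is "_ \<subseteq> generate ?G ?H")
proof (rule subrelI)
  fix A B assume "(A, B) \<in> stabiliser UNIV \<Phi>"
  then have nonsingular: "A \<in> GL5 UNIV" "B \<in> GL5 UNIV" and "act A B \<Phi> = \<Phi>"
    by (auto simp: stabiliser_def)
  then obtain n U V where "U \<in> GL5 \<O>" "V \<in> GL5 \<O>" "A = mat (\<pi> powi n) ** U"
    "B = mat (\<pi> powi (- 2 * n)) ** V"
    using small_discriminant_transformation[OF uniformiser discriminant nonsingular model _ small]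
      model small by metis
  moreover have "(mat (\<pi> powi n), mat (\<pi> powi (- 2 * n))) \<in> generate ?G ?H"
    using uniformiser by (intro scalar_pair_mem_generate) auto
  ultimately show "(A, B) \<in> generate ?G ?H"
    using generate.eng[of _ ?G ?H "(U, V)"] generate.incl[of "(U, V)" ?H ?G]
    by (fastforce simp: GL5_group_def)
qed

end

theorem theorem1p1:
  fixes v :: "'k::field \<Rightarrow> int extended" and \<pi> :: 'k
    and D :: model_poly and \<Phi> \<Phi>' :: "'k model"
  assumes "normalised_discrete_valuation v" and "v \<pi> = Fin 1"
    and "is_discriminant D"
    and "\<Phi> \<in> X\<^sub>5 (valuation_ring v)" and "\<Phi>' \<in> X\<^sub>5 (valuation_ring v)"
    and "v (eval_model D \<Phi>) \<le> Fin 1" and "v (eval_model D \<Phi>') \<le> Fin 1"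
  shows "(\<forall>A \<in> GL5 UNIV. \<forall>B \<in> GL5 UNIV. \<Phi>' = act A B \<Phi> \<longrightarrow>
            A \<in> scalar_GL5 (valuation_ring v) \<and> B \<in> scalar_GL5 (valuation_ring v))
       \<and> (equivalent_over UNIV \<Phi> \<Phi>' \<longrightarrow> equivalent_over (valuation_ring v) \<Phi> \<Phi>')
       \<and> stabiliser UNIV \<Phi> \<subseteq>
           generate (GL5_group UNIV \<times>\<times> GL5_group UNIV)
             (GL5 (valuation_ring v) \<times> GL5 (valuation_ring v) \<union> {(mat (inverse \<pi>), mat (\<pi>\<^sup>2))})"
proof -
  interpret discrete_valuation v
    by unfold_locales (rule assms(1))
  show ?thesis
  proof (intro conjI ballI impI)
    show "A \<in> scalar_GL5 \<O>" "B \<in> scalar_GL5 \<O>"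
      if "A \<in> GL5 UNIV" "B \<in> GL5 UNIV" "\<Phi>' = act A B \<Phi>" for A B
      using small_discriminant_scalar_GL5[OF assms(2,3) that(1,2) assms(4-7)[unfolded that(3)]] .
    show "equivalent_over \<O> \<Phi> \<Phi>'" if "equivalent_over UNIV \<Phi> \<Phi>'"
      using assms(2-7) that by (rule small_discriminant_equivalent_over)
    show "stabiliser UNIV \<Phi> \<subseteq> generate (GL5_group UNIV \<times>\<times> GL5_group UNIV)
        (GL5 \<O> \<times> GL5 \<O> \<union> {(mat (inverse \<pi>), mat (\<pi>\<^sup>2))})"
      using assms(2-4,6) by (rule small_discriminant_stabiliser)
  qed
qed

end
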